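(* Let $\lambda\in(0,1)$, $T>0$, let $f:\mathbb{R}\to\mathbb{R}$ be Lipschitz continuous, let $F$ be a numerical flux for $f$, let $u_0\in L^1(\mathbb{R})\cap BV(\mathbb{R})$, and let $u$ be a BV entropy solution of $$\partial_tu+\partial_xf(u)=g[u]\ \text{ in }Q_T=\mathbb{R}\times(0,T),\qquad u(\cdot,0)=u_0 .$$ (a) If $\tilde u$ is the solution of the implicit-explicit method, then there exists a constant $c_T>0$, independent of $\Delta x$ and $\Delta t$, such that $$\|u(\cdot,T)-\tilde u(\cdot,T)\|_{L^1(\mathbb{R})}\le c_T\sqrt{\Delta x}.$$ (b) If $\tilde u$ is the solution of the fully explicit method, then there exists a constant $c_T>0$, independent of $\Delta x$ and $\Delta t$, such that $$\|u(\cdot,T)-\tilde u(\cdot,T)\|_{L^1(\mathbb{R})}\le c_T\big(\sqrt{\Delta x}+\Delta x^{1-\lambda}\big).$$ In each case the corresponding CFL condition is assumed to hold and $T=N\Delta t$ for some $N\in\mathbb{N}$.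
   Context: Operator: $g[\varphi](x)=c_\lambda\int_{|z|>0}\frac{\varphi(x+z)-\varphi(x)}{|z|^{1+\lambda}}dz$ is the fractional Laplacian $-(-\partial_x^2)^{\lambda/2}$ acting in $x$, $c_\lambda>0$ its normalizing constant. BV entropy solution: for $k\in\mathbb{R}$ let $\eta_k(u)=|u-k|$, $\eta_k'(u)=\mathrm{sgn}(u-k)$, $q_k(u)=\eta_k'(u)(f(u)-f(k))$. A function $u\in L^\infty(Q_T)$ is a BV entropy solution if (i) $u\in C([0,T];L^1(\mathbb{R}))\cap L^\infty(0,T;BV(\mathbb{R}))$, and (ii) for all $k\in\mathbb{R}$ and all nonnegative $\varphi\in C_c^\infty(\mathbb{R}\times[0,T])$, $$\int_{Q_T}\big(\eta_k(u)\varphi_t+q_k(u)\varphi_x+\eta_k'(u)g[u]\varphi\big)dx\,dt+\int_{\mathbb{R}}\eta_k(u_0(x))\varphi(x,0)dx-\int_{\mathbb{R}}\eta_k(u(x,T))\varphi(x,T)dx\ge0.$$ Numerical flux: $F:\mathbb{R}\times\mathbb{R}\to\mathbb{R}$ is Lipschitz continuous, $F(a,a)=f(a)$ for all $a$, $F$ is non-decreasing in its first variable and non-increasing in its second variable. $F_1,F_2>0$ denote Lipschitz constants of $F$ with respect to its first and second variable. Grid: $\Delta x,\Delta t>0$, $x_i=i\Delta x$, $I_i=(x_i,x_{i+1})$, $i\in\mathbb{Z}$; $t_n=n\Delta t$. Put $G^i_j:=\int_{I_i}g[\mathbf{1}_{I_j}]\,dx$, $g\langle U\rangle_i:=\frac1{\Delta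 x}\sum_{j\in\mathbb{Z}}G^i_jU_j$, and $D_-F(U_i,U_{i+1}):=\frac1{\Delta x}\big(F(U_i,U_{i+1})-F(U_{i-1},U_i)\big)$. Both methods start from $U_i^0=\frac1{\Delta x}\int_{I_i}u_0(x)\,dx$. Implicit-explicit method: $U_i^{n+1}=U_i^n-\Delta t\,D_-F(U_i^n,U_{i+1}^n)+\Delta t\,g\langle U^{n+1}\rangle_i$, where $U^{n+1}$ is the unique solution in $\ell^\infty(\mathbb{Z})\cap\ell^1(\mathbb{Z})$. CFL condition: $(F_1+F_2)\frac{\Delta t}{\Delta x}\le1$. Fully explicit method: $U_i^{n+1}=U_i^n-\Delta t\,D_-F(U_i^n,U_{i+1}^n)+\Delta t\,g\langle U^n\rangle_i$. CFL condition: $(F_1+F_2)\frac{\Delta t}{\Delta x}+d_\lambda\frac{\Delta t}{\Delta x^\lambda}\le1$, with $d_\lambda:=c_\lambda\big(\int_{|z|<1}\frac{dz}{|z|^\lambda}+\int_{|z|>1}\frac{dz}{|z|^{1+\lambda}}\big)$. Interpolation: $\tilde u(x,t)=U_i^n$ for $(x,t)\in[x_i,x_{i+1})\times[t_n,t_{n+1})$; in particular $\tilde u(x,T)=U_i^N$ for $x\in[x_i,x_{i+1})$. *)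

theory Defs
  imports "HOL-Analysis.Analysis"
begin

section \<open>The fractional Laplacian\<close>

text \<open>The normalizing constant for which the operator below has Fourier symbol
  \<open>- \<bar>\<xi>\<bar> powr lam\<close>: applied to \<open>cos\<close> at the origin it gives \<open>-1\<close>.\<close>

definition frac_const :: "real \<Rightarrow> real" where
  "frac_const lam = 1 / (LINT z|lborel. (1 - cos z) / \<bar>z\<bar> powr (1 + lam))"

definition frac_lap :: "real \<Rightarrow> (real \<Rightarrow> real) \<Rightarrow> real \<Rightarrow> real" where
  "frac_lap lam \<phi> x =
     frac_const lam * (LINT z:{z. \<bar>z\<bar> > 0}|lborel. (\<phi> (x + z) - \<phi> x) / \<bar>z\<bar> powr (1 + lam))"


section \<open>Functions of bounded variation\<close>

text \<open>Essential (distributional) total variation, so that it depends only on the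
  Lebesgue class of \<open>w\<close>.\<close>

definition total_variation :: "(real \<Rightarrow> real) \<Rightarrow> ereal" where
  "total_variation w =
     (SUP \<phi> \<in> {\<phi>. \<phi> C1_differentiable_on UNIV \<and> compact (closure {x. \<phi> x \<noteq> 0}) \<and>
                   (\<forall>x. \<bar>\<phi> x\<bar> \<le> 1)}.
        ereal (LINT x|lborel. w x * deriv \<phi> x))"

definition BV :: "(real \<Rightarrow> real) set" where
  "BV = {w. integrable lborel w \<and> total_variation w < \<infinity>}"

definition BV_norm :: "(real \<Rightarrow> real) \<Rightarrow> ereal" where
  "BV_norm w = ereal (LINT x|lborel. \<bar>w x\<bar>) + total_variation w"


section \<open>Test functions\<close>

text \<open>Derivatives are taken within \<open>S\<close>. For \<open>S = UNIV \<times> {0..T}\<close> with \<open>T > 0\<close> (convex with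
  nonempty interior) they are unique, and one-sided in time on the boundary.\<close>

primrec higher_differentiable_on ::
    "('a::real_normed_vector) set \<Rightarrow> ('a \<Rightarrow> 'b::real_normed_vector) \<Rightarrow> nat \<Rightarrow> bool" where
  "higher_differentiable_on S f 0 \<longleftrightarrow> continuous_on S f"
| "higher_differentiable_on S f (Suc n) \<longleftrightarrow>
     f differentiable_on S \<and>
     (\<forall>v. higher_differentiable_on S (\<lambda>x. frechet_derivative f (at x within S) v) n)"

definition smooth_on ::
    "('a::real_normed_vector) set \<Rightarrow> ('a \<Rightarrow> 'b::real_normed_vector) \<Rightarrow> bool" where
  "smooth_on S f \<longleftrightarrow> (\<forall>n. higher_differentiable_on S f n)"

text \<open>Compactly supported smooth functions on the closed strip: they need not vanish at
  \<open>t = 0\<close> or \<open>t = T\<close>. Values outside the strip are irrelevant.\<close>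

definition test_functions :: "real \<Rightarrow> (real \<times> real \<Rightarrow> real) set" where
  "test_functions T =
     {\<phi>. smooth_on (UNIV \<times> {0..T}) \<phi> \<and> compact (closure {p \<in> UNIV \<times> {0..T}. \<phi> p \<noteq> 0})}"


section \<open>BV entropy solutions\<close>

definition Q :: "real \<Rightarrow> (real \<times> real) set" where
  "Q T = UNIV \<times> {0<..<T}"

definition eta :: "real \<Rightarrow> real \<Rightarrow> real" where
  "eta k u = \<bar>u - k\<bar>"

definition eta' :: "real \<Rightarrow> real \<Rightarrow> real" where
  "eta' k u = sgn (u - k)"

definition q :: "(real \<Rightarrow> real) \<Rightarrow> real \<Rightarrow> real \<Rightarrow> real" where
  "q f k u = eta' k u * (f u - f k)"

definition L_infinity :: "real \<Rightarrow> (real \<Rightarrow> real \<Rightarrow> real) \<Rightarrow> bool" where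
  "L_infinity T u \<longleftrightarrow>
     set_borel_measurable lborel (Q T) (\<lambda>(x, t). u x t) \<and>
     (\<exists>M. AE (x, t) in lborel. (x, t) \<in> Q T \<longrightarrow> \<bar>u x t\<bar> \<le> M)"

definition continuous_in_L1 :: "real \<Rightarrow> (real \<Rightarrow> real \<Rightarrow> real) \<Rightarrow> bool" where
  "continuous_in_L1 T u \<longleftrightarrow>
     (\<forall>t\<in>{0..T}. integrable lborel (\<lambda>x. u x t)) \<and>
     (\<forall>t\<in>{0..T}. ((\<lambda>s. LINT x|lborel. \<bar>u x s - u x t\<bar>) \<longlongrightarrow> 0) (at t within {0..T}))"

definition L_infinity_BV :: "real \<Rightarrow> (real \<Rightarrow> real \<Rightarrow> real) \<Rightarrow> bool" where
  "L_infinity_BV T u \<longleftrightarrow>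
     (\<exists>M. AE t in lborel. t \<in> {0<..<T} \<longrightarrow>
        (\<lambda>x. u x t) \<in> BV \<and> BV_norm (\<lambda>x. u x t) \<le> ereal M)"

text \<open>Here \<open>u x t\<close> is a Borel representative whose time slices, for every \<open>t\<close> in \<open>{0..T}\<close>,
  represent the values of the continuous curve in \<open>L\<^sup>1\<close>; in particular \<open>u x T\<close> is the trace
  at time \<open>T\<close>. The initial condition is part of the entropy inequality.\<close>

definition BV_entropy_solution ::
    "real \<Rightarrow> real \<Rightarrow> (real \<Rightarrow> real) \<Rightarrow> (real \<Rightarrow> real) \<Rightarrow> (real \<Rightarrow> real \<Rightarrow> real) \<Rightarrow> bool" where
  "BV_entropy_solution lam T f u0 u \<longleftrightarrow>
     L_infinity T u \<and> continuous_in_L1 T u \<and> L_infinity_BV T u \<and>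
     (\<forall>k. \<forall>\<phi>\<in>test_functions T. (\<forall>p\<in>UNIV \<times> {0..T}. \<phi> p \<ge> 0) \<longrightarrow>
        (LINT (x, t):Q T|lborel.
             eta k (u x t) * deriv (\<lambda>s. \<phi> (x, s)) t
           + q f k (u x t) * deriv (\<lambda>y. \<phi> (y, t)) x
           + eta' k (u x t) * frac_lap lam (\<lambda>y. u y t) x * \<phi> (x, t))
        + (LINT x|lborel. eta k (u0 x) * \<phi> (x, 0))
        - (LINT x|lborel. eta k (u x T) * \<phi> (x, T)) \<ge> 0)"


section \<open>The numerical methods\<close>

definition numerical_flux :: "(real \<Rightarrow> real) \<Rightarrow> (real \<Rightarrow> real \<Rightarrow> real) \<Rightarrow> bool" where
  "numerical_flux f F \<longleftrightarrow>
     (\<exists>L. L-lipschitz_on UNIV (\<lambda>(a, b). F a b)) \<and> (\<forall>a. F a a = f a) \<and>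
     (\<forall>b. mono (\<lambda>a. F a b)) \<and> (\<forall>a. antimono (\<lambda>b. F a b))"

definition cell :: "real \<Rightarrow> int \<Rightarrow> real set" where
  "cell \<Delta>x i = {of_int i * \<Delta>x <..< of_int (i + 1) * \<Delta>x}"

definition G :: "real \<Rightarrow> real \<Rightarrow> int \<Rightarrow> int \<Rightarrow> real" where
  "G lam \<Delta>x i j = (LINT x:cell \<Delta>x i|lborel. frac_lap lam (indicator (cell \<Delta>x j)) x)"

definition disc_frac_lap :: "real \<Rightarrow> real \<Rightarrow> (int \<Rightarrow> real) \<Rightarrow> int \<Rightarrow> real" where
  "disc_frac_lap lam \<Delta>x U i = 1 / \<Delta>x * (\<Sum>\<^sub>\<infinity>j. G lam \<Delta>x i j * U j)"

definition D_minus_flux :: "(real \<Rightarrow> real \<Rightarrow> real) \<Rightarrow> real \<Rightarrow> (int \<Rightarrow> real) \<Rightarrow> int \<Rightarrow> real" where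
  "D_minus_flux F \<Delta>x U i = 1 / \<Delta>x * (F (U i) (U (i + 1)) - F (U (i - 1)) (U i))"

definition initial_averages :: "real \<Rightarrow> (real \<Rightarrow> real) \<Rightarrow> int \<Rightarrow> real" where
  "initial_averages \<Delta>x u0 i = 1 / \<Delta>x * (LINT x:cell \<Delta>x i|lborel. u0 x)"

text \<open>\<open>U n i\<close> is the value at time level \<open>n\<close> in cell \<open>i\<close>, for \<open>n \<le> N\<close>.\<close>

definition imex_solution ::
    "real \<Rightarrow> (real \<Rightarrow> real \<Rightarrow> real) \<Rightarrow> (real \<Rightarrow> real) \<Rightarrow> real \<Rightarrow> real \<Rightarrow> nat \<Rightarrow>
     (nat \<Rightarrow> int \<Rightarrow> real) \<Rightarrow> bool" where
  "imex_solution lam F u0 \<Delta>x \<Delta>t N U \<longleftrightarrow>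
     U 0 = initial_averages \<Delta>x u0 \<and>
     (\<forall>n<N. bounded (range (U (Suc n))) \<and> (\<lambda>i. \<bar>U (Suc n) i\<bar>) summable_on UNIV \<and>
        (\<forall>i. U (Suc n) i =
           U n i - \<Delta>t * D_minus_flux F \<Delta>x (U n) i + \<Delta>t * disc_frac_lap lam \<Delta>x (U (Suc n)) i))"

definition explicit_solution ::
    "real \<Rightarrow> (real \<Rightarrow> real \<Rightarrow> real) \<Rightarrow> (real \<Rightarrow> real) \<Rightarrow> real \<Rightarrow> real \<Rightarrow> nat \<Rightarrow>
     (nat \<Rightarrow> int \<Rightarrow> real) \<Rightarrow> bool" where
  "explicit_solution lam F u0 \<Delta>x \<Delta>t N U \<longleftrightarrow>
     U 0 = initial_averages \<Delta>x u0 \<and>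
     (\<forall>n<N. \<forall>i. U (Suc n) i =
        U n i - \<Delta>t * D_minus_flux F \<Delta>x (U n) i + \<Delta>t * disc_frac_lap lam \<Delta>x (U n) i)"

definition d_const :: "real \<Rightarrow> real" where
  "d_const lam = frac_const lam *
     ((LINT z:{z. \<bar>z\<bar> < 1}|lborel. 1 / \<bar>z\<bar> powr lam) +
      (LINT z:{z. \<bar>z\<bar> > 1}|lborel. 1 / \<bar>z\<bar> powr (1 + lam)))"

definition interpolation ::
    "real \<Rightarrow> real \<Rightarrow> (nat \<Rightarrow> int \<Rightarrow> real) \<Rightarrow> real \<Rightarrow> real \<Rightarrow> real" where
  "interpolation \<Delta>x \<Delta>t U x t = U (nat \<lfloor>t / \<Delta>t\<rfloor>) \<lfloor>x / \<Delta>x\<rfloor>"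

text \<open>Values in \<open>ennreal\<close>, so that a finite bound entails integrability.\<close>

definition L1_dist :: "(real \<Rightarrow> real) \<Rightarrow> (real \<Rightarrow> real) \<Rightarrow> ennreal" where
  "L1_dist v w = (\<integral>\<^sup>+x. ennreal \<bar>v x - w x\<bar> \<partial>lborel)"

end

theory Submission
  imports Defs
begin

text \<open>
  Only the space variable is doubled. Put
  \<open>a\<^sub>n (t) = \<integral>\<integral> \<bar>u (x, t) - U\<^sup>n (y)\<bar> \<omega> (x - y) dx dy\<close> with a mollifier \<open>\<omega>\<close> of width \<open>\<surd>\<Delta>x\<close> and
  compare \<open>u\<close> at time \<open>t\<close> with \<^emph>\<open>every\<close> time level \<open>n\<close>. The entropy inequality for \<open>u\<close> with
  \<open>k = U\<^sup>n (y)\<close> and the discrete entropy inequality with \<open>k = u (x, t)\<close> add up to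
  \<open>a\<^sub>n' + (a\<^sub>n - a\<^bsub>n-1\<^esub>) / \<Delta>t \<le> E\<close> in the weak sense: the nonlocal terms have a sign, because
  \<open>\<omega> (x - y)\<close> is invariant under simultaneous translation, and the fluxes differ by \<open>E = O(\<surd>\<Delta>x)\<close>,
  because \<open>U\<^sup>n\<close> has bounded variation and is Lipschitz in time with values in \<open>L\<^sup>1\<close>.

  This differential-difference inequality is the one known from the generation theorem for nonlinear
  semigroups. Testing it with Poisson weights of mean \<open>T / \<Delta>t\<close> yields
  \<open>a\<^sub>N (T) \<le> a\<^sub>0 (0) + E T + O(\<surd>(T \<Delta>t))\<close>, and neither a mollifier in time nor the time regularity
  of \<open>u\<close> is needed. The explicit scheme differs from the implicit-explicit one by a perturbation of
  size \<open>O(\<Delta>x\<^bsup>1-lam\<^esup>)\<close>.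
\<close>

section \<open>Integration on the plane and translations in \<open>L\<^sup>1\<close>\<close>

text \<open>A mollifier in time would call for a modulus of continuity of u in time, and the
  solution is only known to be continuous in time with values in L^1, without a rate. Comparing
  every level with every time has its own difficulty at level 0: it has no predecessor, so no
  discrete inequality controls it, and a bound is needed that does not grow as the mollifier
  narrows. It comes from putting the derivative on the data of bounded variation instead of on the
  mollifier. Bounded variation enters through translation estimates in L^1. They make the singular
  integral converge, as min(|z|, 1) / |z|^(1+lam) is integrable for 0 < lam < 1, and they let a
  second difference of the mollifier be paid for with one derivative of it and one of the scheme. So
  mollifying with width r costs O(r) and consistency costs O(d / r) for mesh size d, which r = sqrt
  d balances. The CFL condition gives h = O(d), so that sqrt(T h) is of the same order.\<close>

abbreviation plane :: "(real \<times> real) measure" where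
  "plane \<equiv> lborel \<Otimes>\<^sub>M lborel"

abbreviation L1norm :: "(real \<Rightarrow> real) \<Rightarrow> real" where
  "L1norm w \<equiv> LINT x|lborel. \<bar>w x\<bar>"

section \<open>Changes of variables and Fubini\<close>

lemma integral_shift:
  fixes f :: "real \<Rightarrow> real"
  shows "(LINT x|lborel. f (x + a)) = (LINT x|lborel. f x)"
  using lborel_integral_real_affine[of 1 f a] by (simp add: add.commute)

lemma integrable_shift:
  fixes f :: "real \<Rightarrow> real"
  shows "integrable lborel f \<Longrightarrow> integrable lborel (\<lambda>x. f (x + a))"
  using lborel_integrable_real_affine[of f 1 a] by (simp add: add.commute)

lemma integral_reflect:
  fixes f :: "real \<Rightarrow> real"
  shows "(LINT x|lborel. f (a - x)) = (LINT x|lborel. f x)"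
  using lborel_integral_real_affine[of "-1" f a] by simp

lemma integrable_reflect:
  fixes f :: "real \<Rightarrow> real"
  shows "integrable lborel f \<Longrightarrow> integrable lborel (\<lambda>x. f (a - x))"
  using lborel_integrable_real_affine[of f "-1" a] by simp

lemma integral_shift_pair:
  fixes f :: "real \<times> real \<Rightarrow> real"
  assumes [measurable]: "f \<in> borel_measurable plane"
  shows "(LINT (x, y)|plane. f (x + a, y + b)) = (LINT p|plane. f p)"
proof -
  have f: "f \<in> borel_measurable borel" using assms by (simp add: lborel_prod)
  have "(LINT p|lborel. f p) = (LINT p|distr lborel borel ((+) (a, b)). f p)"
    by (simp add: lborel_distr_plus)
  also have "\<dots> = (LINT p|lborel. f ((a, b) + p))"
    by (rule integral_distr) (use f in auto)
  finally show ?thesis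
    by (simp add: lborel_prod case_prod_beta' add.commute plus_prod_def)
qed

text \<open>Triple integrals are iterated over the plane and the line. Both orders occur: (p, y) for
  the doubled entropy inequality, (z, p) for the singular integral.\<close>

interpretation lborel_pair_real: pair_sigma_finite
  "lborel \<Otimes>\<^sub>M lborel :: (real \<times> real) measure" "lborel :: real measure"
  unfolding lborel_prod ..

interpretation lborel_real_pair: pair_sigma_finite
  "lborel :: real measure" "lborel \<Otimes>\<^sub>M lborel :: (real \<times> real) measure"
  unfolding lborel_prod ..

text \<open>The bound is asked for almost every x only, because the slices of the solution are
  controlled for almost every time only.\<close>

lemma (in pair_sigma_finite) integrable_pair_bound:
  fixes f :: "'a \<times> 'b \<Rightarrow> real"
  assumes [measurable]: "f \<in> borel_measurable (M1 \<Otimes>\<^sub>M M2)"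
    and B: "AE x in M1. integrable M2 (\<lambda>y. f (x, y)) \<and> (LINT y|M2. \<bar>f (x, y)\<bar>) \<le> B x"
    and "integrable M1 B"
  shows "integrable (M1 \<Otimes>\<^sub>M M2) f"
proof (rule Fubini_integrable)
  show "integrable M1 (\<lambda>x. LINT y|M2. norm (f (x, y)))"
  proof (rule Bochner_Integration.integrable_bound[OF assms(3)])
    show "AE x in M1. norm (LINT y|M2. norm (f (x, y))) \<le> norm (B x)"
      using B by eventually_elim (auto simp: integral_nonneg_AE intro: order_trans)
  qed measurable
qed (use B in auto)

lemma (in pair_sigma_finite) integral_pair_bound:
  fixes f :: "'a \<times> 'b \<Rightarrow> real"
  assumes [measurable]: "f \<in> borel_measurable (M1 \<Otimes>\<^sub>M M2)"
    and B: "AE x in M1. integrable M2 (\<lambda>y. f (x, y)) \<and> (LINT y|M2. \<bar>f (x, y)\<bar>) \<le> B x"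
    and BI: "integrable M1 B"
  shows "\<bar>LINT p|(M1 \<Otimes>\<^sub>M M2). f p\<bar> \<le> (LINT x|M1. B x)"
proof -
  have f: "integrable (M1 \<Otimes>\<^sub>M M2) f" by (rule integrable_pair_bound[OF assms])
  have "\<bar>LINT p|(M1 \<Otimes>\<^sub>M M2). f p\<bar> \<le> (LINT p|(M1 \<Otimes>\<^sub>M M2). \<bar>f p\<bar>)"
    by (rule integral_abs_bound)
  also have "\<dots> = (LINT x|M1. LINT y|M2. \<bar>f (x, y)\<bar>)"
    using integral_fst'[of "\<lambda>p. \<bar>f p\<bar>"] f by simp
  also have "\<dots> \<le> (LINT x|M1. B x)"
    by (rule integral_mono_AE) (use integrable_fst'[of "\<lambda>p. \<bar>f p\<bar>"] f B BI in auto)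
  finally show ?thesis .
qed

section \<open>Integrals of convolution type\<close>

lemma conv_fst:
  fixes P K :: "real \<Rightarrow> real"
  assumes P: "integrable lborel P" and K: "integrable lborel K"
  shows "integrable plane (\<lambda>(x, y). P x * K (x - y))"
    and "(LINT (x, y)|plane. P x * K (x - y)) = (LINT x|lborel. P x) * (LINT x|lborel. K x)"
proof -
  have [measurable]: "P \<in> borel_measurable borel" "K \<in> borel_measurable borel"
    using P K by auto
  show *: "integrable plane (\<lambda>(x, y). P x * K (x - y))"
  proof (rule lborel_pair.integrable_pair_bound[where B="\<lambda>x. \<bar>P x\<bar> * (L1norm K)"])
    show "AE x in lborel. integrable lborel (\<lambda>y. case (x, y) of (x, y) \<Rightarrow> P x * K (x - y)) \<and>
       (LINT y|lborel. \<bar>case (x, y) of (x, y) \<Rightarrow> P x * K (x - y)\<bar>) \<le> \<bar>P x\<bar> * (L1norm K)"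
      using integrable_reflect[OF K] integral_reflect[of "\<lambda>x. \<bar>K x\<bar>"] by (auto simp: abs_mult)
  qed (use P in auto)
  show "(LINT (x, y)|plane. P x * K (x - y)) = (LINT x|lborel. P x) * (LINT x|lborel. K x)"
    using lborel_pair.integral_fst'[OF *] integral_reflect[of K] by simp
qed

lemma conv_snd:
  fixes P K :: "real \<Rightarrow> real"
  assumes P: "integrable lborel P" and K: "integrable lborel K"
  shows "integrable plane (\<lambda>(x, y). P y * K (x - y))"
    and "(LINT (x, y)|plane. P y * K (x - y)) = (LINT x|lborel. P x) * (LINT x|lborel. K x)"
proof -
  have K': "integrable lborel (\<lambda>x. K (- x))" "(LINT x|lborel. K (- x)) = (LINT x|lborel. K x)"
    using integrable_reflect[OF K, of 0] integral_reflect[of K 0] by auto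
  note c = conv_fst[OF P K'(1)]
  show "integrable plane (\<lambda>(x, y). P y * K (x - y))"
    using lborel_pair.integrable_product_swap[OF c(1)] by simp
  show "(LINT (x, y)|plane. P y * K (x - y)) = (LINT x|lborel. P x) * (LINT x|lborel. K x)"
    using lborel_pair.integral_product_swap[OF borel_measurable_integrable[OF c(1)]] c(2) K'(2) by simp
qed

text \<open>Doubled integrands are dominated by a function of one variable times a kernel in x - y,
  so that integrability on the plane reduces to L^1 norms on the line.\<close>

lemma conv_bound:
  fixes f :: "real \<times> real \<Rightarrow> real"
  assumes [measurable]: "f \<in> borel_measurable plane"
    and P: "integrable lborel P" and R: "integrable lborel R" and K: "integrable lborel K"
    and b: "\<And>x y. \<bar>f (x, y)\<bar> \<le> (P x + R y) * K (x - y)"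
  shows "integrable plane f"
    and "\<bar>LINT p|plane. f p\<bar> \<le> ((LINT x|lborel. P x) + (LINT x|lborel. R x)) * (LINT x|lborel. K x)"
    and "(LINT p|plane. \<bar>f p\<bar>) \<le> ((LINT x|lborel. P x) + (LINT x|lborel. R x)) * (LINT x|lborel. K x)"
proof -
  note c = conv_fst[OF P K] conv_snd[OF R K]
  have i: "integrable plane (\<lambda>(x, y). P x * K (x - y) + R y * K (x - y))"
    using Bochner_Integration.integrable_add[OF c(1,3)] by (simp add: case_prod_beta')
  show f: "integrable plane f"
    by (rule Bochner_Integration.integrable_bound[OF i])
       (use b in \<open>auto simp: algebra_simps intro!: AE_I2 order_trans[OF b]\<close>)
  have "(LINT p|plane. \<bar>f p\<bar>) \<le> (LINT (x, y)|plane. P x * K (x - y) + R y * K (x - y))"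
    by (rule integral_mono) (use f i b in \<open>auto simp: algebra_simps split: prod.splits\<close>)
  also have "\<dots> = ((LINT x|lborel. P x) + (LINT x|lborel. R x)) * (LINT x|lborel. K x)"
    using Bochner_Integration.integral_add[OF c(1,3)] c(2,4) by (simp add: case_prod_beta' algebra_simps)
  finally show **: "(LINT p|plane. \<bar>f p\<bar>) \<le> ((LINT x|lborel. P x) + (LINT x|lborel. R x)) * (LINT x|lborel. K x)" .
  show "\<bar>LINT p|plane. f p\<bar> \<le> ((LINT x|lborel. P x) + (LINT x|lborel. R x)) * (LINT x|lborel. K x)"
    using ** integral_abs_bound[of "plane" f] by linarith
qed

lemma abs_pair_conv:
  fixes w v K :: "real \<Rightarrow> real"
  assumes w: "integrable lborel w" and v: "integrable lborel v" and K: "integrable lborel K" "\<And>x. 0 \<le> K x"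
  shows "integrable plane (\<lambda>p. \<bar>w (fst p) - v (snd p)\<bar> * K (fst p - snd p))"
proof (rule conv_bound(1)[where P="\<lambda>x. \<bar>w x\<bar>" and R="\<lambda>x. \<bar>v x\<bar>" and K=K])
  have [measurable]: "w \<in> borel_measurable borel" "v \<in> borel_measurable borel" "K \<in> borel_measurable borel"
    using w v K by auto
  show "(\<lambda>p. \<bar>w (fst p) - v (snd p)\<bar> * K (fst p - snd p)) \<in> borel_measurable plane" by measurable
  show "\<bar>\<bar>w (fst (x, y)) - v (snd (x, y))\<bar> * K (fst (x, y) - snd (x, y))\<bar> \<le> (\<bar>w x\<bar> + \<bar>v y\<bar>) * K (x - y)" for x y
    using K(2)[of "x - y"] by (auto simp: abs_mult intro!: mult_right_mono)
qed (use w v K in auto)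

text \<open>\<open>\<theta>\<close> will be the sign of the difference of solution and scheme. The
  projection \<open>\<pi>\<close> lets one statement cover the terms that belong to the solution
  (\<open>fst\<close>) and those that belong to the scheme (\<open>snd\<close>).\<close>

lemma conv_weighted_integrable:
  fixes \<theta> K :: "_ \<Rightarrow> real" and \<pi> :: "real \<times> real \<Rightarrow> real"
  assumes P: "integrable lborel P" and K: "integrable lborel K"
    and \<theta>[measurable]: "\<theta> \<in> borel_measurable plane" and \<theta>1: "\<And>p. \<bar>\<theta> p\<bar> \<le> 1"
    and \<pi>: "\<pi> = fst \<or> \<pi> = snd"
  shows "integrable plane (\<lambda>p. \<theta> p * P (\<pi> p) * K (fst p - snd p))"
proof (rule conv_bound(1)[where P="\<lambda>x. \<bar>P x\<bar>" and R="\<lambda>x. \<bar>P x\<bar>" and K="\<lambda>x. \<bar>K x\<bar>"])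
  have [measurable]: "P \<in> borel_measurable borel" "K \<in> borel_measurable borel" using P K by auto
  have [measurable]: "\<pi> \<in> borel_measurable plane" using \<pi> by auto
  show "(\<lambda>p. \<theta> p * P (\<pi> p) * K (fst p - snd p)) \<in> borel_measurable plane" by measurable
  show "\<bar>\<theta> (x, y) * P (\<pi> (x, y)) * K (fst (x, y) - snd (x, y))\<bar> \<le> (\<bar>P x\<bar> + \<bar>P y\<bar>) * \<bar>K (x - y)\<bar>" for x y
  proof -
    have "\<bar>\<theta> (x, y)\<bar> * \<bar>P (\<pi> (x, y))\<bar> \<le> 1 * (\<bar>P x\<bar> + \<bar>P y\<bar>)" using \<pi> by (intro mult_mono \<theta>1) auto
    then show ?thesis unfolding abs_mult by (simp add: mult_right_mono)
  qed
qed (use P K in auto)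

lemma integrable_product:
  fixes k l :: "real \<Rightarrow> real"
  assumes k: "integrable lborel k" and l: "integrable lborel l"
  shows "integrable plane (\<lambda>(x, t). k x * l t)"
    and "(LINT (x, t)|plane. k x * l t) = (LINT x|lborel. k x) * (LINT t|lborel. l t)"
proof -
  have [measurable]: "k \<in> borel_measurable borel" "l \<in> borel_measurable borel" using k l by auto
  show i: "integrable plane (\<lambda>(x, t). k x * l t)"
    by (rule lborel_pair.integrable_pair_bound[where B="\<lambda>x. \<bar>k x\<bar> * (L1norm l)"])
       (use k l in \<open>auto simp: abs_mult\<close>)
  show "(LINT (x, t)|plane. k x * l t) = (LINT x|lborel. k x) * (LINT t|lborel. l t)"
    using lborel_pair.integral_fst'[OF i] by simp
qed

text \<open>For integrable \<open>w\<close> this says that the total variation is at most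
  \<open>M\<close>; the translation form is what the singular integral and the flux terms
  consume.\<close>

definition L1_lipschitz :: "real \<Rightarrow> (real \<Rightarrow> real) \<Rightarrow> bool" where
  "L1_lipschitz M w \<longleftrightarrow> integrable lborel w \<and> (\<forall>z. (LINT x|lborel. \<bar>w (x + z) - w x\<bar>) \<le> M * \<bar>z\<bar>)"

lemma L1_lipschitzD:
  assumes "L1_lipschitz M w"
  shows "integrable lborel w" "w \<in> borel_measurable borel"
    "(LINT x|lborel. \<bar>w (x + z) - w x\<bar>) \<le> M * \<bar>z\<bar>"
    "(LINT x|lborel. \<bar>w (x + z) - w x\<bar>) \<le> 2 * (L1norm w)" "0 \<le> M"
proof -
  show w: "integrable lborel w" and "w \<in> borel_measurable borel"
    and *: "(LINT x|lborel. \<bar>w (x + z) - w x\<bar>) \<le> M * \<bar>z\<bar>"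
    using assms by (auto simp: L1_lipschitz_def)
  have "(LINT x|lborel. \<bar>w (x + z) - w x\<bar>) \<le> (LINT x|lborel. \<bar>w (x + z)\<bar> + \<bar>w x\<bar>)"
    using w integrable_shift[OF w, of z] by (intro integral_mono) auto
  also have "\<dots> = 2 * (L1norm w)"
    using w integrable_shift[OF w, of z] integral_shift[of "\<lambda>x. \<bar>w x\<bar>" z] by simp
  finally show "(LINT x|lborel. \<bar>w (x + z) - w x\<bar>) \<le> 2 * (L1norm w)" .
  have "0 \<le> (LINT x|lborel. \<bar>w (x + 1) - w x\<bar>)" by simp
  also have "\<dots> \<le> M * \<bar>1\<bar>" using assms unfolding L1_lipschitz_def by blast
  finally show "0 \<le> M" by simp
qed

text \<open>Test functions enter the total variation through their derivative. The difference
  quotient of an antiderivative of \<open>\<phi>\<close> is an admissible test function, and its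
  derivative is a difference quotient of \<open>\<phi>\<close> itself; a change of variables moves
  that difference onto \<open>w\<close>.\<close>

lemma BV_duality:
  assumes w: "integrable lborel w" and tv: "total_variation w \<le> ereal M"
    and \<phi>: "continuous_on UNIV \<phi>" "\<And>x. \<bar>\<phi> x\<bar> \<le> 1" "\<And>x. n < \<bar>x\<bar> \<Longrightarrow> \<phi> x = 0"
  shows "(LINT x|lborel. (w (x + z) - w x) * \<phi> x) \<le> M * \<bar>z\<bar>"
proof (cases "z = 0")
  case False
  obtain P where P: "\<And>x. (P has_real_derivative \<phi> x) (at x)"
  proof -
    have "\<exists>F. \<forall>x::real. -\<infinity> < ereal x \<longrightarrow> ereal x < \<infinity> \<longrightarrow> (F has_vector_derivative \<phi> x) (at x)"
      by (rule einterval_antiderivative) (use \<phi>(1) in \<open>auto simp: continuous_on_eq_continuous_at\<close>)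
    then show ?thesis using that by (auto simp: has_real_derivative_iff_has_vector_derivative)
  qed
  \<comment> \<open>The intermediate point serves two purposes: it bounds \<open>\<psi>\<close> by
    1, and since it stays within distance |z| of x, it gives the compact support.\<close>
  have mvt: "\<exists>\<xi>. P (x - z) - P x = - z * \<phi> \<xi> \<and> \<bar>x\<bar> - \<bar>z\<bar> \<le> \<bar>\<xi>\<bar>" for x
  proof (cases "z > 0")
    case True
    then obtain \<xi> where "x - z < \<xi>" "\<xi> < x" "P x - P (x - z) = (x - (x - z)) * \<phi> \<xi>"
      using MVT2[of "x - z" x P \<phi>] P by auto
    then show ?thesis by (intro exI[of _ \<xi>]) auto
  next
    case neg: False
    then obtain \<xi> where "x < \<xi>" "\<xi> < x - z" "P (x - z) - P x = (x - z - x) * \<phi> \<xi>"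
      using MVT2[of x "x - z" P \<phi>] P False by auto
    then show ?thesis by (intro exI[of _ \<xi>]) auto
  qed
  define \<psi> where "\<psi> x = (P (x - z) - P x) / \<bar>z\<bar>" for x
  have D: "(\<psi> has_real_derivative (\<phi> (x - z) - \<phi> x) / \<bar>z\<bar>) (at x)" for x
    unfolding \<psi>_def
    by (rule DERIV_cdivide) (auto intro!: derivative_eq_intros P DERIV_chain2[where f=P and g="\<lambda>x. x - z", OF P])
  have c: "continuous_on UNIV (\<lambda>x. (\<phi> (x - z) - \<phi> x) / \<bar>z\<bar>)"
    by (intro continuous_intros continuous_on_compose2[OF \<phi>(1)] \<phi>(1)) (auto simp: False)
  have "\<psi> C1_differentiable_on UNIV"
    unfolding C1_differentiable_on_def
    by (rule exI[of _ "\<lambda>x. (\<phi> (x - z) - \<phi> x) / \<bar>z\<bar>"])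
       (use D c in \<open>auto simp: has_real_derivative_iff_has_vector_derivative\<close>)
  moreover have "\<bar>\<psi> x\<bar> \<le> 1" for x
    using mvt[of x] \<phi>(2) False by (auto simp: \<psi>_def abs_mult)
  moreover have "compact (closure {x. \<psi> x \<noteq> 0})"
  proof -
    have "{x. \<psi> x \<noteq> 0} \<subseteq> {- (\<bar>n\<bar> + \<bar>z\<bar>) .. \<bar>n\<bar> + \<bar>z\<bar>}"
    proof (rule subsetI, rule ccontr)
      fix x assume x: "x \<in> {x. \<psi> x \<noteq> 0}" "x \<notin> {- (\<bar>n\<bar> + \<bar>z\<bar>) .. \<bar>n\<bar> + \<bar>z\<bar>}"
      then have "\<bar>x\<bar> > \<bar>n\<bar> + \<bar>z\<bar>" by auto
      with mvt[of x] obtain \<xi> where \<xi>: "P (x - z) - P x = - z * \<phi> \<xi>" "\<bar>\<xi>\<bar> > \<bar>n\<bar>" by force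
      then have "\<phi> \<xi> = 0" using \<phi>(3)[of \<xi>] by linarith
      with \<xi> x show False by (auto simp: \<psi>_def)
    qed
    then have "bounded {x. \<psi> x \<noteq> 0}" by (rule bounded_subset[rotated]) auto
    then show ?thesis by (simp add: compact_closure)
  qed
  ultimately have "ereal (LINT x|lborel. w x * deriv \<psi> x) \<le> total_variation w"
    unfolding total_variation_def by (intro SUP_upper) auto
  with tv have "(LINT x|lborel. w x * deriv \<psi> x) \<le> M" using order_trans by fastforce
  moreover have "deriv \<psi> x = (\<phi> (x - z) - \<phi> x) / \<bar>z\<bar>" for x
    using D by (rule DERIV_imp_deriv)
  ultimately have 1: "(LINT x|lborel. w x * (\<phi> (x - z) - \<phi> x)) \<le> M * \<bar>z\<bar>"
    using False by (simp add: field_simps)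
  have [measurable]: "\<phi> \<in> borel_measurable borel" "w \<in> borel_measurable borel"
    using \<phi>(1) w by (auto intro: borel_measurable_continuous_onI)
  have i: "integrable lborel (\<lambda>x. w x * \<phi> (x + a))" for a
    by (rule Bochner_Integration.integrable_bound[OF w])
       (auto simp: abs_mult intro!: AE_I2 mult_left_le \<phi>(2))
  have i2: "integrable lborel (\<lambda>x. w (x + z) * \<phi> x)"
    using integrable_shift[OF i[of "-z"], of z] by simp
  have "(LINT x|lborel. (w (x + z) - w x) * \<phi> x) = (LINT x|lborel. w (x + z) * \<phi> x) - (LINT x|lborel. w x * \<phi> x)"
    using i[of 0] i2 by (simp add: left_diff_distrib)
  also have "(LINT x|lborel. w (x + z) * \<phi> x) = (LINT x|lborel. w x * \<phi> (x - z))"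
    using integral_shift[of "\<lambda>x. w x * \<phi> (x - z)" z] by simp
  also have "(LINT x|lborel. w x * \<phi> (x - z)) - (LINT x|lborel. w x * \<phi> x) = (LINT x|lborel. w x * (\<phi> (x - z) - \<phi> x))"
    using i[of 0] i[of "-z"] by (simp add: right_diff_distrib)
  finally show ?thesis using 1 by simp
qed simp

text \<open>The supremum over continuous \<open>\<phi>\<close> in the duality bound is attained in the limit: \<open>sgn D\<close> is an
  almost everywhere limit of continuous functions, which are truncated to \<open>[-1, 1]\<close> and cut off.\<close>

lemma BV_imp_L1_lipschitz:
  assumes w: "integrable lborel w" and tv: "total_variation w \<le> ereal M"
  shows "L1_lipschitz M w"
  unfolding L1_lipschitz_def
proof (intro conjI allI w)
  fix z
  define D where "D x = w (x + z) - w x" for x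
  have D: "integrable lborel D" unfolding D_def using w integrable_shift[OF w] by auto
  then have [measurable]: "D \<in> borel_measurable borel" by simp
  have "(\<lambda>x. sgn (D x)) measurable_on UNIV"
    by (rule lebesgue_measurable_imp_measurable_on) (auto intro!: measurable_completion)
  then obtain N g where N: "negligible N" and g: "\<And>n. continuous_on UNIV (g n)"
    and lim: "\<And>x. x \<notin> N \<Longrightarrow> (\<lambda>n. g n x) \<longlonglongrightarrow> sgn (D x)"
    unfolding measurable_on_def by auto
  define \<phi> where "\<phi> n x = max 0 (min 1 (real n + 1 - \<bar>x\<bar>)) * max (-1) (min 1 (g n x))" for n x
  have cont: "continuous_on UNIV (\<phi> n)" for n
    unfolding \<phi>_def by (intro continuous_intros g)
  then have [measurable]: "\<phi> n \<in> borel_measurable borel" for n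
    by (rule borel_measurable_continuous_onI)
  have le1: "\<bar>\<phi> n x\<bar> \<le> 1" for n x
    unfolding \<phi>_def abs_mult by (rule mult_le_one) auto
  have sup: "\<phi> n x = 0" if "real n + 1 < \<bar>x\<bar>" for n x
    using that by (auto simp: \<phi>_def)
  have "(LINT x|lborel. D x * \<phi> n x) \<le> M * \<bar>z\<bar>" for n
    unfolding D_def by (rule BV_duality[OF w tv cont le1 sup])
  moreover have "(\<lambda>n. LINT x|lborel. D x * \<phi> n x) \<longlonglongrightarrow> (L1norm D)"
  proof (rule integral_dominated_convergence[where w="\<lambda>x. \<bar>D x\<bar>"])
    show "AE x in lborel. (\<lambda>n. D x * \<phi> n x) \<longlonglongrightarrow> \<bar>D x\<bar>"
    proof -
      \<comment> \<open>\<open>N\<close> is a null set of the completed measure, and need not be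
        Borel.\<close>
      have "AE x in lborel. x \<notin> N"
        using N by (metis AE_completion_iff AE_not_in negligible_iff_null_sets)
      then show ?thesis
      proof eventually_elim
        case (elim x)
        have "eventually (\<lambda>n. max 0 (min 1 (real n + 1 - \<bar>x\<bar>)) = 1) sequentially"
          using eventually_ge_at_top[of "nat \<lceil>\<bar>x\<bar>\<rceil>"] by eventually_elim linarith
        then have a: "(\<lambda>n. max 0 (min 1 (real n + 1 - \<bar>x\<bar>))) \<longlonglongrightarrow> 1"
          by (rule tendsto_eventually)
        have "(\<lambda>n. D x * \<phi> n x) \<longlonglongrightarrow> D x * (1 * max (-1) (min 1 (sgn (D x))))"
          unfolding \<phi>_def by (intro tendsto_intros a lim elim)
        moreover have "D x * (1 * max (-1) (min 1 (sgn (D x)))) = \<bar>D x\<bar>"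
          by (auto simp: sgn_if)
        ultimately show ?case by simp
      qed
    qed
    show "AE x in lborel. norm (D x * \<phi> n x) \<le> \<bar>D x\<bar>" for n
      using le1[of n] by (auto simp: abs_mult intro!: mult_left_le)
  qed (use D in auto)
  ultimately show "(LINT x|lborel. \<bar>w (x + z) - w x\<bar>) \<le> M * \<bar>z\<bar>"
    unfolding D_def[symmetric] by (intro LIMSEQ_le_const2) auto
qed

section \<open>The fractional Laplacian on functions that are Lipschitz in \<open>L\<^sup>1\<close>\<close>

text \<open>An increment by z is at most M |z| in L^1, and at most twice the L^1 norm. The minimum
  of the two, divided by the singular kernel, is integrable near 0 because lam < 1 and at infinity
  because lam > 0.\<close>

definition min_kernel :: "real \<Rightarrow> real \<Rightarrow> real" where
  "min_kernel lam z = min \<bar>z\<bar> 1 / \<bar>z\<bar> powr (1 + lam)"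

lemma min_kernel_nonneg: "0 \<le> min_kernel lam z"
  by (simp add: min_kernel_def)

lemma min_kernel_measurable [measurable]: "min_kernel lam \<in> borel_measurable borel"
  unfolding min_kernel_def[abs_def] by measurable

lemma min_kernel_small: "\<bar>z\<bar> \<le> 1 \<Longrightarrow> min_kernel lam z = \<bar>z\<bar> powr (- lam)"
  by (cases "z = 0") (auto simp: min_kernel_def powr_minus powr_add divide_simps)

lemma min_kernel_large: "\<bar>z\<bar> \<ge> 1 \<Longrightarrow> min_kernel lam z = \<bar>z\<bar> powr (- 1 - lam)"
  using powr_minus[of "\<bar>z\<bar>" "1 + lam"] by (auto simp: min_kernel_def divide_simps)

lemma integrable_min_kernel:
  assumes "0 < lam" "lam < 1"
  shows "integrable lborel (min_kernel lam)"
proof -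
  have "min_kernel lam integrable_on {0..1}"
    by (rule integrable_eq[OF integrable_on_powr_from_0[of "- lam" 1]])
       (use assms in \<open>auto simp: min_kernel_small\<close>)
  moreover have "min_kernel lam integrable_on {1..}"
    by (rule integrable_eq[OF has_integral_integrable[OF has_integral_powr_to_inf[of "-1-lam" 1]]])
       (use assms in \<open>auto simp: min_kernel_large\<close>)
  moreover have "{0..1} \<inter> {1..} = {1::real}" "{0..1} \<union> {1..} = {0::real..}" by auto
  ultimately have "min_kernel lam integrable_on {0..}"
    using integrable_Un[of "{0..1::real}" "{1..}" "min_kernel lam"] by simp
  then have "min_kernel lam absolutely_integrable_on {0..}"
    by (rule nonnegative_absolutely_integrable_1) (simp add: min_kernel_nonneg)
  then have i: "integrable lborel (\<lambda>z. indicator {0..} z * min_kernel lam z)"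
    unfolding set_integrable_def by (subst (asm) integrable_completion) auto
  have "integrable lborel (\<lambda>z. indicator {0..} z * min_kernel lam z + indicator {0..} (- z) * min_kernel lam (- z))"
    using i integrable_reflect[OF i, of 0] by auto
  then show ?thesis
  proof (rule Bochner_Integration.integrable_bound)
    have "min_kernel lam (- z) = min_kernel lam z" for z by (simp add: min_kernel_def)
    then show "AE x in lborel. norm (min_kernel lam x) \<le> norm (indicat_real {0..} x * min_kernel lam x +
                  indicat_real {0..} (- x) * min_kernel lam (- x))"
      using min_kernel_nonneg[of lam] by (auto simp: indicator_def)
  qed simp
qed

definition kernel_mass :: "real \<Rightarrow> real" where
  "kernel_mass lam = (LINT z|lborel. min_kernel lam z)"

lemma kernel_mass_nonneg: "0 \<le> kernel_mass lam"
  unfolding kernel_mass_def by (simp add: min_kernel_nonneg)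

text \<open>True for every \<open>lam\<close>: the integrand is nonnegative, and a divergent
  integral has the value 0, whose reciprocal is 0.\<close>

lemma frac_const_nonneg: "0 \<le> frac_const lam"
  unfolding frac_const_def by (simp add: integral_nonneg_AE)

text \<open>Identifies the constant of the CFL condition with the integral that gives the diagonal
  entries of \<open>G\<close>.\<close>

lemma d_const_eq:
  assumes "0 < lam" "lam < 1"
  shows "d_const lam = frac_const lam * kernel_mass lam"
proof -
  note i = integrable_min_kernel[OF assms]
  have "indicator {z. \<bar>z\<bar> < 1} z *\<^sub>R (1 / \<bar>z\<bar> powr lam) = indicator {z. \<bar>z\<bar> < 1} z * min_kernel lam z" for z
    by (auto simp: indicator_def min_kernel_small powr_minus divide_simps)
  moreover have "indicator {z. \<bar>z\<bar> > 1} z *\<^sub>R (1 / \<bar>z\<bar> powr (1 + lam)) = indicator {z. \<bar>z\<bar> > 1} z * min_kernel lam z" for z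
    by (auto simp: indicator_def min_kernel_def)
  moreover have "integrable lborel (\<lambda>z. indicator {z. \<bar>z\<bar> < 1} z * min_kernel lam z)"
    "integrable lborel (\<lambda>z. indicator {z. \<bar>z\<bar> > 1} z * min_kernel lam z)"
    using integrable_mult_indicator[OF _ i, of "{z. \<bar>z\<bar> < 1}"] integrable_mult_indicator[OF _ i, of "{z. \<bar>z\<bar> > 1}"]
    by auto
  moreover have "(LINT z|lborel. indicator {z. \<bar>z\<bar> < 1} z * min_kernel lam z + indicator {z. \<bar>z\<bar> > 1} z * min_kernel lam z)
      = kernel_mass lam"
    unfolding kernel_mass_def
  proof (rule integral_cong_AE)
    have "AE z in lborel. z \<noteq> 1" "AE z in lborel. z \<noteq> (-1::real)"
      by (rule AE_lborel_singleton)+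
    then show "AE z in lborel. indicator {z. \<bar>z\<bar> < 1} z * min_kernel lam z + indicator {z. \<bar>z\<bar> > 1} z * min_kernel lam z
      = min_kernel lam z"
      by eventually_elim (auto simp: indicator_def)
  qed auto
  ultimately show ?thesis
    unfolding d_const_def set_lebesgue_integral_def by simp
qed

lemma d_const_nonneg: "0 < lam \<Longrightarrow> lam < 1 \<Longrightarrow> 0 \<le> d_const lam"
  by (simp add: d_const_eq frac_const_nonneg kernel_mass_nonneg)

text \<open>min(|z|, d) is the length of the part of a cell that leaves the cell under translation
  by z; this integral will be the diagonal of \<open>G\<close> up to sign and
  \<open>frac_const\<close>.\<close>

lemma min_kernel_scaling:
  assumes "0 < d"
  shows "(LINT z|lborel. min \<bar>z\<bar> d / \<bar>z\<bar> powr (1 + lam)) = d powr (1 - lam) * kernel_mass lam"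
proof -
  have "min \<bar>d * z\<bar> d / \<bar>d * z\<bar> powr (1 + lam) = d powr (- lam) * min_kernel lam z" for z
  proof -
    have "min \<bar>d * z\<bar> d = d * min \<bar>z\<bar> 1" using assms
      by (auto simp: min_def abs_mult mult_le_cancel_left2)
    then show ?thesis using assms
      by (simp add: min_kernel_def abs_mult powr_mult powr_add powr_minus divide_simps)
  qed
  then have "(LINT z|lborel. min \<bar>d * z\<bar> d / \<bar>d * z\<bar> powr (1 + lam)) = d powr (- lam) * kernel_mass lam"
    by (simp only: kernel_mass_def integral_mult_right_zero)
  note * = this
  have "(LINT z|lborel. min \<bar>z\<bar> d / \<bar>z\<bar> powr (1 + lam))
      = \<bar>d\<bar> *\<^sub>R (LINT z|lborel. min \<bar>0 + d * z\<bar> d / \<bar>0 + d * z\<bar> powr (1 + lam))"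
    by (rule lborel_integral_real_affine) (use assms in simp)
  also have "\<dots> = d * (d powr (- lam) * kernel_mass lam)"
    unfolding add_0_left * using assms by simp
  also have "\<dots> = d powr (1 - lam) * kernel_mass lam"
    using assms by (simp add: powr_diff powr_minus divide_simps)
  finally show ?thesis .
qed

lemma frac_lap_eq:
  "frac_lap lam \<phi> x = frac_const lam * (LINT z|lborel. (\<phi> (x + z) - \<phi> x) / \<bar>z\<bar> powr (1 + lam))"
proof -
  have "indicator {z. 0 < \<bar>z\<bar>} z *\<^sub>R ((\<phi> (x + z) - \<phi> x) / \<bar>z\<bar> powr (1 + lam)) = (\<phi> (x + z) - \<phi> x) / \<bar>z\<bar> powr (1 + lam)" for z
    by (auto simp: indicator_def)
  then show ?thesis by (simp only: frac_lap_def set_lebesgue_integral_def)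
qed

lemma increment_bound:
  assumes "L1_lipschitz M w"
  shows "(LINT x|lborel. \<bar>w (x + z) - w x\<bar>) / \<bar>z\<bar> powr (1 + lam)
    \<le> (M + 2 * (L1norm w)) * min_kernel lam z"
proof -
  note w = L1_lipschitzD[OF assms]
  let ?A = "LINT x|lborel. \<bar>w x\<bar>"
  have A: "0 \<le> ?A" by simp
  have "(LINT x|lborel. \<bar>w (x + z) - w x\<bar>) \<le> (M + 2 * ?A) * min \<bar>z\<bar> 1"
  proof (cases "\<bar>z\<bar> \<le> 1")
    case True
    have "M * \<bar>z\<bar> \<le> (M + 2 * ?A) * \<bar>z\<bar>" using A by (intro mult_right_mono) auto
    with w(3)[of z] True show ?thesis by (simp add: min_def)
  next
    case False
    with w(4)[of z] w(5) A show ?thesis by (simp add: min_def)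
  qed
  then show ?thesis
    unfolding min_kernel_def times_divide_eq_right by (rule divide_right_mono) simp
qed

lemma frac_increment_integrable:
  assumes lam: "0 < lam" "lam < 1" and w: "L1_lipschitz M w"
  shows "integrable plane (\<lambda>(z, x). (w (x + z) - w x) / \<bar>z\<bar> powr (1 + lam))"
proof (rule lborel_pair.integrable_pair_bound[where B="\<lambda>z. (M + 2 * (L1norm w)) * min_kernel lam z"])
  have [measurable]: "w \<in> borel_measurable borel" using L1_lipschitzD[OF w] by auto
  show "(\<lambda>(z, x). (w (x + z) - w x) / \<bar>z\<bar> powr (1 + lam)) \<in> borel_measurable plane"
    by measurable
  show "integrable lborel (\<lambda>z. (M + 2 * (L1norm w)) * min_kernel lam z)"
    using integrable_min_kernel[OF lam] by simp
  show "AE z in lborel. integrable lborel (\<lambda>x. case (z, x) of (z, x) \<Rightarrow> (w (x + z) - w x) / \<bar>z\<bar> powr (1 + lam)) \<and>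
     (LINT x|lborel. \<bar>case (z, x) of (z, x) \<Rightarrow> (w (x + z) - w x) / \<bar>z\<bar> powr (1 + lam)\<bar>)
       \<le> (M + 2 * (L1norm w)) * min_kernel lam z"
    using L1_lipschitzD(1)[OF w] integrable_shift[OF L1_lipschitzD(1)[OF w]] increment_bound[OF w]
    by (auto simp: abs_divide)
qed

text \<open>Fubini brings the x-integral inside, where the increments are small in L^1 and have
  integral 0 by translation invariance. The third claim is conservation of mass; the vanishing
  column sums of \<open>G\<close> are inherited from it.\<close>

lemma
  assumes lam: "0 < lam" "lam < 1" and w: "L1_lipschitz M w"
  shows integrable_frac_lap: "integrable lborel (frac_lap lam w)"
    and frac_lap_L1_bound: "(LINT x|lborel. \<bar>frac_lap lam w x\<bar>)
      \<le> frac_const lam * ((M + 2 * (L1norm w)) * kernel_mass lam)"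
    and integral_frac_lap: "(LINT x|lborel. frac_lap lam w x) = 0"
proof -
  note i = frac_increment_integrable[OF assms]
  note w1 = L1_lipschitzD(1)[OF w]
  have feq: "frac_lap lam w = (\<lambda>x. frac_const lam * (LINT z|lborel. (w (x + z) - w x) / \<bar>z\<bar> powr (1 + lam)))"
    by (rule ext) (rule frac_lap_eq)
  have i1: "integrable lborel (\<lambda>x. LINT z|lborel. (w (x + z) - w x) / \<bar>z\<bar> powr (1 + lam))"
    using lborel_pair.integrable_fst'[OF lborel_pair.integrable_product_swap[OF i]] by simp
  then show "integrable lborel (frac_lap lam w)"
    unfolding feq by auto
  have "(LINT x|lborel. LINT z|lborel. (w (x + z) - w x) / \<bar>z\<bar> powr (1 + lam))
      = (LINT z|lborel. LINT x|lborel. (w (x + z) - w x) / \<bar>z\<bar> powr (1 + lam))"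
    by (rule lborel_pair.Fubini_integral) (use i in simp)
  also have "\<dots> = 0"
    using w1 integrable_shift[OF w1] integral_shift[of w] by simp
  finally show "(LINT x|lborel. frac_lap lam w x) = 0"
    unfolding feq by simp
  have ia: "integrable plane (\<lambda>(z, x). \<bar>w (x + z) - w x\<bar> / \<bar>z\<bar> powr (1 + lam))"
    using integrable_norm[OF i] by (simp add: case_prod_beta' abs_divide)
  have "(LINT x|lborel. \<bar>LINT z|lborel. (w (x + z) - w x) / \<bar>z\<bar> powr (1 + lam)\<bar>)
      \<le> (LINT x|lborel. LINT z|lborel. \<bar>w (x + z) - w x\<bar> / \<bar>z\<bar> powr (1 + lam))"
  proof (rule integral_mono)
    show "integrable lborel (\<lambda>x. LINT z|lborel. \<bar>w (x + z) - w x\<bar> / \<bar>z\<bar> powr (1 + lam))"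
      using lborel_pair.integrable_fst'[OF lborel_pair.integrable_product_swap[OF ia]] by simp
    show "\<bar>LINT z|lborel. (w (x + z) - w x) / \<bar>z\<bar> powr (1 + lam)\<bar>
      \<le> (LINT z|lborel. \<bar>w (x + z) - w x\<bar> / \<bar>z\<bar> powr (1 + lam))" for x
      using integral_abs_bound[of lborel "\<lambda>z. (w (x + z) - w x) / \<bar>z\<bar> powr (1 + lam)"] by (simp add: abs_divide)
  qed (use i1 in auto)
  also have "\<dots> = (LINT z|lborel. LINT x|lborel. \<bar>w (x + z) - w x\<bar> / \<bar>z\<bar> powr (1 + lam))"
    by (rule lborel_pair.Fubini_integral) (use ia in simp)
  also have "\<dots> \<le> (LINT z|lborel. (M + 2 * (L1norm w)) * min_kernel lam z)"
    using increment_bound[OF w] integrable_min_kernel[OF lam] lborel_pair.integrable_fst'[OF ia]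
    by (intro integral_mono) auto
  also have "\<dots> = (M + 2 * (L1norm w)) * kernel_mass lam"
    by (simp add: kernel_mass_def)
  finally show "(LINT x|lborel. \<bar>frac_lap lam w x\<bar>)
      \<le> frac_const lam * ((M + 2 * (L1norm w)) * kernel_mass lam)"
    unfolding feq using frac_const_nonneg[of lam] by (simp add: abs_mult mult_left_mono)
qed

text \<open>Pulls the z-integral out of the doubled integral, so that dissipativity can be checked
  for each z separately.\<close>

lemma frac_lap_weighted:
  fixes \<theta> K :: "_ \<Rightarrow> real" and \<pi> :: "real \<times> real \<Rightarrow> real"
  assumes lam: "0 < lam" "lam < 1" and w: "L1_lipschitz M w"
    and K: "integrable lborel K" "\<And>x. 0 \<le> K x"
    and \<theta>[measurable]: "\<theta> \<in> borel_measurable plane" and \<theta>1: "\<And>p. \<bar>\<theta> p\<bar> \<le> 1"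
    and \<pi>: "\<pi> = fst \<or> \<pi> = snd"
  shows "integrable lborel (\<lambda>z. LINT p|plane. \<theta> p * ((w (\<pi> p + z) - w (\<pi> p)) / \<bar>z\<bar> powr (1 + lam)) * K (fst p - snd p))"
    and "(LINT p|plane. \<theta> p * frac_lap lam w (\<pi> p) * K (fst p - snd p))
      = frac_const lam * (LINT z|lborel. LINT p|plane. \<theta> p * ((w (\<pi> p + z) - w (\<pi> p)) / \<bar>z\<bar> powr (1 + lam)) * K (fst p - snd p))"
proof -
  note wD = L1_lipschitzD[OF w]
  have [measurable]: "w \<in> borel_measurable borel" "K \<in> borel_measurable borel" using wD K(1) by auto
  have [measurable]: "\<pi> \<in> borel_measurable plane" using \<pi> by auto
  define H where "H z p = \<theta> p * ((w (\<pi> p + z) - w (\<pi> p)) / \<bar>z\<bar> powr (1 + lam)) * K (fst p - snd p)" for z p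
  have meas: "(\<lambda>(z, p). H z p) \<in> borel_measurable (lborel \<Otimes>\<^sub>M plane)"
    unfolding H_def by measurable
  have b: "integrable plane (H z) \<and> (LINT p|plane. \<bar>H z p\<bar>)
      \<le> 2 * (M + 2 * (L1norm w)) * (LINT x|lborel. K x) * min_kernel lam z" for z
  proof -
    let ?P = "\<lambda>x. \<bar>w (x + z) - w x\<bar> / \<bar>z\<bar> powr (1 + lam)"
    have P: "integrable lborel ?P" using wD(1) integrable_shift[OF wD(1)] by auto
    have Hm: "H z \<in> borel_measurable plane"
      unfolding H_def[abs_def] by measurable
    have bb: "\<bar>H z (x, y)\<bar> \<le> (?P x + ?P y) * K (x - y)" for x y
    proof -
      have "\<bar>(w (\<pi> (x, y) + z) - w (\<pi> (x, y))) / \<bar>z\<bar> powr (1 + lam)\<bar> \<le> ?P x + ?P y"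
        using \<pi> by (auto simp: abs_divide)
      then have "\<bar>\<theta> (x, y)\<bar> * \<bar>(w (\<pi> (x, y) + z) - w (\<pi> (x, y))) / \<bar>z\<bar> powr (1 + lam)\<bar> \<le> 1 * (?P x + ?P y)"
        by (intro mult_mono \<theta>1) auto
      from mult_right_mono[OF this K(2)[of "x - y"]] show ?thesis
        unfolding H_def abs_mult using K(2)[of "x - y"] by simp
    qed
    have PP: "(LINT x|lborel. ?P x) \<le> (M + 2 * (L1norm w)) * min_kernel lam z"
      using increment_bound[OF w, of z lam] by simp
    note cb = conv_bound[OF Hm P P K(1) bb]
    have "(LINT p|plane. \<bar>H z p\<bar>) \<le> ((LINT x|lborel. ?P x) + (LINT x|lborel. ?P x)) * (LINT x|lborel. K x)"
      by (rule cb(3))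
    also have "\<dots> \<le> ((M + 2 * (L1norm w)) * min_kernel lam z + (M + 2 * (L1norm w)) * min_kernel lam z) * (LINT x|lborel. K x)"
      by (intro mult_right_mono add_mono PP integral_nonneg_AE) (use K in auto)
    finally show ?thesis using cb(1) by (simp add: algebra_simps)
  qed
  have i: "integrable (lborel \<Otimes>\<^sub>M plane) (\<lambda>(z, p). H z p)"
    by (rule lborel_real_pair.integrable_pair_bound[OF meas,
          where B="\<lambda>z. 2 * (M + 2 * (L1norm w)) * (LINT x|lborel. K x) * min_kernel lam z"])
       (use b integrable_min_kernel[OF lam] in auto)
  show "integrable lborel (\<lambda>z. LINT p|plane. \<theta> p * ((w (\<pi> p + z) - w (\<pi> p)) / \<bar>z\<bar> powr (1 + lam)) * K (fst p - snd p))"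
    using lborel_real_pair.integrable_fst'[OF i] by (simp add: H_def)
  have "(LINT p|plane. \<theta> p * frac_lap lam w (\<pi> p) * K (fst p - snd p))
     = (LINT p|plane. frac_const lam * (LINT z|lborel. H z p))"
  proof (rule Bochner_Integration.integral_cong[OF refl])
    fix p :: "real \<times> real"
    have "(LINT z|lborel. H z p) = \<theta> p * (LINT z|lborel. (w (\<pi> p + z) - w (\<pi> p)) / \<bar>z\<bar> powr (1 + lam)) * K (fst p - snd p)"
      unfolding H_def by (simp only: integral_mult_right_zero integral_mult_left_zero)
    then show "\<theta> p * frac_lap lam w (\<pi> p) * K (fst p - snd p) = frac_const lam * (LINT z|lborel. H z p)"
      by (simp only: frac_lap_eq mult_ac)
  qed
  also have "\<dots> = frac_const lam * (LINT z|lborel. LINT p|plane. H z p)"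
    using lborel_real_pair.Fubini_integral[of H] i by simp
  finally show "(LINT p|plane. \<theta> p * frac_lap lam w (\<pi> p) * K (fst p - snd p))
      = frac_const lam * (LINT z|lborel. LINT p|plane. \<theta> p * ((w (\<pi> p + z) - w (\<pi> p)) / \<bar>z\<bar> powr (1 + lam)) * K (fst p - snd p))"
    by (simp add: H_def)
qed

text \<open>The doubled variables are translated simultaneously by \<open>z\<close>, which leaves both Lebesgue
  measure and the weight \<open>K (x - y)\<close> unchanged.\<close>

lemma frac_lap_dissipative:
  assumes lam: "0 < lam" "lam < 1" and w: "L1_lipschitz M w" and v: "L1_lipschitz B v"
    and K: "integrable lborel K" "\<And>x. 0 \<le> K x"
  shows "(LINT (x, y)|plane. sgn (w x - v y) * (frac_lap lam w x - frac_lap lam v y) * K (x - y)) \<le> 0"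
proof -
  note wD = L1_lipschitzD[OF w] and vD = L1_lipschitzD[OF v]
  have [measurable]: "w \<in> borel_measurable borel" "v \<in> borel_measurable borel" "K \<in> borel_measurable borel" using wD vD K(1) by auto
  define \<theta> :: "real \<times> real \<Rightarrow> real" where "\<theta> p = sgn (w (fst p) - v (snd p))" for p
  have \<theta>[measurable]: "\<theta> \<in> borel_measurable plane" unfolding \<theta>_def[abs_def] by measurable
  have \<theta>1: "\<bar>\<theta> p\<bar> \<le> 1" for p by (auto simp: \<theta>_def sgn_if)
  define I where "I u \<pi> z = (LINT p|plane. \<theta> p * ((u (\<pi> p + z) - u (\<pi> p)) / \<bar>z\<bar> powr (1 + lam)) * K (fst p - snd p))"
    for u :: "real \<Rightarrow> real" and \<pi> :: "real \<times> real \<Rightarrow> real" and z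
  have fw: "integrable lborel (I w fst)" "(LINT p|plane. \<theta> p * frac_lap lam w (fst p) * K (fst p - snd p)) = frac_const lam * (LINT z|lborel. I w fst z)"
    unfolding I_def[abs_def] by (rule frac_lap_weighted[OF lam w K \<theta> \<theta>1, of fst, OF disjI1[OF refl]])+
  have fv: "integrable lborel (I v snd)" "(LINT p|plane. \<theta> p * frac_lap lam v (snd p) * K (fst p - snd p)) = frac_const lam * (LINT z|lborel. I v snd z)"
    unfolding I_def[abs_def] by (rule frac_lap_weighted[OF lam v K \<theta> \<theta>1, of snd, OF disjI2[OF refl]])+
  have le: "I w fst z - I v snd z \<le> 0" for z
  proof -
    have sw: "integrable lborel (\<lambda>x. (w (x + z) - w x) / \<bar>z\<bar> powr (1 + lam))" "integrable lborel (\<lambda>x. (v (x + z) - v x) / \<bar>z\<bar> powr (1 + lam))"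
      using wD(1) vD(1) integrable_shift[OF wD(1), of z] integrable_shift[OF vD(1), of z] by auto
    note iw = conv_weighted_integrable[OF sw(1) K(1) \<theta> \<theta>1, of fst, simplified]
      and iv = conv_weighted_integrable[OF sw(2) K(1) \<theta> \<theta>1, of snd, simplified]
    define \<kappa> where "\<kappa> = 1 / \<bar>z\<bar> powr (1 + lam)"
    have \<kappa>: "0 \<le> \<kappa>" by (simp add: \<kappa>_def)
    define h where "h p = \<bar>w (fst p) - v (snd p)\<bar> * K (fst p - snd p)" for p :: "real \<times> real"
    have h: "integrable plane h"
    proof (rule conv_bound(1)[where P="\<lambda>x. \<bar>w x\<bar>" and R="\<lambda>x. \<bar>v x\<bar>" and K=K])
      show "\<bar>h (x, y)\<bar> \<le> (\<bar>w x\<bar> + \<bar>v y\<bar>) * K (x - y)" for x y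
        using K(2)[of "x - y"] by (auto simp: h_def abs_mult intro!: mult_right_mono)
    qed (use wD(1) vD(1) K in \<open>auto simp: h_def[abs_def]\<close>)
    define h' where "h' p = h (fst p + z, snd p + z)" for p
    have hz: "(LINT p|plane. h' p) = (LINT p|plane. h p)"
      using integral_shift_pair[OF borel_measurable_integrable[OF h], of z z] by (simp add: h'_def case_prod_beta')
    have h': "integrable plane h'"
    proof (rule conv_bound(1)[where P="\<lambda>x. \<bar>w (x + z)\<bar>" and R="\<lambda>x. \<bar>v (x + z)\<bar>" and K=K])
      show "\<bar>h' (x, y)\<bar> \<le> (\<bar>w (x + z)\<bar> + \<bar>v (y + z)\<bar>) * K (x - y)" for x y
        using K(2)[of "x - y"] by (auto simp: h'_def h_def abs_mult intro!: mult_right_mono)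
    qed (use integrable_shift[OF wD(1), of z] integrable_shift[OF vD(1), of z] K in \<open>auto simp: h_def[abs_def] h'_def[abs_def]\<close>)
    have "I w fst z - I v snd z = (LINT p|plane.
        \<theta> p * ((w (fst p + z) - w (fst p)) / \<bar>z\<bar> powr (1 + lam)) * K (fst p - snd p)
        - \<theta> p * ((v (snd p + z) - v (snd p)) / \<bar>z\<bar> powr (1 + lam)) * K (fst p - snd p))"
      unfolding I_def using iw iv by (subst Bochner_Integration.integral_diff) auto
    also have "\<dots> \<le> (LINT p|plane. \<kappa> * (h' p - h p))"
    proof (rule integral_mono)
      fix p :: "real \<times> real"
      \<comment> \<open>\<open>sgn b\<close> is a subgradient of the absolute value at b, also for b
        = 0.\<close>
      have s: "sgn b * (a - b) \<le> \<bar>a\<bar> - \<bar>b\<bar>" for a b :: real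
        by (auto simp: sgn_if)
      have "\<theta> p * ((w (fst p + z) - w (fst p)) / \<bar>z\<bar> powr (1 + lam)) * K (fst p - snd p)
        - \<theta> p * ((v (snd p + z) - v (snd p)) / \<bar>z\<bar> powr (1 + lam)) * K (fst p - snd p)
        = \<kappa> * ((sgn (w (fst p) - v (snd p)) * ((w (fst p + z) - v (snd p + z)) - (w (fst p) - v (snd p)))) * K (fst p - snd p))"
        by (simp add: \<kappa>_def \<theta>_def algebra_simps add_divide_distrib diff_divide_distrib)
      also have "\<dots> \<le> \<kappa> * ((\<bar>w (fst p + z) - v (snd p + z)\<bar> - \<bar>w (fst p) - v (snd p)\<bar>) * K (fst p - snd p))"
        by (intro mult_left_mono mult_right_mono s K(2) \<kappa>)
      finally show "\<theta> p * ((w (fst p + z) - w (fst p)) / \<bar>z\<bar> powr (1 + lam)) * K (fst p - snd p)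
        - \<theta> p * ((v (snd p + z) - v (snd p)) / \<bar>z\<bar> powr (1 + lam)) * K (fst p - snd p) \<le> \<kappa> * (h' p - h p)"
        by (simp add: h'_def h_def algebra_simps)
    qed (use iw iv h h' in auto)
    also have "\<dots> = 0" using hz h h' by simp
    finally show ?thesis .
  qed
  note jw = conv_weighted_integrable[OF integrable_frac_lap[OF lam w] K(1) \<theta> \<theta>1, of fst, simplified]
    and jv = conv_weighted_integrable[OF integrable_frac_lap[OF lam v] K(1) \<theta> \<theta>1, of snd, simplified]
  have "(LINT (x, y)|plane. sgn (w x - v y) * (frac_lap lam w x - frac_lap lam v y) * K (x - y))
    = (LINT p|plane. \<theta> p * frac_lap lam w (fst p) * K (fst p - snd p) - \<theta> p * frac_lap lam v (snd p) * K (fst p - snd p))"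
    by (intro Bochner_Integration.integral_cong) (auto simp: \<theta>_def algebra_simps)
  also have "\<dots> = frac_const lam * (LINT z|lborel. I w fst z - I v snd z)"
    using jw jv fw fv by (simp add: right_diff_distrib)
  also have "\<dots> \<le> 0"
  proof (rule mult_nonneg_nonpos[OF frac_const_nonneg])
    have "(LINT z|lborel. I w fst z - I v snd z) \<le> (LINT z::real|lborel. 0)"
      by (rule integral_mono) (use fw fv le in auto)
    then show "(LINT z|lborel. I w fst z - I v snd z) \<le> 0" by simp
  qed
  finally show ?thesis .
qed

section \<open>Mollifiers and test functions\<close>

text \<open>Each level carries a witness for the derivative, so that closure under sums, products
  and affine substitutions is an induction on k with an explicit derivative.\<close>

primrec Ck :: "nat \<Rightarrow> (real \<Rightarrow> real) \<Rightarrow> bool" where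
  "Ck 0 f \<longleftrightarrow> continuous_on UNIV f"
| "Ck (Suc k) f \<longleftrightarrow> (\<exists>f'. (\<forall>x. (f has_real_derivative f' x) (at x)) \<and> Ck k f')"

lemma Ck_SucI: "(\<And>x. (f has_real_derivative f' x) (at x)) \<Longrightarrow> Ck k f' \<Longrightarrow> Ck (Suc k) f"
  by auto

lemma Ck_Suc_imp: "Ck (Suc k) f \<Longrightarrow> Ck k f"
proof (induction k arbitrary: f)
  case 0
  then obtain f' where "\<And>x. (f has_real_derivative f' x) (at x)" by auto
  then show ?case using DERIV_continuous_on[of UNIV f f'] by simp
next
  case (Suc k)
  from Suc.prems obtain f' where "\<And>x. (f has_real_derivative f' x) (at x)" "Ck (Suc k) f'"
    by (subst (asm) Ck.simps(2)) blast
  then show ?case using Suc.IH Ck_SucI by blast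
qed

lemma Ck_const: "Ck k (\<lambda>x. c)"
  by (induction k arbitrary: c) (auto intro!: exI[of _ "\<lambda>x. 0"])

lemma Ck_add: "Ck k f \<Longrightarrow> Ck k g \<Longrightarrow> Ck k (\<lambda>x. f x + g x)"
proof (induction k arbitrary: f g)
  case (Suc k)
  then obtain f' g' where "\<And>x. (f has_real_derivative f' x) (at x)" "Ck k f'"
    "\<And>x. (g has_real_derivative g' x) (at x)" "Ck k g'" by auto
  then show ?case
    by (intro Ck_SucI[where f'="\<lambda>x. f' x + g' x"] Suc.IH) (auto intro!: derivative_eq_intros)
qed (auto intro: continuous_intros)

lemma Ck_mult: "Ck k f \<Longrightarrow> Ck k g \<Longrightarrow> Ck k (\<lambda>x. f x * g x)"
proof (induction k arbitrary: f g)
  case (Suc k)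
  then obtain f' g' where "\<And>x. (f has_real_derivative f' x) (at x)" "Ck k f'"
    "\<And>x. (g has_real_derivative g' x) (at x)" "Ck k g'" by auto
  then show ?case using Suc.prems[THEN Ck_Suc_imp]
    by (intro Ck_SucI[where f'="\<lambda>x. f' x * g x + f x * g' x"] Suc.IH Ck_add)
       (auto intro!: derivative_eq_intros)
qed (auto intro: continuous_intros)

lemma Ck_affine: "Ck k f \<Longrightarrow> Ck k (\<lambda>x. f (a * x + b))"
proof (induction k arbitrary: f)
  case 0
  then show ?case by (auto intro!: continuous_intros continuous_on_compose2[of UNIV f])
next
  case (Suc k)
  then obtain f' where f': "\<And>x. (f has_real_derivative f' x) (at x)" "Ck k f'" by auto
  have "((\<lambda>x. f (a * x + b)) has_real_derivative a * f' (a * x + b)) (at x)" for x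
    by (rule DERIV_cong[OF DERIV_chain2[where g="\<lambda>x. a * x + b" and Db=a, OF f'(1)]]) (auto intro!: derivative_eq_intros)
  then show ?case
    by (rule Ck_SucI) (intro Ck_mult Ck_const Suc.IH f')
qed

text \<open>The family \<open>p (1/x) exp (-1/x)\<close> is closed under differentiation, also at the origin.\<close>

definition flat :: "real poly \<Rightarrow> real \<Rightarrow> real" where
  "flat p x = (if x > 0 then poly p (1 / x) * exp (- (1 / x)) else 0)"

lemma poly_exp_tendsto_0: "((\<lambda>y. poly p y * exp (- y)) \<longlongrightarrow> (0::real)) at_top"
proof -
  have "((\<lambda>y. \<Sum>i\<le>degree p. coeff p i * (y ^ i / exp y)) \<longlongrightarrow> (\<Sum>i\<le>degree p. coeff p i * 0)) at_top"
    by (intro tendsto_intros tendsto_power_div_exp_0)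
  then show ?thesis
    by (simp add: poly_altdef sum_distrib_right exp_minus divide_inverse mult.assoc)
qed

text \<open>With y = 1/x the derivative of p(y) exp(-y) in x is y^2 (p - p')(y) exp(-y), and
  \<open>[:0, 0, 1:]\<close> is the polynomial y^2.\<close>

lemma flat_derivative: "(flat p has_real_derivative flat ([:0, 0, 1:] * (p - pderiv p)) x) (at x)"
proof -
  consider "x < 0" | "x > 0" | "x = 0" by linarith
  then show ?thesis
  proof cases
    case 1
    have "((\<lambda>x. 0) has_real_derivative 0) (at x)" by simp
    then have "(flat p has_real_derivative 0) (at x)"
      by (rule has_field_derivative_transform_within_open[where S="{..<0}"]) (use 1 in \<open>auto simp: flat_def\<close>)
    then show ?thesis using 1 by (simp add: flat_def)
  next
    case 2
    have "((\<lambda>x. poly p (1 / x) * exp (- (1 / x))) has_real_derivative flat ([:0, 0, 1:] * (p - pderiv p)) x) (at x)"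
      by (rule derivative_eq_intros DERIV_chain2[where f="poly p" and g="\<lambda>x. 1 / x", OF poly_DERIV] refl | (use 2 in simp; fail))+
         (use 2 in \<open>simp add: flat_def field_simps power2_eq_square\<close>)
    then show ?thesis
      by (rule has_field_derivative_transform_within_open[where S="{0<..}"]) (use 2 in \<open>auto simp: flat_def\<close>)
  next
    case 3
    have "((\<lambda>h. (flat p (0 + h) - flat p 0) / h) \<longlongrightarrow> 0) (at 0)"
    proof (rule filterlim_split_at)
      show "((\<lambda>h. (flat p (0 + h) - flat p 0) / h) \<longlongrightarrow> 0) (at_left 0)"
        by (rule tendsto_eventually) (auto simp: eventually_at_filter flat_def)
      \<comment> \<open>The difference quotient at 0 from the right is y p(y) exp(-y) with y =
        1/h.\<close>
      have "((\<lambda>h. poly ([:0, 1:] * p) (inverse h) * exp (- inverse h)) \<longlongrightarrow> 0) (at_right (0::real))"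
        by (rule filterlim_compose[OF poly_exp_tendsto_0 filterlim_inverse_at_top_right])
      then show "((\<lambda>h. (flat p (0 + h) - flat p 0) / h) \<longlongrightarrow> 0) (at_right 0)"
        by (rule Lim_transform_eventually) (auto simp: eventually_at_filter flat_def divide_simps)
    qed
    then show ?thesis using 3 by (simp add: DERIV_def flat_def)
  qed
qed

lemma Ck_flat: "Ck k (flat p)"
proof (induction k arbitrary: p)
  case 0
  then show ?case
    using DERIV_continuous_on[OF flat_derivative] by simp
next
  case (Suc k)
  then show ?case using flat_derivative by (auto simp del: mult_pCons_left)
qed

lemma integrable_continuous_support:
  fixes f :: "real \<Rightarrow> real"
  assumes "continuous_on UNIV f" "\<And>x. r < \<bar>x\<bar> \<Longrightarrow> f x = 0"
  shows "integrable lborel f"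
proof -
  have "set_integrable lborel {-r..r} f"
    by (rule borel_integrable_atLeastAtMost') (use assms in \<open>auto intro: continuous_on_subset\<close>)
  moreover have "(\<lambda>x. indicator {-r..r} x *\<^sub>R f x) = f"
    using assms(2) by (auto simp: indicator_def fun_eq_iff abs_le_iff not_less[symmetric])
  ultimately show ?thesis by (simp only: set_integrable_def)
qed

text \<open>The derivative is a parameter of its own because its L^1 norm, which grows like 1/r,
  governs the consistency error.\<close>

definition mollifier :: "real \<Rightarrow> (real \<Rightarrow> real) \<Rightarrow> (real \<Rightarrow> real) \<Rightarrow> bool" where
  "mollifier r \<omega> \<omega>' \<longleftrightarrow> (\<forall>k. Ck k \<omega>) \<and> (\<forall>x. (\<omega> has_real_derivative \<omega>' x) (at x)) \<and> continuous_on UNIV \<omega>' \<and>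
     (\<forall>x. 0 \<le> \<omega> x) \<and> (\<forall>x. r < \<bar>x\<bar> \<longrightarrow> \<omega> x = 0) \<and> (\<forall>x. r < \<bar>x\<bar> \<longrightarrow> \<omega>' x = 0) \<and> (LINT x|lborel. \<omega> x) = 1"

lemma mollifierD:
  assumes "mollifier r \<omega> \<omega>'"
  shows "Ck k \<omega>" "(\<omega> has_real_derivative \<omega>' x) (at x)" "continuous_on UNIV \<omega>'" "continuous_on UNIV \<omega>" "0 \<le> \<omega> x"
    "r < \<bar>x\<bar> \<Longrightarrow> \<omega> x = 0" "(LINT x|lborel. \<omega> x) = 1"
    "integrable lborel \<omega>" "integrable lborel \<omega>'"
    "\<omega> \<in> borel_measurable borel" "\<omega>' \<in> borel_measurable borel"
proof -
  show "Ck k \<omega>" "(\<omega> has_real_derivative \<omega>' x) (at x)" and *: "continuous_on UNIV \<omega>'" and "0 \<le> \<omega> x"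
    "r < \<bar>x\<bar> \<Longrightarrow> \<omega> x = 0" "(LINT x|lborel. \<omega> x) = 1"
    using assms by (auto simp: mollifier_def)
  show "continuous_on UNIV \<omega>" using assms Ck.simps(1)[of \<omega>] unfolding mollifier_def by blast
  then show i: "integrable lborel \<omega>" using assms by (auto simp: mollifier_def intro: integrable_continuous_support)
  show i': "integrable lborel \<omega>'" using assms by (auto simp: mollifier_def intro: integrable_continuous_support)
  show "\<omega> \<in> borel_measurable borel" "\<omega>' \<in> borel_measurable borel" using i i' by auto
qed

lemma mollifier_exists: "\<exists>\<omega> \<omega>'. mollifier 1 \<omega> \<omega>'"
proof -
  \<comment> \<open>A bump that is positive on (-1, 1) and vanishes outside; it is divided by its
    integral below.\<close>
  define b where "b x = flat 1 (1 * x + 1) * flat 1 (-1 * x + 1)" for x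
  have Cb: "Ck k b" for k
    unfolding b_def[abs_def] by (intro Ck_mult Ck_affine Ck_flat)
  have b0: "0 \<le> b x" "1 < \<bar>x\<bar> \<Longrightarrow> b x = 0" for x by (auto simp: b_def flat_def)
  have pos: "0 < b x" if "x \<in> {-1<..<1}" for x using that by (auto simp: b_def flat_def)
  have cont: "continuous_on UNIV b" using Cb[of 0] by simp
  have ib: "integrable lborel b" using integrable_continuous_support[OF cont b0(2)] .
  have "(LINT x|lborel. b x) \<noteq> 0"
  proof
    assume "(LINT x|lborel. b x) = 0"
    then have "AE x in lborel. b x = 0"
      using integral_nonneg_eq_0_iff_AE[OF ib] b0 by auto
    then have "AE x in lborel. x \<notin> {-1<..<(1::real)}"
      by eventually_elim (use pos in force)
    then have "{-1<..<(1::real)} \<in> null_sets lborel"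
      by (subst AE_iff_null_sets) auto
    then show False by (auto simp: null_sets_def)
  qed
  then have I: "0 < (LINT x|lborel. b x)" (is "0 < ?I")
    using b0 by (simp add: order.strict_iff_order)
  from Cb[of 1] obtain b' where b': "\<And>x. (b has_real_derivative b' x) (at x)" "continuous_on UNIV b'" by auto
  have b'0: "b' x = 0" if "1 < \<bar>x\<bar>" for x
  proof -
    have "open {x::real. 1 < \<bar>x\<bar>}" by (intro open_Collect_less continuous_intros)
    then have "(b has_real_derivative 0) (at x)"
      using has_field_derivative_transform_within_open[of "\<lambda>x. 0" 0 x "{x. 1 < \<bar>x\<bar>}" b] that b0 by auto
    then show ?thesis using b'(1) DERIV_unique by blast
  qed
  have II: "?I * (1 / ?I) = 1" using I by simp
  have "mollifier 1 (\<lambda>x. b x * (1 / ?I)) (\<lambda>x. b' x * (1 / ?I))"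
    unfolding mollifier_def
    using b0 I II b'0 by (auto intro!: Ck_mult Cb Ck_const DERIV_cmult_right b' continuous_intros simp del: mult_1_right times_divide_eq_right)
  then show ?thesis by blast
qed

text \<open>The idle \<open>+ 0\<close> gives the argument the shape of \<open>Ck_affine\<close>.
  The second claim is the source of the factor 1/r in the error.\<close>

lemma mollifier_scale:
  assumes m: "mollifier 1 \<omega> \<omega>'" and r: "0 < r"
  shows "mollifier r (\<lambda>x. 1 / r * \<omega> (1 / r * x + 0)) (\<lambda>x. 1 / r * (1 / r * \<omega>' (1 / r * x + 0)))"
    and "(LINT x|lborel. \<bar>1 / r * (1 / r * \<omega>' (1 / r * x + 0))\<bar>) = (L1norm \<omega>') / r"
proof -
  note mD = mollifierD[OF m]
  have z: "\<omega> (1 / r * x + 0) = 0" "\<omega>' (1 / r * x + 0) = 0" if "r < \<bar>x\<bar>" for x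
  proof -
    have "1 < \<bar>1 / r * x + 0\<bar>" using that r by (simp add: abs_mult field_simps)
    then show "\<omega> (1 / r * x + 0) = 0" "\<omega>' (1 / r * x + 0) = 0"
      using m unfolding mollifier_def by blast+
  qed
  have "(LINT x|lborel. 1 / r * \<omega> (1 / r * x + 0)) = 1"
    using lborel_integral_real_affine[of "1 / r" \<omega> 0] mD(7) r by simp
  moreover have "((\<lambda>x. 1 / r * \<omega> (1 / r * x + 0)) has_real_derivative 1 / r * (1 / r * \<omega>' (1 / r * x + 0))) (at x)" for x
    by (rule DERIV_cmult) (rule DERIV_cong[OF DERIV_chain2[where g="\<lambda>x. 1 / r * x + 0" and Db="1 / r", OF mD(2)]], use r in \<open>auto intro!: derivative_eq_intros\<close>)
  moreover have "Ck k (\<lambda>x. 1 / r * \<omega> (1 / r * x + 0))" for k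
    by (intro Ck_mult Ck_const Ck_affine mD(1))
  moreover have "continuous_on UNIV (\<lambda>x. 1 / r * (1 / r * \<omega>' (1 / r * x + 0)))"
    by (intro continuous_intros continuous_on_compose2[OF mD(3)]) (use r in auto)
  moreover have "\<forall>x. 0 \<le> 1 / r * \<omega> (1 / r * x + 0)" using mD(5) r by simp
  ultimately show "mollifier r (\<lambda>x. 1 / r * \<omega> (1 / r * x + 0)) (\<lambda>x. 1 / r * (1 / r * \<omega>' (1 / r * x + 0)))"
    unfolding mollifier_def using z by (simp del: add_0_right)
  show "(LINT x|lborel. \<bar>1 / r * (1 / r * \<omega>' (1 / r * x + 0))\<bar>) = (L1norm \<omega>') / r"
    using lborel_integral_real_affine[of "1 / r" "\<lambda>x. \<bar>\<omega>' x\<bar>" 0] r by (simp add: abs_mult)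
qed

lemma L1_lipschitzI_nonneg:
  assumes w: "integrable lborel w" and b: "\<And>z. 0 \<le> z \<Longrightarrow> (LINT x|lborel. \<bar>w (x + z) - w x\<bar>) \<le> M * z"
  shows "L1_lipschitz M w"
  unfolding L1_lipschitz_def
proof (intro conjI allI w)
  fix z
  show "(LINT x|lborel. \<bar>w (x + z) - w x\<bar>) \<le> M * \<bar>z\<bar>"
  proof (cases "0 \<le> z")
    case False
    have "(LINT x|lborel. \<bar>w (x + z) - w x\<bar>) = (LINT x|lborel. \<bar>w (x + - z) - w x\<bar>)"
      using integral_shift[of "\<lambda>x. \<bar>w (x + z) - w x\<bar>" "- z"] by (simp add: abs_minus_commute)
    then show ?thesis using b[of "- z"] False by simp
  qed (use b in auto)
qed

text \<open>The increment w(x + z) - w(x) is the convolution of w' with the indicator of [-z, 0],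
  whose L^1 norm is z.\<close>

lemma C1_L1_lipschitz:
  fixes w w' :: "real \<Rightarrow> real"
  assumes D: "\<And>x. (w has_real_derivative w' x) (at x)" and c: "continuous_on UNIV w'"
    and w: "integrable lborel w" and w': "integrable lborel w'"
  shows "L1_lipschitz (L1norm w') w"
proof (rule L1_lipschitzI_nonneg[OF w])
  fix z :: real assume z: "0 \<le> z"
  let ?i = "\<lambda>y::real. indicator {-z..0} y :: real"
  have i: "integrable lborel ?i" "(LINT y|lborel. ?i y) = z" using z by auto
  have a: "integrable lborel (\<lambda>x. \<bar>w' x\<bar>)" using w' by auto
  note cv = conv_snd[OF i(1) a]
  have eq: "w (x + z) - w x = (LINT y|lborel. ?i y * w' (x - y))" for x
  proof -
    have "(LINT y|lborel. indicator {-z..0} y *\<^sub>R w' (x - y)) = - w (x - 0) - (- w (x - (- z)))"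
    proof (rule integral_FTC_atLeastAtMost)
      show "((\<lambda>y. - w (x - y)) has_vector_derivative w' (x - y)) (at y within {- z..0})" for y
        unfolding has_real_derivative_iff_has_vector_derivative[symmetric]
        by (rule has_field_derivative_at_within)
           (rule DERIV_cong[OF DERIV_minus[OF DERIV_chain2[where g="\<lambda>y. x - y" and Db="-1", OF D]]], auto intro!: derivative_eq_intros)
      show "continuous_on {- z..0} (\<lambda>y. w' (x - y))"
        by (intro continuous_intros continuous_on_compose2[OF c]) auto
    qed (use z in auto)
    then show ?thesis by simp
  qed
  have "(LINT x|lborel. \<bar>w (x + z) - w x\<bar>) \<le> (LINT x|lborel. LINT y|lborel. ?i y * \<bar>w' (x - y)\<bar>)"
  proof (rule integral_mono)
    show "integrable lborel (\<lambda>x. LINT y|lborel. ?i y * \<bar>w' (x - y)\<bar>)"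
      using lborel_pair.integrable_fst'[OF cv(1)] by simp
    show "\<bar>w (x + z) - w x\<bar> \<le> (LINT y|lborel. ?i y * \<bar>w' (x - y)\<bar>)" for x
      unfolding eq using integral_abs_bound[of lborel "\<lambda>y. ?i y * w' (x - y)"] by (simp add: abs_mult)
  qed (use w integrable_shift[OF w, of z] in auto)
  also have "\<dots> = (LINT (x, y)|plane. ?i y * \<bar>w' (x - y)\<bar>)"
    using lborel_pair.integral_fst'[OF cv(1)] by simp
  also have "\<dots> = (L1norm w') * z" using cv(2) i(2) by simp
  finally show "(LINT x|lborel. \<bar>w (x + z) - w x\<bar>) \<le> (L1norm w') * z" .
qed

section \<open>Smooth functions on the closed strip\<close>

context
  fixes T :: real
  assumes T: "0 < T"
begin

text \<open>Derivatives within the closed strip are unique, because along each coordinate line the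
  strip has points arbitrarily close to p; for t = T they lie in the past, where T > 0 leaves
  room.\<close>

lemma frechet_derivative_strip:
  fixes f :: "real \<times> real \<Rightarrow> real"
  assumes D: "(f has_derivative D) (at p within UNIV \<times> {0..T})" and p: "p \<in> UNIV \<times> {0..T}"
  shows "frechet_derivative f (at p within UNIV \<times> {0..T}) = D"
proof -
  have "f differentiable at p within UNIV \<times> {0..T}" using D by (auto simp: differentiable_def)
  then have F: "(f has_derivative frechet_derivative f (at p within UNIV \<times> {0..T})) (at p within UNIV \<times> {0..T})"
    by (simp add: frechet_derivative_works)
  show ?thesis
  proof (rule frechet_derivative_unique_within[OF F D])
    fix i :: "real \<times> real" and e :: real assume i: "i \<in> Basis" and e: "0 < e"
    show "\<exists>d. 0 < \<bar>d\<bar> \<and> \<bar>d\<bar> < e \<and> p + d *\<^sub>R i \<in> UNIV \<times> {0..T}"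
    proof (cases "snd p < T")
      case True
      then show ?thesis using i e p
        by (intro exI[of _ "min (e/2) (T - snd p)"]) (auto simp: Basis_prod_def min_def mem_Times_iff)
    next
      case False
      then show ?thesis using i e p T
        by (intro exI[of _ "- min (e/2) T"]) (auto simp: Basis_prod_def min_def mem_Times_iff)
    qed
  qed
qed

lemma higher_differentiable_on_cong:
  assumes "\<And>p. p \<in> S \<Longrightarrow> f p = g p"
  shows "higher_differentiable_on S f n \<longleftrightarrow> higher_differentiable_on S g n"
  using assms
proof (induction n arbitrary: f g)
  case 0
  then show ?case by (auto cong: continuous_on_cong)
next
  case (Suc n)
  have h: "(f has_derivative D) (at p within S) \<longleftrightarrow> (g has_derivative D) (at p within S)" if "p \<in> S" for D p
    using has_derivative_transform[OF that, of g f D] has_derivative_transform[OF that, of f g D] Suc.prems by metis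
  then have "f differentiable_on S \<longleftrightarrow> g differentiable_on S"
    unfolding differentiable_on_def differentiable_def by blast
  moreover have "frechet_derivative f (at p within S) = frechet_derivative g (at p within S)" if "p \<in> S" for p
    unfolding frechet_derivative_def using h[OF that] by simp
  then have "higher_differentiable_on S (\<lambda>p. frechet_derivative f (at p within S) v) n
      \<longleftrightarrow> higher_differentiable_on S (\<lambda>p. frechet_derivative g (at p within S) v) n" for v
    by (intro Suc.IH) simp
  ultimately show ?case by simp
qed

text \<open>Replaces the derivative chosen by \<open>frechet_derivative\<close> by an explicit
  candidate, so that sum, product and chain rule can drive the recursion.\<close>

lemma higher_strip_SucI:
  fixes f :: "real \<times> real \<Rightarrow> real"
  assumes D: "\<And>p. p \<in> UNIV \<times> {0..T} \<Longrightarrow> (f has_derivative D p) (at p within UNIV \<times> {0..T})"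
    and h: "\<And>v. higher_differentiable_on (UNIV \<times> {0..T}) (\<lambda>p. D p v) n"
  shows "higher_differentiable_on (UNIV \<times> {0..T}) f (Suc n)"
proof -
  have "higher_differentiable_on (UNIV \<times> {0..T}) (\<lambda>p. frechet_derivative f (at p within UNIV \<times> {0..T}) v) n" for v
    using h[of v] frechet_derivative_strip[OF D]
    by (subst higher_differentiable_on_cong[where g="\<lambda>p. D p v"]) auto
  moreover have "f differentiable_on UNIV \<times> {0..T}"
    unfolding differentiable_on_def differentiable_def using D by blast
  ultimately show ?thesis by simp
qed

lemma higher_strip_SucD:
  fixes f :: "real \<times> real \<Rightarrow> real"
  assumes "higher_differentiable_on (UNIV \<times> {0..T}) f (Suc n)"
  obtains D where "\<And>p. p \<in> UNIV \<times> {0..T} \<Longrightarrow> (f has_derivative D p) (at p within UNIV \<times> {0..T})"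
    and "\<And>v. higher_differentiable_on (UNIV \<times> {0..T}) (\<lambda>p. D p v) n"
  using assms that[of "\<lambda>p. frechet_derivative f (at p within UNIV \<times> {0..T})"]
  by (auto simp: differentiable_on_def frechet_derivative_works)

lemma higher_strip_Suc_imp:
  fixes f :: "real \<times> real \<Rightarrow> real"
  shows "higher_differentiable_on (UNIV \<times> {0..T}) f (Suc n) \<Longrightarrow> higher_differentiable_on (UNIV \<times> {0..T}) f n"
proof (induction n arbitrary: f)
  case 0
  then show ?case by (auto intro: differentiable_imp_continuous_on)
next
  case (Suc n)
  then show ?case by (metis higher_differentiable_on.simps(2))
qed

lemma higher_strip_add:
  fixes f g :: "real \<times> real \<Rightarrow> real"
  shows "higher_differentiable_on (UNIV \<times> {0..T}) f n \<Longrightarrow> higher_differentiable_on (UNIV \<times> {0..T}) g n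
    \<Longrightarrow> higher_differentiable_on (UNIV \<times> {0..T}) (\<lambda>p. f p + g p) n"
proof (induction n arbitrary: f g)
  case (Suc n)
  obtain D where D: "\<And>p. p \<in> UNIV \<times> {0..T} \<Longrightarrow> (f has_derivative D p) (at p within UNIV \<times> {0..T})"
    "\<And>v. higher_differentiable_on (UNIV \<times> {0..T}) (\<lambda>p. D p v) n"
    using higher_strip_SucD[OF Suc.prems(1)] by blast
  obtain E where E: "\<And>p. p \<in> UNIV \<times> {0..T} \<Longrightarrow> (g has_derivative E p) (at p within UNIV \<times> {0..T})"
    "\<And>v. higher_differentiable_on (UNIV \<times> {0..T}) (\<lambda>p. E p v) n"
    using higher_strip_SucD[OF Suc.prems(2)] by blast
  show ?case
  proof (rule higher_strip_SucI[where D="\<lambda>p v. D p v + E p v"])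
    show "((\<lambda>p. f p + g p) has_derivative (\<lambda>v. D p v + E p v)) (at p within UNIV \<times> {0..T})"
      if "p \<in> UNIV \<times> {0..T}" for p using has_derivative_add[OF D(1)[OF that] E(1)[OF that]] .
    show "higher_differentiable_on (UNIV \<times> {0..T}) (\<lambda>p. D p v + E p v) n" for v
      by (rule Suc.IH[OF D(2) E(2)])
  qed
qed (auto intro: continuous_intros)

lemma higher_strip_mult:
  fixes f g :: "real \<times> real \<Rightarrow> real"
  shows "higher_differentiable_on (UNIV \<times> {0..T}) f n \<Longrightarrow> higher_differentiable_on (UNIV \<times> {0..T}) g n
    \<Longrightarrow> higher_differentiable_on (UNIV \<times> {0..T}) (\<lambda>p. f p * g p) n"
proof (induction n arbitrary: f g)
  case (Suc n)
  obtain D where D: "\<And>p. p \<in> UNIV \<times> {0..T} \<Longrightarrow> (f has_derivative D p) (at p within UNIV \<times> {0..T})"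
    "\<And>v. higher_differentiable_on (UNIV \<times> {0..T}) (\<lambda>p. D p v) n"
    using higher_strip_SucD[OF Suc.prems(1)] by blast
  obtain E where E: "\<And>p. p \<in> UNIV \<times> {0..T} \<Longrightarrow> (g has_derivative E p) (at p within UNIV \<times> {0..T})"
    "\<And>v. higher_differentiable_on (UNIV \<times> {0..T}) (\<lambda>p. E p v) n"
    using higher_strip_SucD[OF Suc.prems(2)] by blast
  show ?case
  proof (rule higher_strip_SucI[where D="\<lambda>p v. f p * E p v + D p v * g p"])
    show "((\<lambda>p. f p * g p) has_derivative (\<lambda>v. f p * E p v + D p v * g p)) (at p within UNIV \<times> {0..T})"
      if "p \<in> UNIV \<times> {0..T}" for p using has_derivative_mult[OF D(1)[OF that] E(1)[OF that]] .
    show "higher_differentiable_on (UNIV \<times> {0..T}) (\<lambda>p. f p * E p v + D p v * g p) n" for v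
      by (intro higher_strip_add Suc.IH D(2) E(2) higher_strip_Suc_imp[OF Suc.prems(1)] higher_strip_Suc_imp[OF Suc.prems(2)])
  qed
qed (auto intro: continuous_intros)

lemma higher_strip_fst: "Ck n a \<Longrightarrow> higher_differentiable_on (UNIV \<times> {0..T}) (\<lambda>p. a (fst p)) n"
proof (induction n arbitrary: a)
  case 0
  then show ?case using continuous_on_compose2[of UNIV a "UNIV \<times> {0..T}" fst] continuous_on_fst[OF continuous_on_id] by auto
next
  case (Suc n)
  then obtain a' where a': "\<And>x. (a has_real_derivative a' x) (at x)" "Ck n a'" by auto
  show ?case
  proof (rule higher_strip_SucI[where D="\<lambda>p v. a' (fst p) * fst v"])
    show "((\<lambda>p. a (fst p)) has_derivative (\<lambda>v. a' (fst p) * fst v)) (at p within UNIV \<times> {0..T})" for p :: "real \<times> real"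
      using has_derivative_compose[OF has_derivative_fst[OF has_derivative_ident], of a "(*) (a' (fst p))" p "UNIV \<times> {0..T}"] a'(1)[of "fst p"]
      by (simp add: has_field_derivative_def)
    show "higher_differentiable_on (UNIV \<times> {0..T}) (\<lambda>p. a' (fst p) * fst v) n" for v :: "real \<times> real"
      by (rule Suc.IH[OF Ck_mult[OF a'(2) Ck_const[of n "fst v"]]])
  qed
qed

lemma higher_strip_snd: "Ck n a \<Longrightarrow> higher_differentiable_on (UNIV \<times> {0..T}) (\<lambda>p::real \<times> real. a (snd p)) n"
proof (induction n arbitrary: a)
  case 0
  then show ?case using continuous_on_compose2[of UNIV a "UNIV \<times> {0..T}" snd] continuous_on_snd[OF continuous_on_id] by auto
next
  case (Suc n)
  then obtain a' where a': "\<And>x. (a has_real_derivative a' x) (at x)" "Ck n a'" by auto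
  show ?case
  proof (rule higher_strip_SucI[where D="\<lambda>p v. a' (snd p) * snd v"])
    show "((\<lambda>p. a (snd p)) has_derivative (\<lambda>v. a' (snd p) * snd v)) (at p within UNIV \<times> {0..T})" for p :: "real \<times> real"
      using has_derivative_compose[OF has_derivative_snd[OF has_derivative_ident], of a "(*) (a' (snd p))" p "UNIV \<times> {0..T}"] a'(1)[of "snd p"]
      by (simp add: has_field_derivative_def)
    show "higher_differentiable_on (UNIV \<times> {0..T}) (\<lambda>p :: real \<times> real. a' (snd p) * snd v) n" for v :: "real \<times> real"
      by (rule Suc.IH[OF Ck_mult[OF a'(2) Ck_const[of n "snd v"]]])
  qed
qed

text \<open>\<open>y\<close> is a parameter: the entropy inequality will be used for each y with the
  constant k = v(y) and integrated in y afterwards.\<close>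

lemma mollifier_test_function:
  assumes m: "mollifier r \<omega> \<omega>'" and \<tau>: "\<And>k. Ck k \<tau>"
  shows "(\<lambda>(x, t). \<omega> (x - y) * \<tau> t) \<in> test_functions T"
proof -
  have "Ck n (\<lambda>x. \<omega> (x - y))" for n using Ck_affine[OF mollifierD(1)[OF m, of n], of 1 "- y"] by simp
  then have "higher_differentiable_on (UNIV \<times> {0..T}) (\<lambda>p. \<omega> (fst p - y) * \<tau> (snd p)) n" for n
    by (intro higher_strip_mult higher_strip_fst[where a="\<lambda>x. \<omega> (x - y)"] higher_strip_snd \<tau>)
  moreover have "compact (closure {p \<in> UNIV \<times> {0..T}. \<omega> (fst p - y) * \<tau> (snd p) \<noteq> 0})"
  proof -
    have "{p \<in> UNIV \<times> {0..T}. \<omega> (fst p - y) * \<tau> (snd p) \<noteq> 0} \<subseteq> {y - r..y + r} \<times> {0..T}"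
      using mollifierD(6)[OF m] by (force simp: abs_le_iff not_less[symmetric])
    then have "bounded {p \<in> UNIV \<times> {0..T}. \<omega> (fst p - y) * \<tau> (snd p) \<noteq> 0}"
      by (rule bounded_subset[rotated]) (auto intro: bounded_Times)
    then show ?thesis by (simp add: compact_closure)
  qed
  ultimately show ?thesis
    unfolding test_functions_def smooth_on_def case_prod_beta' by blast
qed

end

section \<open>Poisson weights in time\<close>

definition poisson :: "nat \<Rightarrow> real \<Rightarrow> real" where
  "poisson m s = exp (- s) * s ^ m / fact m"

text \<open>The probability that a Poisson variable of mean \<open>s\<close> is at least
  \<open>N\<close>.\<close>

definition poisson_tail :: "nat \<Rightarrow> real \<Rightarrow> real" where
  "poisson_tail N s = 1 - (\<Sum>m<N. poisson m s)"

lemma poisson_nonneg: "0 \<le> s \<Longrightarrow> 0 \<le> poisson m s"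
  by (simp add: poisson_def)

lemma poisson_at_0: "poisson m 0 = (if m = 0 then 1 else 0)"
  by (simp add: poisson_def)

lemma poisson_Suc: "real (Suc m) * poisson (Suc m) s = s * poisson m s"
  by (simp add: poisson_def field_simps del: of_nat_Suc)

lemma poisson_derivative:
  "(poisson m has_real_derivative (if m = 0 then 0 else poisson (m - 1) s) - poisson m s) (at s)"
proof (cases m)
  case 0
  then show ?thesis
    unfolding poisson_def[abs_def] by (auto intro!: derivative_eq_intros)
next
  case (Suc k)
  have "((\<lambda>s. exp (- s) * s ^ Suc k / fact (Suc k)) has_real_derivative poisson k s - poisson (Suc k) s) (at s)"
  proof (rule DERIV_cong)
    show "((\<lambda>s. exp (- s) * s ^ Suc k / fact (Suc k)) has_real_derivative
        (- exp (- s) * s ^ Suc k + exp (- s) * (real (Suc k) * s ^ k)) / fact (Suc k)) (at s)"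
      by (rule DERIV_cdivide) (auto intro!: derivative_eq_intros simp del: power_Suc)
    show "(- exp (- s) * s ^ Suc k + exp (- s) * (real (Suc k) * s ^ k)) / fact (Suc k) = poisson k s - poisson (Suc k) s"
      unfolding poisson_def fact_Suc by (simp add: field_simps del: of_nat_Suc)
  qed
  then show ?thesis using Suc by (simp add: poisson_def[abs_def])
qed

lemma poisson_tail_derivative:
  "(poisson_tail (Suc N) has_real_derivative poisson N s) (at s)"
proof (induction N)
  case 0
  show ?case
    unfolding poisson_tail_def[abs_def] using poisson_derivative[of 0 s]
    by (auto intro!: derivative_eq_intros)
next
  case (Suc N)
  have "poisson_tail (Suc (Suc N)) = (\<lambda>s. poisson_tail (Suc N) s - poisson (Suc N) s)"
    by (auto simp: poisson_tail_def)
  moreover have "((\<lambda>s. poisson_tail (Suc N) s - poisson (Suc N) s) has_real_derivative poisson N s - (poisson N s - poisson (Suc N) s)) (at s)"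
    using DERIV_diff[OF Suc.IH poisson_derivative[of "Suc N" s]] by simp
  ultimately show ?case by simp
qed

lemma poisson_tail_at_0: "poisson_tail (Suc N) 0 = 0"
  unfolding poisson_tail_def poisson_at_0 by (simp add: sum.delta)

text \<open>The tail vanishes at 0 and its derivative is a Poisson weight; the exponential series is
  not summed anywhere.\<close>

lemma poisson_tail_nonneg: "0 \<le> s \<Longrightarrow> 0 \<le> poisson_tail N s"
proof (cases N)
  case (Suc k)
  assume s: "0 \<le> s"
  have "poisson_tail (Suc k) 0 \<le> poisson_tail (Suc k) s"
    using DERIV_nonneg_imp_nondecreasing[OF s, of "poisson_tail (Suc k)"] poisson_tail_derivative poisson_nonneg by blast
  then show ?thesis using Suc by (simp add: poisson_tail_at_0)
qed (simp add: poisson_tail_def)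

lemma Ck_poisson: "Ck k (poisson m)"
proof (induction k arbitrary: m)
  case 0
  show ?case using DERIV_continuous_on[OF poisson_derivative] by simp
next
  case (Suc k)
  show ?case
  proof (rule Ck_SucI[OF poisson_derivative])
    have "Ck k (\<lambda>s. (if m = 0 then (\<lambda>s. 0) else poisson (m - 1)) s + (-1) * poisson m s)"
      by (intro Ck_add Ck_mult Ck_const Suc.IH) (auto intro: Suc.IH Ck_const)
    then show "Ck k (\<lambda>s. (if m = 0 then 0 else poisson (m - 1) s) - poisson m s)"
      by (cases "m = 0") auto
  qed
qed

lemma Ck_poisson_tail: "Ck k (poisson_tail (Suc N))"
proof (cases k)
  case 0
  show ?thesis using DERIV_continuous_on[OF poisson_tail_derivative] 0 by simp
next
  case (Suc j)
  show ?thesis unfolding Suc by (rule Ck_SucI[OF poisson_tail_derivative Ck_poisson])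
qed

text \<open>Truncated moments are closed expressions, since m P_m(s) = s P_(m-1)(s) makes the sums
  telescope. At s = N they yield the expected shortfall below the mean.\<close>

lemma poisson_first_moment: "(\<Sum>m\<le>k. (s - real m) * poisson m s) = s * poisson k s"
proof (induction k)
  case (Suc k)
  then show ?case using poisson_Suc[of k s] by (simp add: algebra_simps)
qed simp

lemma poisson_second_moment:
  "(\<Sum>m\<le>k. (s - real m)\<^sup>2 * poisson m s) = s * ((s - real k) * poisson k s + (\<Sum>m<k. poisson m s))"
proof (induction k)
  case (Suc k)
  have "(s - real (Suc k)) * (real (Suc k) * poisson (Suc k) s) = (s - real (Suc k)) * (s * poisson k s)"
    by (simp only: poisson_Suc)
  then show ?case using Suc by (simp add: algebra_simps power2_eq_square)
qed (simp add: power2_eq_square)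

text \<open>For a Poisson variable X of mean N the left side is the expectation of the positive part
  of N - X, and the right side is the standard deviation. The inequality x \<le> r/2 + x^2/(2r) with
  r = sqrt N takes the place of Cauchy-Schwarz. Truncation at k = N - 1 makes the second moment
  exactly N times the truncated mass.\<close>

lemma poisson_deviation:
  assumes "0 < N"
  shows "real N * poisson (N - 1) (real N) \<le> sqrt (real N)"
proof -
  obtain k where N: "N = Suc k" using assms by (cases N) auto
  define r where "r = sqrt (real N)"
  have r: "0 < r" "r * r = real N" using assms by (auto simp: r_def)
  let ?P = "\<lambda>m. poisson m (real N)"
  have P: "0 \<le> ?P m" for m by (simp add: poisson_nonneg)
  have le1: "(\<Sum>m\<le>k. ?P m) \<le> 1"
    using poisson_tail_nonneg[of "real N" N] by (simp add: poisson_tail_def N lessThan_Suc_atMost)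
  have "real N * ?P k = (\<Sum>m\<le>k. (real N - real m) * ?P m)"
    by (simp add: poisson_first_moment)
  also have "\<dots> \<le> (\<Sum>m\<le>k. (r / 2 + (real N - real m)\<^sup>2 / (2 * r)) * ?P m)"
  proof (intro sum_mono mult_right_mono P)
    fix m
    have "0 \<le> (r - (real N - real m))\<^sup>2 / (2 * r)" using r by simp
    then show "real N - real m \<le> r / 2 + (real N - real m)\<^sup>2 / (2 * r)"
      using r by (simp add: power2_eq_square field_simps)
  qed
  also have "\<dots> = r / 2 * (\<Sum>m\<le>k. ?P m) + (\<Sum>m\<le>k. (real N - real m)\<^sup>2 * ?P m) / (2 * r)"
    by (simp add: distrib_right sum.distrib sum_distrib_left sum_divide_distrib)
  also have "(\<Sum>m\<le>k. (real N - real m)\<^sup>2 * ?P m) = real N * (\<Sum>m\<le>k. ?P m)"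
  proof -
    have "(real N - real k) * ?P k + (\<Sum>m<k. ?P m) = (\<Sum>m\<le>k. ?P m)"
      by (simp add: N lessThan_Suc_atMost[symmetric])
    then show ?thesis unfolding poisson_second_moment by simp
  qed
  also have "r / 2 * (\<Sum>m\<le>k. ?P m) + real N * (\<Sum>m\<le>k. ?P m) / (2 * r) = r * (\<Sum>m\<le>k. ?P m)"
    unfolding r(2)[symmetric] using r(1) by (simp add: field_simps)
  also have "\<dots> \<le> r" using le1 r by (simp add: mult_left_le)
  finally show ?thesis by (simp add: N r_def)
qed

lemma time_derivative_affine:
  assumes "\<And>s. (g has_real_derivative g' s) (at s)" "h \<noteq> 0"
  shows "((\<lambda>t. g ((-1 / h) * t + T / h)) has_real_derivative - (g' ((-1 / h) * t + T / h) / h)) (at t)"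
  by (rule DERIV_cong[OF DERIV_chain2[where g="\<lambda>t. (-1 / h) * t + T / h" and Db="-1 / h", OF assms(1)]])
     (use assms in \<open>auto intro!: derivative_eq_intros\<close>)

lemma poisson_tail_integral:
  assumes h: "0 < h" and N: "0 < N" and T: "T = real N * h"
  shows "integrable lborel (\<lambda>t. indicator {0..T} t * poisson_tail N ((-1 / h) * t + T / h))"
    and "(LINT t|lborel. indicator {0..T} t * poisson_tail N ((-1 / h) * t + T / h)) = h * (real N * poisson (N - 1) (real N))"
proof -
  obtain k where k: "N = Suc k" using N by (cases N) auto
  \<comment> \<open>Integration by parts: the derivative of the tail is P_(N-1), and s P_(N-1)(s) =
    N P_N(s) is again the derivative of a tail.\<close>
  define Y where "Y s = s * poisson_tail N s - real N * poisson_tail (Suc N) s" for s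
  have DY: "(Y has_real_derivative poisson_tail N s) (at s)" for s
  proof (rule DERIV_cong)
    show "(Y has_real_derivative (1 * poisson_tail N s + poisson k s * s) - real N * poisson N s) (at s)"
      unfolding Y_def[abs_def] k
      by (intro DERIV_diff DERIV_mult DERIV_cmult DERIV_ident poisson_tail_derivative)
    show "(1 * poisson_tail N s + poisson k s * s) - real N * poisson N s = poisson_tail N s"
      using poisson_Suc[of k s] by (simp add: k)
  qed
  have c: "continuous_on UNIV (\<lambda>t. poisson_tail N ((-1 / h) * t + T / h))"
    using Ck_affine[OF Ck_poisson_tail[of 0 k], of "-1 / h" "T / h"] by (simp add: k)
  have TN: "0 \<le> T" "T / h = real N" using T h by auto
  show "integrable lborel (\<lambda>t. indicator {0..T} t * poisson_tail N ((-1 / h) * t + T / h))"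
    using borel_integrable_atLeastAtMost'[OF continuous_on_subset[OF c]] by (simp add: set_integrable_def)
  have "(LINT t|lborel. indicator {0..T} t *\<^sub>R poisson_tail N ((-1 / h) * t + T / h))
      = - h * Y ((-1 / h) * T + T / h) - - h * Y ((-1 / h) * 0 + T / h)"
  proof (rule integral_FTC_atLeastAtMost[OF TN(1)])
    fix t
    have "((\<lambda>t. - h * Y ((-1 / h) * t + T / h)) has_real_derivative - h * - (poisson_tail N ((-1 / h) * t + T / h) / h)) (at t)"
      by (rule DERIV_cmult[OF time_derivative_affine[OF DY]]) (use h in simp)
    then show "((\<lambda>t. - h * Y ((-1 / h) * t + T / h)) has_vector_derivative poisson_tail N ((-1 / h) * t + T / h)) (at t within {0..T})"
      unfolding has_real_derivative_iff_has_vector_derivative[symmetric]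
      using h by (auto intro: has_field_derivative_at_within)
  qed (rule continuous_on_subset[OF c], simp)
  also have "\<dots> = h * (Y (real N) - Y 0)" using TN h by (simp add: algebra_simps)
  also have "Y 0 = 0" by (simp add: Y_def poisson_tail_at_0)
  also have "Y (real N) = real N * poisson N (real N)"
    by (simp add: Y_def poisson_tail_def algebra_simps)
  also have "real N * poisson N (real N) = real N * poisson (N - 1) (real N)"
    using poisson_Suc[of k "real N"] by (simp add: k)
  finally show "(LINT t|lborel. indicator {0..T} t * poisson_tail N ((-1 / h) * t + T / h)) = h * (real N * poisson (N - 1) (real N))"
    by simp
qed

text \<open>The test functions \<open>\<tau>\<^sub>n (t) = P\<^bsub>N-n\<^esub> ((T - t) / h)\<close>, with \<open>P\<^sub>m\<close> the Poisson weights, solve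
  \<open>\<tau>\<^sub>n' = (\<tau>\<^sub>n - \<tau>\<^bsub>n+1\<^esub>) / h\<close> and \<open>\<tau>\<^sub>n (T) = \<delta>\<^bsub>nN\<^esub>\<close>, so that in the sum over \<open>n\<close> all \<open>a\<^sub>n\<close> cancel except the
  one at time \<open>T\<close>. The final term is the mean deviation of a Poisson variable of mean \<open>N\<close>, scaled by \<open>h\<close>.\<close>

lemma time_stepping_duality:
  fixes a b :: "nat \<Rightarrow> real \<Rightarrow> real" and a0 aT :: "nat \<Rightarrow> real"
  assumes h: "0 < h" and N: "0 < N" and T: "T = real N * h"
    and weak: "\<And>n \<tau> \<tau>'. n \<le> N \<Longrightarrow> (\<And>k. Ck k \<tau>) \<Longrightarrow> (\<And>t. (\<tau> has_real_derivative \<tau>' t) (at t)) \<Longrightarrow>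
        (\<And>t. t \<in> {0..T} \<Longrightarrow> 0 \<le> \<tau> t) \<Longrightarrow>
        integrable lborel (\<lambda>t. indicator {0<..<T} t * (\<tau>' t * a n t + \<tau> t * b n t)) \<and>
        0 \<le> (LINT t|lborel. indicator {0<..<T} t * (\<tau>' t * a n t + \<tau> t * b n t)) + \<tau> 0 * a0 n - \<tau> T * aT n"
    and step: "AE t in lborel. t \<in> {0<..<T} \<longrightarrow> (\<forall>n<N. b (Suc n) t + (a (Suc n) t - a n t) / h \<le> E)"
    and b0: "AE t in lborel. t \<in> {0<..<T} \<longrightarrow> b 0 t \<le> C"
    and init: "\<And>n. n \<le> N \<Longrightarrow> a0 n \<le> A + C * (real n * h)"
    and E: "0 \<le> E" and C: "0 \<le> C"
  shows "aT N \<le> A + E * T + 2 * C * (h * sqrt (real N))"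
proof -
  define s where "s t = (-1 / h) * t + T / h" for t
  \<comment> \<open>Level 0 has no predecessor and collects the whole tail, so that the weights sum
    to 1 at every time. The value 0 beyond level N ends the recursion.\<close>
  define \<sigma> where "\<sigma> n t = (if n = 0 then poisson_tail N (s t) else if n \<le> N then poisson (N - n) (s t) else 0)" for n t
  define \<sigma>' where "\<sigma>' n t = (if n = 0 then - (\<sigma> 1 t / h) else (\<sigma> n t - \<sigma> (Suc n) t) / h)" for n t
  define \<alpha> where "\<alpha> = real N * poisson (N - 1) (real N)"
  have sr: "s 0 = real N" "s T = 0" "0 \<le> s t" if "t \<in> {0..T}" for t
    using h T that by (auto simp: s_def field_simps)
  have s0: "s 0 = real N" and sT: "s T = 0" using h T by (auto simp: s_def)
  obtain k where k: "N = Suc k" using N by (cases N) auto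
  have Cks: "Ck j (\<sigma> n)" for j n
  proof -
    have "Ck j (\<lambda>t. poisson_tail N (s t))" "Ck j (\<lambda>t. poisson (N - n) (s t))"
      unfolding s_def k by (intro Ck_affine Ck_poisson_tail Ck_poisson)+
    then show ?thesis unfolding \<sigma>_def by (cases "n = 0"; cases "n \<le> N") (simp_all add: Ck_const)
  qed
  have D: "(\<sigma> n has_real_derivative \<sigma>' n t) (at t)" for n t
  proof -
    consider "n = 0" | "0 < n" "n \<le> N" | "N < n" by linarith
    then show ?thesis
    proof cases
      case 1
      have "(\<lambda>t. poisson_tail N (s t)) = \<sigma> n" using 1 by (auto simp: \<sigma>_def)
      moreover have "((\<lambda>t. poisson_tail N (s t)) has_real_derivative - (poisson k (s t) / h)) (at t)"
        unfolding s_def k using time_derivative_affine[OF poisson_tail_derivative] h by auto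
      ultimately show ?thesis using 1 N by (simp add: \<sigma>'_def \<sigma>_def k)
    next
      case 2
      have "(\<lambda>t. poisson (N - n) (s t)) = \<sigma> n" using 2 by (auto simp: \<sigma>_def)
      moreover have "((\<lambda>t. poisson (N - n) (s t)) has_real_derivative
          - (((if N - n = 0 then 0 else poisson (N - n - 1) (s t)) - poisson (N - n) (s t)) / h)) (at t)"
        unfolding s_def using h by (intro time_derivative_affine poisson_derivative) auto
      moreover have "- (((if N - n = 0 then 0 else poisson (N - n - 1) (s t)) - poisson (N - n) (s t)) / h) = \<sigma>' n t"
        using 2 by (auto simp: \<sigma>'_def \<sigma>_def diff_divide_distrib)
      ultimately show ?thesis by simp
    next
      case 3
      then have "\<sigma> n = (\<lambda>t. 0)" "\<sigma>' n t = 0" by (auto simp: \<sigma>_def \<sigma>'_def)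
      then show ?thesis by simp
    qed
  qed
  have nonneg: "0 \<le> \<sigma> n t" if "t \<in> {0..T}" for n t
    using sr(3)[OF that] by (auto simp: \<sigma>_def poisson_nonneg poisson_tail_nonneg)
  have total: "\<sigma> 0 t + (\<Sum>n<N. \<sigma> (Suc n) t) = 1" for t
  proof -
    have "(\<Sum>n<N. \<sigma> (Suc n) t) = (\<Sum>n<N. poisson (N - Suc n) (s t))"
      by (intro sum.cong) (auto simp: \<sigma>_def)
    also have "\<dots> = (\<Sum>n<N. poisson n (s t))" by (rule sum.nat_diff_reindex)
    finally show ?thesis by (simp add: \<sigma>_def poisson_tail_def)
  qed
  define I where "I n t = indicator {0<..<T} t * (\<sigma>' n t * a n t + \<sigma> n t * b n t)" for n t
  have w: "integrable lborel (I n)" "0 \<le> (LINT t|lborel. I n t) + \<sigma> n 0 * a0 n - \<sigma> n T * aT n" if "n \<le> N" for n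
    unfolding I_def[abs_def] using weak[OF that Cks D nonneg] by auto
  have "0 \<le> (\<Sum>n\<le>N. (LINT t|lborel. I n t) + \<sigma> n 0 * a0 n - \<sigma> n T * aT n)"
    by (intro sum_nonneg w) auto
  also have "\<dots> = (LINT t|lborel. (\<Sum>n\<le>N. I n t)) + (\<Sum>n\<le>N. \<sigma> n 0 * a0 n) - (\<Sum>n\<le>N. \<sigma> n T * aT n)"
    by (subst Bochner_Integration.integral_sum) (auto simp: w sum.distrib sum_subtractf)
  also have "(\<Sum>n\<le>N. \<sigma> n T * aT n) = aT N"
  proof -
    have "(\<Sum>n\<le>N. \<sigma> n T * aT n) = (\<Sum>n\<le>N. if n = N then aT n else 0)"
      using N by (intro sum.cong) (auto simp: \<sigma>_def sT poisson_at_0 poisson_tail_at_0 k)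
    then show ?thesis by simp
  qed
  also have "(\<Sum>n\<le>N. \<sigma> n 0 * a0 n) \<le> A + C * (h * \<alpha>)"
  proof -
    have "(\<Sum>n\<le>N. \<sigma> n 0 * a0 n) \<le> (\<Sum>n\<le>N. \<sigma> n 0 * (A + C * (real n * h)))"
    proof (intro sum_mono mult_left_mono init)
      show "0 \<le> \<sigma> n 0" for n using nonneg[of 0 n] T h by auto
    qed auto
    also have "\<dots> = A * (\<Sum>n\<le>N. \<sigma> n 0) + C * (h * (\<Sum>n\<le>N. real n * \<sigma> n 0))"
      by (simp add: algebra_simps sum.distrib sum_distrib_left)
    also have "(\<Sum>n\<le>N. \<sigma> n 0) = 1"
      using total[of 0] by (simp add: lessThan_Suc_atMost[symmetric] sum.lessThan_Suc_shift del: sum.lessThan_Suc)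
    \<comment> \<open>With m = N - n this is the expected positive part of N - m, for m Poisson of
      mean N.\<close>
    also have "(\<Sum>n\<le>N. real n * \<sigma> n 0) = \<alpha>"
    proof -
      have "(\<Sum>n\<le>N. real n * \<sigma> n 0) = (\<Sum>n<N. real (Suc n) * \<sigma> (Suc n) 0)"
        by (simp add: lessThan_Suc_atMost[symmetric] sum.lessThan_Suc_shift del: sum.lessThan_Suc of_nat_Suc)
      also have "\<dots> = (\<Sum>n<N. (real N - real (N - Suc n)) * poisson (N - Suc n) (real N))"
        by (intro sum.cong) (auto simp: \<sigma>_def s0 of_nat_diff)
      also have "\<dots> = (\<Sum>n<N. (real N - real n) * poisson n (real N))"
        by (rule sum.nat_diff_reindex)
      also have "\<dots> = \<alpha>"
        using poisson_first_moment[of "real N" k] by (simp add: \<alpha>_def k lessThan_Suc_atMost)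
      finally show ?thesis .
    qed
    finally show ?thesis by simp
  qed
  also have "(LINT t|lborel. (\<Sum>n\<le>N. I n t)) \<le> E * T + C * (h * \<alpha>)"
  proof -
    \<comment> \<open>The time spent at level 0 has the same mean \<open>h * \<alpha>\<close> as the
      initial contribution, hence the factor 2 in the claim.\<close>
    note tl = poisson_tail_integral[OF h N T]
    have "(LINT t|lborel. (\<Sum>n\<le>N. I n t)) \<le> (LINT t|lborel. E * indicator {0..T} t + C * (indicator {0..T} t * poisson_tail N (s t)))"
    proof (rule integral_mono_AE)
      show "integrable lborel (\<lambda>t. E * indicator {0..T} t + C * (indicator {0..T} t * poisson_tail N (s t)))"
        using tl(1) T h unfolding s_def by auto
      show "AE t in lborel. (\<Sum>n\<le>N. I n t) \<le> E * indicator {0..T} t + C * (indicator {0..T} t * poisson_tail N (s t))"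
        using step b0
      proof eventually_elim
        case (elim t)
        show ?case
        proof (cases "t \<in> {0<..<T}")
          case False
          then show ?thesis using E C nonneg[of t 0] by (auto simp: I_def indicator_def \<sigma>_def)
        next
          case True
          then have t: "t \<in> {0..T}" by auto
          have "(\<Sum>n\<le>N. I n t) = (\<sigma>' 0 t * a 0 t + \<sigma> 0 t * b 0 t) + (\<Sum>n<N. \<sigma>' (Suc n) t * a (Suc n) t + \<sigma> (Suc n) t * b (Suc n) t)"
            using True by (simp add: I_def lessThan_Suc_atMost[symmetric] sum.lessThan_Suc_shift del: sum.lessThan_Suc)
          also have "\<sigma> 0 t * b 0 t \<le> \<sigma> 0 t * C"
            using elim True nonneg[OF t] by (intro mult_left_mono) auto
          \<comment> \<open>Inserting the step inequality and the equation for
            \<open>\<sigma>'\<close> leaves a telescoping sum. Its end at n = 0 cancels against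
            \<open>\<sigma>' 0 t * a 0 t\<close>, and its other end vanishes.\<close>
          also have "(\<Sum>n<N. \<sigma>' (Suc n) t * a (Suc n) t + \<sigma> (Suc n) t * b (Suc n) t)
            \<le> (\<Sum>n<N. E * \<sigma> (Suc n) t + (\<sigma> (Suc n) t * a n t / h - \<sigma> (Suc (Suc n)) t * a (Suc n) t / h))"
          proof (rule sum_mono)
            fix n assume n: "n \<in> {..<N}"
            have "b (Suc n) t \<le> E - (a (Suc n) t - a n t) / h" using elim True n by auto
            note le = mult_left_mono[OF this nonneg[OF t, of "Suc n"]]
            have "\<sigma> (Suc n) t * (E - (a (Suc n) t - a n t) / h) = E * \<sigma> (Suc n) t - (\<sigma> (Suc n) t * a (Suc n) t / h - \<sigma> (Suc n) t * a n t / h)"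
              by (simp add: right_diff_distrib diff_divide_distrib)
            moreover have "\<sigma>' (Suc n) t * a (Suc n) t = \<sigma> (Suc n) t * a (Suc n) t / h - \<sigma> (Suc (Suc n)) t * a (Suc n) t / h"
              by (simp add: \<sigma>'_def left_diff_distrib diff_divide_distrib)
            ultimately show "\<sigma>' (Suc n) t * a (Suc n) t + \<sigma> (Suc n) t * b (Suc n) t
              \<le> E * \<sigma> (Suc n) t + (\<sigma> (Suc n) t * a n t / h - \<sigma> (Suc (Suc n)) t * a (Suc n) t / h)"
              using le by linarith
          qed
          also have "\<dots> = E * (\<Sum>n<N. \<sigma> (Suc n) t) + (\<sigma> (Suc 0) t * a 0 t / h - \<sigma> (Suc N) t * a N t / h)"
            using sum_lessThan_telescope'[of "\<lambda>n. \<sigma> (Suc n) t * a n t / h" N]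
            by (simp add: sum.distrib sum_distrib_left)
          also have "\<sigma> (Suc N) t = 0" by (simp add: \<sigma>_def)
          also have "\<sigma>' 0 t = - (\<sigma> (Suc 0) t / h)" by (simp add: \<sigma>'_def)
          also have "E * (\<Sum>n<N. \<sigma> (Suc n) t) \<le> E * 1"
            using total[of t] nonneg[OF t, of 0] E by (intro mult_left_mono) auto
          finally show ?thesis using t by (simp add: \<sigma>_def mult.commute)
        qed
      qed
    qed (auto intro!: w Bochner_Integration.integrable_sum)
    also have "\<dots> = E * T + C * (h * \<alpha>)"
      using tl T h unfolding s_def \<alpha>_def by simp
    finally show ?thesis .
  qed
  finally have "aT N \<le> A + E * T + 2 * C * (h * \<alpha>)" by (simp add: algebra_simps)
  also have "\<dots> \<le> A + E * T + 2 * C * (h * sqrt (real N))"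
    using poisson_deviation[OF N] C h unfolding \<alpha>_def by (auto intro!: mult_left_mono)
  finally show ?thesis .
qed

section \<open>Cell averages and monotone fluxes\<close>

lemma cell_sets [measurable]: "cell d i \<in> sets borel"
  by (simp add: cell_def)

lemma floor_in_cell:
  assumes "0 < d" "y \<in> cell d i"
  shows "\<lfloor>y / d\<rfloor> = i"
proof -
  have "real_of_int i < y / d" "y / d < real_of_int i + 1"
    using assms by (auto simp: cell_def field_simps)
  then show ?thesis by (simp add: floor_eq_iff)
qed

lemma AE_in_cell:
  assumes d: "0 < d"
  shows "AE y in lborel. y \<in> cell d \<lfloor>y / d\<rfloor>"
proof -
  have "AE y in lborel. y \<notin> range (\<lambda>i::int. of_int i * d)"
    by (rule AE_not_in) (auto intro!: countable_imp_null_set_lborel)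
  then show ?thesis
  proof eventually_elim
    case (elim y)
    have "real_of_int \<lfloor>y / d\<rfloor> * d \<le> y" "y < (real_of_int \<lfloor>y / d\<rfloor> + 1) * d"
      using floor_divide_lower[OF d] floor_divide_upper[OF d] by auto
    moreover have "real_of_int \<lfloor>y / d\<rfloor> * d \<noteq> y" using elim by (metis rangeI)
    ultimately show ?case by (auto simp: cell_def)
  qed
qed

lemma cell_disjoint: "0 < d \<Longrightarrow> i \<noteq> j \<Longrightarrow> cell d i \<inter> cell d j = {}"
  using floor_in_cell by blast

text \<open>Disjointness of the cells bounds all finite sums by the L^1 norm. The value is then
  found along the enumeration \<open>int_decode\<close>, where countable additivity applies; the
  open cells miss only the grid points.\<close>

lemma cell_has_sum:
  fixes h :: "real \<Rightarrow> real"
  assumes d: "0 < d" and h: "integrable lborel h"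
  shows "((\<lambda>i. LINT x:cell d i|lborel. h x) has_sum (LINT x|lborel. h x)) UNIV"
proof -
  define f where "f i = (LINT x:cell d i|lborel. h x)" for i
  have [measurable]: "h \<in> borel_measurable borel" using h by simp
  have si: "set_integrable lborel A h" if "A \<in> sets borel" for A
    unfolding set_integrable_def using h that by (intro integrable_mult_indicator) auto
  have "(\<lambda>i. norm (f i)) summable_on UNIV"
  proof (rule nonneg_bdd_above_summable_on)
    show "bdd_above (sum (\<lambda>i. norm (f i)) ` {F. F \<subseteq> UNIV \<and> finite F})"
    proof (rule bdd_aboveI2)
      fix F :: "int set" assume "F \<in> {F. F \<subseteq> UNIV \<and> finite F}"
      then have F: "finite F" by auto
      have "(\<Sum>i\<in>F. norm (f i)) \<le> (\<Sum>i\<in>F. LINT x:cell d i|lborel. \<bar>h x\<bar>)"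
        unfolding f_def using si by (intro sum_mono) (simp add: set_integral_norm_bound[of lborel _ h, simplified])
      also have "\<dots> = (LINT x:(\<Union>i\<in>F. cell d i)|lborel. \<bar>h x\<bar>)"
        using F si by (intro set_integral_finite_Union[symmetric])
          (auto simp: disjoint_family_on_def cell_disjoint[OF d] intro: set_integrable_abs)
      also have "\<dots> \<le> (L1norm h)"
        unfolding set_lebesgue_integral_def
      proof (rule integral_mono)
        show "integrable lborel (\<lambda>x. indicat_real (\<Union>i\<in>F. cell d i) x *\<^sub>R \<bar>h x\<bar>)"
          using h F by (intro integrable_mult_indicator) auto
      qed (use h in \<open>auto simp: indicator_def\<close>)
      finally show "(\<Sum>i\<in>F. norm (f i)) \<le> (L1norm h)" .
    qed
  qed auto
  then have "f summable_on UNIV" by (rule abs_summable_summable)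
  then obtain s where s: "(f has_sum s) UNIV" by (auto simp: summable_on_def)
  have "((\<lambda>n. f (int_decode n)) has_sum s) UNIV"
    using s has_sum_reindex_bij_betw[OF bij_int_decode, of f s] by simp
  then have "(\<lambda>n. f (int_decode n)) sums s" by (rule has_sum_imp_sums)
  then have "s = (\<Sum>n. f (int_decode n))" by (rule sums_unique)
  also have "\<dots> = (LINT x:(\<Union>n. cell d (int_decode n))|lborel. h x)"
    unfolding f_def
  proof (rule lebesgue_integral_countable_add[symmetric])
    show "cell d (int_decode i) \<inter> cell d (int_decode j) = {}" if "i \<noteq> j" for i j
      using cell_disjoint[OF d] that by (metis inj_int_decode inj_eq)
    show "set_integrable lborel (\<Union>i. cell d (int_decode i)) h" by (rule si) auto
  qed auto
  also have "\<dots> = (LINT x|lborel. h x)"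
    unfolding set_lebesgue_integral_def
  proof (rule integral_cong_AE)
    show "AE x in lborel. indicat_real (\<Union>n. cell d (int_decode n)) x *\<^sub>R h x = h x"
      using AE_in_cell[OF d]
    proof eventually_elim
      case (elim x)
      then have "x \<in> (\<Union>n. cell d (int_decode n))" by (metis UN_iff UNIV_I int_encode_inverse)
      then show ?case by simp
    qed
  qed auto
  finally show ?thesis using s unfolding f_def by simp
qed

lemma cell_constant_mult_integral:
  fixes g :: "real \<Rightarrow> real" and c :: "int \<Rightarrow> real"
  assumes d: "0 < d"
  shows "(LINT y:cell d i|lborel. c \<lfloor>y / d\<rfloor> * g y) = c i * (LINT y:cell d i|lborel. g y)"
proof -
  have "(LINT y:cell d i|lborel. c \<lfloor>y / d\<rfloor> * g y) = (LINT y:cell d i|lborel. c i * g y)"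
    by (rule set_lebesgue_integral_cong) (auto simp: floor_in_cell[OF d])
  then show ?thesis by simp
qed

lemma cell_length: "0 < d \<Longrightarrow> (LINT y:cell d i|lborel. (1::real)) = d"
  by (simp add: cell_def set_lebesgue_integral_def algebra_simps)

lemma cell_zero_mean_integral:
  fixes g :: "real \<Rightarrow> real" and c :: "int \<Rightarrow> real"
  assumes d: "0 < d" and g: "\<And>i. (LINT y:cell d i|lborel. g y) = 0"
  shows "(LINT y|lborel. c \<lfloor>y / d\<rfloor> * g y) = 0"
\<comment> \<open>Without integrability the integral is 0 by convention, and the claim holds as
  well.\<close>
proof (cases "integrable lborel (\<lambda>y. c \<lfloor>y / d\<rfloor> * g y)")
  case True
  from cell_has_sum[OF d True] have "((\<lambda>i::int. 0::real) has_sum (LINT y|lborel. c \<lfloor>y / d\<rfloor> * g y)) UNIV"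
    by (simp add: cell_constant_mult_integral[OF d] g)
  then show ?thesis using has_sum_0 has_sum_unique by (metis (mono_tags, lifting))
qed (simp add: not_integrable_integral_eq)

text \<open>The scheme sees only the cell average of g, multiplied by a sign that is constant in y
  on each cell. As g minus its average has mean 0 on cells, \<omega>(x - y) may be replaced by its
  value at the left end of the cell, and the error gains a factor d.\<close>

lemma cell_average_error:
  fixes g \<omega> :: "real \<Rightarrow> real" and gd :: "int \<Rightarrow> real" and \<theta> :: "real \<Rightarrow> int \<Rightarrow> real"
  assumes d: "0 < d" and g: "integrable lborel g" and gd: "integrable lborel (\<lambda>y. gd \<lfloor>y / d\<rfloor>)"
    and avg: "\<And>i. d * gd i = (LINT y:cell d i|lborel. g y)"
    and \<theta>[measurable]: "(\<lambda>(x, y). \<theta> x \<lfloor>y / d\<rfloor>) \<in> borel_measurable plane"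
    and \<theta>1: "\<And>x i. \<bar>\<theta> x i\<bar> \<le> 1"
    and \<omega>: "L1_lipschitz \<Omega> \<omega>"
  shows "\<bar>LINT (x, y)|plane. \<theta> x \<lfloor>y / d\<rfloor> * (g y - gd \<lfloor>y / d\<rfloor>) * \<omega> (x - y)\<bar>
    \<le> (LINT y|lborel. \<bar>g y - gd \<lfloor>y / d\<rfloor>\<bar>) * (d * \<Omega>)"
proof -
  note \<omega>D = L1_lipschitzD[OF \<omega>]
  have [measurable]: "g \<in> borel_measurable borel" "\<omega> \<in> borel_measurable borel" using g \<omega>D by auto
  define e where "e y = g y - gd \<lfloor>y / d\<rfloor>" for y
  have e: "integrable lborel e" unfolding e_def[abs_def] using g gd by auto
  have [measurable]: "e \<in> borel_measurable borel" using e by simp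
  define s where "s y = \<lfloor>y / d\<rfloor> * d" for y :: real
  have [measurable]: "s \<in> borel_measurable borel" unfolding s_def[abs_def] by measurable
  have s: "\<bar>y - s y\<bar> \<le> d" for y
  proof -
    show ?thesis using d floor_divide_lower[OF d, of y] floor_divide_upper[OF d, of y]
      by (auto simp: s_def algebra_simps abs_le_iff)
  qed
  define H where "H p = \<theta> (fst p) \<lfloor>snd p / d\<rfloor> * e (snd p) * (\<omega> (fst p - snd p) - \<omega> (fst p - s (snd p)))" for p
  have \<theta>m: "(\<lambda>p. \<theta> (fst p) \<lfloor>snd p / d\<rfloor>) \<in> borel_measurable plane"
    using \<theta> by (simp add: case_prod_beta')
  have Hm[measurable]: "H \<in> borel_measurable plane"
    unfolding H_def[abs_def] using \<theta>m by measurable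
  \<comment> \<open>The order of the variables is reversed, since it is the integral in x that
    yields the factor \<open>d * \<Omega>\<close>.\<close>
  define H' where "H' = (\<lambda>(y, x). H (x, y))"
  have Hm'[measurable]: "H' \<in> borel_measurable plane"
    unfolding H'_def by measurable
  have BI: "integrable lborel (\<lambda>y. \<bar>e y\<bar> * (d * \<Omega>))" using e by auto
  have B: "AE y in lborel. integrable lborel (\<lambda>x. H' (y, x)) \<and> (LINT x|lborel. \<bar>H' (y, x)\<bar>) \<le> \<bar>e y\<bar> * (d * \<Omega>)"
  proof (rule AE_I2)
    fix y
    let ?D = "\<lambda>x. \<bar>\<omega> (x - y) - \<omega> (x - s y)\<bar>"
    have D: "integrable lborel ?D"
      using integrable_shift[OF \<omega>D(1), of "- y"] integrable_shift[OF \<omega>D(1), of "- s y"] by auto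
    have "(LINT x|lborel. ?D x) = (LINT x|lborel. \<bar>\<omega> (x + (s y - y)) - \<omega> x\<bar>)"
      using integral_shift[of ?D "s y"] by (simp add: algebra_simps)
    also have "\<dots> \<le> \<Omega> * \<bar>s y - y\<bar>" by (rule \<omega>D(3))
    also have "\<dots> \<le> \<Omega> * d" using s[of y] \<omega>D(5) by (intro mult_left_mono) (auto simp: abs_minus_commute)
    finally have D2: "(LINT x|lborel. ?D x) \<le> d * \<Omega>" by (simp add: mult.commute)
    have b: "\<bar>H' (y, x)\<bar> \<le> \<bar>e y\<bar> * ?D x" for x
    proof -
      have "\<bar>\<theta> x \<lfloor>y / d\<rfloor>\<bar> * (\<bar>e y\<bar> * ?D x) \<le> 1 * (\<bar>e y\<bar> * ?D x)" by (intro mult_right_mono \<theta>1) auto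
      then show ?thesis by (simp add: H'_def H_def abs_mult mult.assoc)
    qed
    have i: "integrable lborel (\<lambda>x. H' (y, x))"
      by (rule Bochner_Integration.integrable_bound[of _ "\<lambda>x. \<bar>e y\<bar> * ?D x"])
         (use D b in \<open>auto intro!: AE_I2\<close>)
    have "(LINT x|lborel. \<bar>H' (y, x)\<bar>) \<le> (LINT x|lborel. \<bar>e y\<bar> * ?D x)"
      by (rule integral_mono) (use i D b in auto)
    also have "\<dots> \<le> \<bar>e y\<bar> * (d * \<Omega>)" using D2 by (simp add: mult_left_mono)
    finally show "integrable lborel (\<lambda>x. H' (y, x)) \<and> (LINT x|lborel. \<bar>H' (y, x)\<bar>) \<le> \<bar>e y\<bar> * (d * \<Omega>)"
      using i by simp
  qed
  have H'i: "integrable plane H'"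
    by (rule lborel_pair.integrable_pair_bound[OF Hm' B BI])
  have Hi: "integrable plane H"
    using lborel_pair.integrable_product_swap[OF H'i] by (simp add: H'_def)
  have HH: "(LINT p|plane. H' p) = (LINT p|plane. H p)"
    unfolding H'_def by (rule lborel_pair.integral_product_swap[OF Hm])
  define J where "J p = \<theta> (fst p) \<lfloor>snd p / d\<rfloor> * e (snd p) * \<omega> (fst p - snd p)" for p
  have J: "integrable plane J"
    unfolding J_def[abs_def] using conv_weighted_integrable[OF e \<omega>D(1) \<theta>m, of snd] \<theta>1 by simp
  define J0 where "J0 p = \<theta> (fst p) \<lfloor>snd p / d\<rfloor> * e (snd p) * \<omega> (fst p - s (snd p))" for p
  have JH: "J0 = (\<lambda>p. J p - H p)" by (auto simp: J_def J0_def H_def algebra_simps)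
  have J0: "integrable plane J0" unfolding JH using J Hi by auto
  have em: "(LINT y:cell d i|lborel. e y) = 0" for i
  proof -
    have gi: "set_integrable lborel (cell d i) g" "set_integrable lborel (cell d i) (\<lambda>y. gd \<lfloor>y / d\<rfloor> * 1)"
      unfolding set_integrable_def using integrable_mult_indicator[OF _ g, of "cell d i"] integrable_mult_indicator[OF _ gd, of "cell d i"] by auto
    have "(LINT y:cell d i|lborel. e y) = (LINT y:cell d i|lborel. g y) - (LINT y:cell d i|lborel. gd \<lfloor>y / d\<rfloor> * 1)"
      unfolding e_def[abs_def] using set_integral_diff(2)[OF gi] by simp
    also have "\<dots> = 0" using cell_constant_mult_integral[OF d, of i gd "\<lambda>_. 1"] cell_length[OF d, of i] avg[of i] by (simp add: mult.commute)
    finally show ?thesis .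
  qed
  have "(LINT y|lborel. J0 (x, y)) = 0" for x
    using cell_zero_mean_integral[OF d em, of "\<lambda>i. \<theta> x i * \<omega> (x - of_int i * d)"]
    by (simp add: J0_def s_def mult_ac)
  then have "(LINT p|plane. J0 p) = 0"
    using lborel_pair.integral_fst'[OF J0] by simp
  then have "(LINT p|plane. J p) = (LINT p|plane. H p)"
    using J Hi by (simp add: JH)
  moreover have "\<bar>LINT p|plane. H p\<bar> \<le> (L1norm e) * (d * \<Omega>)"
    using lborel_pair.integral_pair_bound[OF Hm' B BI] by (simp add: HH)
  ultimately show ?thesis by (simp add: J_def e_def case_prod_beta')
qed

text \<open>With \<open>c = e = k\<close> this is the numerical Kruzkov entropy flux; with a second grid function in place
  of \<open>(c, e)\<close> it is the flux that telescopes in the proof of \<open>\<ell>\<^sup>1\<close> contraction.\<close>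

definition entropy_flux :: "(real \<Rightarrow> real \<Rightarrow> real) \<Rightarrow> real \<Rightarrow> real \<Rightarrow> real \<Rightarrow> real \<Rightarrow> real" where
  "entropy_flux F a b c e = sgn (a - c) * (F a b - F c b) + sgn (b - e) * (F c b - F c e)"

section \<open>Monotone numerical fluxes\<close>

locale monotone_flux =
  fixes f :: "real \<Rightarrow> real" and F :: "real \<Rightarrow> real \<Rightarrow> real" and F1 F2 :: real
  assumes flux: "numerical_flux f F"
    and F1_pos: "0 < F1" and F1_lip: "\<And>b. F1-lipschitz_on UNIV (\<lambda>a. F a b)"
    and F2_pos: "0 < F2" and F2_lip: "\<And>a. F2-lipschitz_on UNIV (\<lambda>b. F a b)"
begin

lemma F_diag: "F a a = f a"
  using flux by (simp add: numerical_flux_def)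

lemma F_mono1: "a \<le> a' \<Longrightarrow> F a b \<le> F a' b"
  using flux by (auto simp: numerical_flux_def mono_def)

lemma F_mono2: "b \<le> b' \<Longrightarrow> F a b' \<le> F a b"
  using flux by (auto simp: numerical_flux_def antimono_def)

lemma F_lip1: "\<bar>F a b - F c b\<bar> \<le> F1 * \<bar>a - c\<bar>"
  using lipschitz_onD[OF F1_lip, of a c b] by (simp add: dist_real_def)

lemma F_lip2: "\<bar>F a b - F a c\<bar> \<le> F2 * \<bar>b - c\<bar>"
  using lipschitz_onD[OF F2_lip, of b c a] by (simp add: dist_real_def)

lemma f_lip: "\<bar>f a - f b\<bar> \<le> (F1 + F2) * \<bar>a - b\<bar>"
  using F_lip1[of a a b] F_lip2[of b a b] by (simp add: F_diag[symmetric] algebra_simps)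

lemma F_measurable [measurable (raw)]:
  assumes "g \<in> borel_measurable M" "h \<in> borel_measurable M"
  shows "(\<lambda>x. F (g x) (h x)) \<in> borel_measurable M"
proof -
  obtain L where "L-lipschitz_on UNIV (\<lambda>(a, b). F a b)" using flux by (auto simp: numerical_flux_def)
  then have "continuous_on UNIV (\<lambda>(a, b). F a b)" by (rule lipschitz_on_continuous_on)
  then show ?thesis
    using borel_measurable_continuous_Pair[of g M h F] assms by (simp add: case_prod_beta')
qed

lemma f_measurable [measurable (raw)]:
  "g \<in> borel_measurable M \<Longrightarrow> (\<lambda>x. f (g x)) \<in> borel_measurable M"
  using F_measurable[of g M g] by (simp add: F_diag)

lemma q_measurable [measurable (raw)]:
  assumes [measurable]: "g \<in> borel_measurable M" "h \<in> borel_measurable M"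
  shows "(\<lambda>x. q f (g x) (h x)) \<in> borel_measurable M"
  unfolding q_def eta'_def by measurable

lemma entropy_flux_measurable [measurable (raw)]:
  assumes [measurable]: "g \<in> borel_measurable M" "h \<in> borel_measurable M" "k \<in> borel_measurable M"
  shows "(\<lambda>x. entropy_flux F (g x) (h x) (k x) (k x)) \<in> borel_measurable M"
  unfolding entropy_flux_def by measurable

lemma sgn_F1: "sgn (a - c) * (F a b - F c b) = \<bar>F a b - F c b\<bar>"
  using F_mono1[of a c b] F_mono1[of c a b] by (auto simp: sgn_if)

lemma sgn_F2: "sgn (b - e) * (F c b - F c e) = - \<bar>F c b - F c e\<bar>"
  using F_mono2[of b e c] F_mono2[of e b c] by (auto simp: sgn_if)

text \<open>Monotonicity absorbs the signs: F increases in its first argument and decreases in its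
  second.\<close>

lemma entropy_flux_eq: "entropy_flux F a b c e = \<bar>F a b - F c b\<bar> - \<bar>F c b - F c e\<bar>"
  by (simp add: entropy_flux_def sgn_F1 sgn_F2)

lemma entropy_flux_bound: "\<bar>entropy_flux F a b c e\<bar> \<le> F1 * \<bar>a - c\<bar> + F2 * \<bar>b - e\<bar>"
  unfolding entropy_flux_eq using F_lip1[of a b c] F_lip2[of c b e] by linarith

lemma entropy_flux_diag: "entropy_flux F a a k k = q f a k"
proof -
  have "entropy_flux F a a k k = sgn (a - k) * (f a - f k)"
    by (simp add: entropy_flux_def F_diag algebra_simps)
  also have "\<dots> = q f a k" by (auto simp: q_def eta'_def sgn_if)
  finally show ?thesis .
qed

lemma entropy_flux_lip2: "\<bar>entropy_flux F a b k k - entropy_flux F a a k k\<bar> \<le> 3 * F2 * \<bar>b - a\<bar>"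
  unfolding entropy_flux_eq using F_lip2[of a b a] F_lip2[of k b a] by linarith

lemma q_bound: "\<bar>q f a k\<bar> \<le> (F1 + F2) * \<bar>k - a\<bar>"
proof -
  have "\<bar>q f a k\<bar> \<le> \<bar>f k - f a\<bar>" by (auto simp: q_def eta'_def sgn_if abs_mult)
  with f_lip[of k a] show ?thesis by linarith
qed

text \<open>If k lies between a and b, the two values are unrelated, but then |k - a| + |k - b| = |a
  - b| and the bound at each of them suffices.\<close>

lemma q_lip: "\<bar>q f a k - q f b k\<bar> \<le> (F1 + F2) * \<bar>a - b\<bar>"
proof -
  consider "k \<le> a" "k \<le> b" | "a \<le> k" "b \<le> k" | "a < k" "k < b" | "b < k" "k < a" by linarith
  then show ?thesis
  proof cases
    case 1
    then have "q f a k - q f b k = f a - f b" by (auto simp: q_def eta'_def sgn_if)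
    then show ?thesis using f_lip[of a b] by simp
  next
    case 2
    then have "q f a k - q f b k = f b - f a" by (auto simp: q_def eta'_def sgn_if)
    then show ?thesis using f_lip[of a b] by simp
  next
    case 3
    have "\<bar>q f a k - q f b k\<bar> \<le> (F1 + F2) * \<bar>k - a\<bar> + (F1 + F2) * \<bar>k - b\<bar>"
      using q_bound[of a k] q_bound[of b k] by linarith
    also have "\<dots> = (F1 + F2) * \<bar>a - b\<bar>" using 3 by (simp add: algebra_simps)
    finally show ?thesis .
  next
    case 4
    have "\<bar>q f a k - q f b k\<bar> \<le> (F1 + F2) * \<bar>k - a\<bar> + (F1 + F2) * \<bar>k - b\<bar>"
      using q_bound[of a k] q_bound[of b k] by linarith
    also have "\<dots> = (F1 + F2) * \<bar>a - b\<bar>" using 4 by (simp add: algebra_simps)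
    finally show ?thesis .
  qed
qed

text \<open>The change of F caused by the centre cell has a known sign in both fluxes, and the CFL
  condition lets the centre difference dominate it; the changes caused by the neighbours are
  estimated by the triangle inequality. A constant second state gives the discrete entropy
  inequality, a second grid function gives the contraction. \<open>\<delta>\<close> is the share of
  the old value that the diagonal of the nonlocal operator takes away in the explicit
  scheme.\<close>

lemma monotone_step_abs:
  assumes \<mu>: "0 \<le> \<mu>" and cfl: "\<mu> * (F1 + F2) + \<delta> \<le> 1"
  shows "\<bar>(1 - \<delta>) * (a0 - c0) - \<mu> * ((F a0 a1 - F c0 c1) - (F am a0 - F cm c0))\<bar>
    \<le> (1 - \<delta>) * \<bar>a0 - c0\<bar> - \<mu> * (entropy_flux F a0 a1 c0 c1 - entropy_flux F am a0 cm c0)"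
proof -
  \<comment> \<open>\<open>A\<close> and \<open>E\<close> are the variations in the centre cell,
    \<open>B\<close> and \<open>C\<close> those in the right and left neighbours.\<close>
  define D A B C E where "D = a0 - c0" and "A = F a0 a1 - F c0 a1" and "B = F c0 a1 - F c0 c1"
    and "C = F am a0 - F cm a0" and "E = F cm a0 - F cm c0"
  have AE: "sgn D * A = \<bar>A\<bar>" "sgn D * E = - \<bar>E\<bar>" "\<bar>A\<bar> \<le> F1 * \<bar>D\<bar>" "\<bar>E\<bar> \<le> F2 * \<bar>D\<bar>"
    unfolding D_def A_def E_def using sgn_F1 sgn_F2 F_lip1 F_lip2 by auto
  have "\<mu> * (\<bar>A\<bar> + \<bar>E\<bar>) \<le> \<mu> * ((F1 + F2) * \<bar>D\<bar>)" using AE \<mu> by (intro mult_left_mono) (auto simp: algebra_simps)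
  also have "\<dots> \<le> (1 - \<delta>) * \<bar>D\<bar>" using cfl mult_right_mono[of "\<mu> * (F1 + F2)" "1 - \<delta>" "\<bar>D\<bar>"] by (simp add: mult.assoc)
  finally have nn: "0 \<le> (1 - \<delta>) * \<bar>D\<bar> - \<mu> * \<bar>A\<bar> - \<mu> * \<bar>E\<bar>" by (simp add: algebra_simps)
  have m: "\<bar>(1 - \<delta>) * D - \<mu> * A + \<mu> * E\<bar> \<le> (1 - \<delta>) * \<bar>D\<bar> - \<mu> * \<bar>A\<bar> - \<mu> * \<bar>E\<bar>"
  proof (cases "D = 0")
    case True
    then have "A = 0" "E = 0" by (auto simp: D_def A_def E_def)
    then show ?thesis using True by simp
  next
    case False
    then consider "0 < D" | "D < 0" by linarith
    then show ?thesis
    proof cases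
      case 1
      then have "0 \<le> A" "E \<le> 0" using AE(1,2) by (simp_all add: abs_if split: if_splits)
      then have a: "\<bar>A\<bar> = A" "\<bar>E\<bar> = - E" "\<bar>D\<bar> = D" using 1 by simp_all
      show ?thesis using nn unfolding a mult_minus_right by linarith
    next
      case 2
      then have "A \<le> 0" "0 \<le> E" using AE(1,2) by (simp_all add: abs_if split: if_splits)
      then have a: "\<bar>A\<bar> = - A" "\<bar>E\<bar> = E" "\<bar>D\<bar> = - D" using 2 by simp_all
      show ?thesis using nn unfolding a mult_minus_right by linarith
    qed
  qed
  have "(1 - \<delta>) * (a0 - c0) - \<mu> * ((F a0 a1 - F c0 c1) - (F am a0 - F cm c0))
      = ((1 - \<delta>) * D - \<mu> * A + \<mu> * E) - \<mu> * B + \<mu> * C"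
    by (simp add: D_def A_def B_def C_def E_def algebra_simps)
  note eq = this
  have "\<bar>(1 - \<delta>) * (a0 - c0) - \<mu> * ((F a0 a1 - F c0 c1) - (F am a0 - F cm c0))\<bar>
      \<le> \<bar>(1 - \<delta>) * D - \<mu> * A + \<mu> * E\<bar> + \<mu> * \<bar>B\<bar> + \<mu> * \<bar>C\<bar>"
  proof -
    have "\<bar>\<mu> * B\<bar> = \<mu> * \<bar>B\<bar>" "\<bar>\<mu> * C\<bar> = \<mu> * \<bar>C\<bar>" using \<mu> by (simp_all add: abs_mult)
    then show ?thesis using eq by linarith
  qed
  also have "\<dots> \<le> (1 - \<delta>) * \<bar>D\<bar> - \<mu> * (\<bar>A\<bar> - \<bar>B\<bar> - (\<bar>C\<bar> - \<bar>E\<bar>))"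
    using m by (simp add: algebra_simps)
  finally show ?thesis by (simp add: entropy_flux_eq D_def A_def B_def C_def E_def)
qed

end

section \<open>Flux terms in doubled variables\<close>

context monotone_flux
begin

lemma q_pair_conv:
  fixes w v K :: "real \<Rightarrow> real"
  assumes w: "integrable lborel w" and v: "integrable lborel v" and K: "integrable lborel K"
  shows "integrable plane (\<lambda>(x, y). q f (v y) (w x) * K (x - y))"
    and "(LINT (x, y)|plane. \<bar>q f (v y) (w x) * K (x - y)\<bar>)
      \<le> (F1 + F2) * ((L1norm w) + (L1norm v)) * (L1norm K)"
proof -
  have [measurable]: "w \<in> borel_measurable borel" "v \<in> borel_measurable borel" "K \<in> borel_measurable borel"
    using w v K by auto
  have m: "(\<lambda>(x, y). q f (v y) (w x) * K (x - y)) \<in> borel_measurable plane" by measurable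
  have b: "\<bar>case (x, y) of (x, y) \<Rightarrow> q f (v y) (w x) * K (x - y)\<bar>
      \<le> ((F1 + F2) * \<bar>w x\<bar> + (F1 + F2) * \<bar>v y\<bar>) * \<bar>K (x - y)\<bar>" for x y
  proof -
    have "\<bar>q f (v y) (w x)\<bar> \<le> (F1 + F2) * \<bar>w x - v y\<bar>" by (rule q_bound)
    also have "\<dots> \<le> (F1 + F2) * (\<bar>w x\<bar> + \<bar>v y\<bar>)" using F1_pos F2_pos by (intro mult_left_mono) auto
    finally show ?thesis by (simp add: abs_mult mult_right_mono distrib_left)
  qed
  note c = conv_bound[where P="\<lambda>x. (F1 + F2) * \<bar>w x\<bar>" and R="\<lambda>x. (F1 + F2) * \<bar>v x\<bar>" and K="\<lambda>x. \<bar>K x\<bar>", OF m _ _ _ b]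
  show "integrable plane (\<lambda>(x, y). q f (v y) (w x) * K (x - y))"
    by (rule c(1)) (use w v K in auto)
  show "(LINT (x, y)|plane. \<bar>q f (v y) (w x) * K (x - y)\<bar>)
      \<le> (F1 + F2) * ((L1norm w) + (L1norm v)) * (L1norm K)"
    using c(3) w v K by (simp add: case_prod_beta' distrib_left)
qed

lemma q_pair_diff:
  fixes w v v' K :: "real \<Rightarrow> real"
  assumes w: "integrable lborel w" and v: "integrable lborel v" and v': "integrable lborel v'" and K: "integrable lborel K"
  shows "\<bar>(LINT (x, y)|plane. q f (v y) (w x) * K (x - y)) - (LINT (x, y)|plane. q f (v' y) (w x) * K (x - y))\<bar>
      \<le> (F1 + F2) * (LINT y|lborel. \<bar>v y - v' y\<bar>) * (L1norm K)"
proof -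
  have [measurable]: "w \<in> borel_measurable borel" "v \<in> borel_measurable borel" "v' \<in> borel_measurable borel" "K \<in> borel_measurable borel"
    using w v v' K by auto
  define D where "D p = q f (v (snd p)) (w (fst p)) * K (fst p - snd p) - q f (v' (snd p)) (w (fst p)) * K (fst p - snd p)" for p
  have m: "D \<in> borel_measurable plane" unfolding D_def[abs_def] by measurable
  have b: "\<bar>D (x, y)\<bar> \<le> (0 + (F1 + F2) * \<bar>v y - v' y\<bar>) * \<bar>K (x - y)\<bar>" for x y
  proof -
    have "D (x, y) = (q f (v y) (w x) - q f (v' y) (w x)) * K (x - y)" by (simp add: D_def algebra_simps)
    then show ?thesis using q_lip[of "v y" "w x" "v' y"] by (simp add: abs_mult mult_right_mono)
  qed
  have "(LINT (x, y)|plane. q f (v y) (w x) * K (x - y)) - (LINT (x, y)|plane. q f (v' y) (w x) * K (x - y))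
      = (LINT p|plane. D p)"
    unfolding D_def using q_pair_conv(1)[OF w v K] q_pair_conv(1)[OF w v' K] by (simp add: case_prod_beta')
  then show ?thesis
    using conv_bound(2)[where P="\<lambda>x. 0" and R="\<lambda>y. (F1 + F2) * \<bar>v y - v' y\<bar>" and K="\<lambda>x. \<bar>K x\<bar>", OF m _ _ _ b] v v' K by simp
qed

text \<open>A translation of the kernel can be charged to \<open>v\<close>, and thereby to its
  variation.\<close>

lemma q_pair_shift:
  fixes w v K :: "real \<Rightarrow> real"
  assumes w: "w \<in> borel_measurable borel" and v: "v \<in> borel_measurable borel" and K: "K \<in> borel_measurable borel"
  shows "(LINT (x, y)|plane. q f (v y) (w x) * K (x - y - s))
    = (LINT (x, y)|plane. q f (v (y - s)) (w x) * K (x - y))"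
proof -
  note [measurable] = w v K
  have "(\<lambda>(x, y). q f (v y) (w x) * K (x - y - s)) \<in> borel_measurable plane" by measurable
  from integral_shift_pair[OF this, of 0 "- s"] show ?thesis by simp
qed

lemma integrable_shift_diff:
  fixes K :: "real \<Rightarrow> real"
  assumes "integrable lborel K"
  shows "integrable lborel (\<lambda>x. K (x - s))" "(LINT x|lborel. K (x - s)) = (LINT x|lborel. K x)"
    "(LINT x|lborel. \<bar>K (x - s)\<bar>) = (L1norm K)"
  using integrable_shift[OF assms, of "- s"] integral_shift[of K "- s"] integral_shift[of "\<lambda>x. \<bar>K x\<bar>" "- s"] by auto

lemma L1_lipschitz_shift_diff:
  assumes "L1_lipschitz B v"
  shows "(LINT y|lborel. \<bar>v y - v (y - s)\<bar>) \<le> B * \<bar>s\<bar>"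
  using L1_lipschitzD(3)[OF assms, of "- s"] by (simp add: abs_minus_commute)

text \<open>The remainder \<omega>(\<xi> - e) - \<omega>(\<xi>) + e \<omega>'(\<xi>) is the integral
  over s in [0, e] of \<omega>'(\<xi>) - \<omega>'(\<xi> - s). Each of these differences is a
  translation, which is moved onto v and costs at most B e. So the bound is quadratic in e with a
  single derivative of \<omega>.\<close>

lemma flux_difference_quotient:
  assumes D: "\<And>x. (\<omega> has_real_derivative \<omega>' x) (at x)" and c: "continuous_on UNIV \<omega>'"
    and \<omega>: "integrable lborel \<omega>" and \<omega>': "integrable lborel \<omega>'"
    and w: "integrable lborel w" and v: "L1_lipschitz B v" and e: "0 \<le> e"
  shows "\<bar>(LINT (x, y)|plane. q f (v y) (w x) * (\<omega> (x - y - e) - \<omega> (x - y)))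
      + e * (LINT (x, y)|plane. q f (v y) (w x) * \<omega>' (x - y))\<bar>
    \<le> (F1 + F2) * (B * e) * (L1norm \<omega>') * e"
proof -
  note vD = L1_lipschitzD[OF v]
  have [measurable]: "w \<in> borel_measurable borel" "v \<in> borel_measurable borel" "\<omega> \<in> borel_measurable borel" "\<omega>' \<in> borel_measurable borel"
    using w vD \<omega> \<omega>' by auto
  let ?\<Omega> = "LINT x|lborel. \<bar>\<omega>' x\<bar>"
  let ?i = "\<lambda>s::real. indicator {0..e} s :: real"
  define Q0 where "Q0 p = q f (v (snd p)) (w (fst p))" for p
  have [measurable]: "Q0 \<in> borel_measurable plane" unfolding Q0_def[abs_def] by measurable
  define H where "H s p = ?i s * (Q0 p * (\<omega>' (fst p - snd p) - \<omega>' (fst p - snd p - s)))" for s p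
  have Hm: "(\<lambda>(s, p). H s p) \<in> borel_measurable (lborel \<Otimes>\<^sub>M plane)"
    unfolding H_def by measurable
  let ?A = "2 * ((F1 + F2) * ((L1norm w) + (L1norm v)) * ?\<Omega>)"
  have Hs: "integrable plane (H s)" "(LINT p|plane. \<bar>H s p\<bar>) \<le> ?i s * ?A"
    "\<bar>LINT p|plane. H s p\<bar> \<le> ?i s * ((F1 + F2) * (B * e) * ?\<Omega>)" for s
  proof -
    note q0 = q_pair_conv[OF w vD(1) \<omega>'] and q1 = q_pair_conv[OF w vD(1) integrable_shift_diff(1)[OF \<omega>', of s]]
    have Heq: "H s = (\<lambda>p. ?i s * (Q0 p * \<omega>' (fst p - snd p) - Q0 p * \<omega>' (fst p - snd p - s)))"
      by (auto simp: H_def algebra_simps)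
    have i0: "integrable plane (\<lambda>p. Q0 p * \<omega>' (fst p - snd p))"
      "integrable plane (\<lambda>p. Q0 p * \<omega>' (fst p - snd p - s))"
      using q0(1) q1(1) by (auto simp: Q0_def case_prod_beta')
    then show i: "integrable plane (H s)" unfolding Heq by auto
    have "(LINT p|plane. \<bar>H s p\<bar>) \<le> (LINT p|plane. ?i s * (\<bar>Q0 p * \<omega>' (fst p - snd p)\<bar> + \<bar>Q0 p * \<omega>' (fst p - snd p - s)\<bar>))"
    proof (rule integral_mono)
      show "\<bar>H s p\<bar> \<le> ?i s * (\<bar>Q0 p * \<omega>' (fst p - snd p)\<bar> + \<bar>Q0 p * \<omega>' (fst p - snd p - s)\<bar>)" for p
        unfolding Heq by (auto simp: indicator_def)
    qed (use i i0 in auto)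
    also have "\<dots> = ?i s * ((LINT p|plane. \<bar>Q0 p * \<omega>' (fst p - snd p)\<bar>) + (LINT p|plane. \<bar>Q0 p * \<omega>' (fst p - snd p - s)\<bar>))"
      using i0[THEN integrable_abs] by simp
    also have "\<dots> \<le> ?i s * ?A"
      using q0(2) q1(2) integrable_shift_diff(3)[OF \<omega>', of s]
      by (intro mult_left_mono) (auto simp: Q0_def case_prod_beta')
    finally show "(LINT p|plane. \<bar>H s p\<bar>) \<le> ?i s * ?A" .
    have "(LINT p|plane. H s p) = ?i s * ((LINT (x, y)|plane. q f (v y) (w x) * \<omega>' (x - y))
        - (LINT (x, y)|plane. q f (v y) (w x) * \<omega>' (x - y - s)))"
      unfolding Heq using i0 by (simp add: Q0_def case_prod_beta')
    also have "(LINT (x, y)|plane. q f (v y) (w x) * \<omega>' (x - y - s)) = (LINT (x, y)|plane. q f (v (y - s)) (w x) * \<omega>' (x - y))"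
      by (rule q_pair_shift) auto
    finally have eq: "(LINT p|plane. H s p) = ?i s * ((LINT (x, y)|plane. q f (v y) (w x) * \<omega>' (x - y))
        - (LINT (x, y)|plane. q f (v (y - s)) (w x) * \<omega>' (x - y)))" .
    show "\<bar>LINT p|plane. H s p\<bar> \<le> ?i s * ((F1 + F2) * (B * e) * ?\<Omega>)"
    proof (cases "s \<in> {0..e}")
      case True
      have "\<bar>LINT p|plane. H s p\<bar> \<le> (F1 + F2) * (LINT y|lborel. \<bar>v y - v (y - s)\<bar>) * ?\<Omega>"
        unfolding eq using True q_pair_diff[OF w vD(1) integrable_shift_diff(1)[OF vD(1), of s] \<omega>'] by simp
      also have "(LINT y|lborel. \<bar>v y - v (y - s)\<bar>) \<le> B * e"
        using L1_lipschitz_shift_diff[OF v, of s] True vD(5) mult_left_mono[of s e B] by auto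
      finally show ?thesis using True F1_pos F2_pos by (simp add: mult_left_mono mult_right_mono)
    qed (simp add: eq)
  qed
  have Ai: "integrable lborel (\<lambda>s. ?i s * ?A)" using e by auto
  have Hi: "integrable (lborel \<Otimes>\<^sub>M plane) (\<lambda>(s, p). H s p)"
    by (rule lborel_real_pair.integrable_pair_bound[OF Hm _ Ai]) (use Hs in auto)
  have in1: "(LINT s|lborel. H s p) = Q0 p * (\<omega> (fst p - snd p - e) - \<omega> (fst p - snd p)) + e * (Q0 p * \<omega>' (fst p - snd p))" for p
  proof -
    define \<xi> where "\<xi> = fst p - snd p"
    have c': "continuous_on {0..e} (\<lambda>s. \<omega>' (\<xi> - s))"
      by (rule continuous_on_compose2[OF c]) (auto intro: continuous_intros)
    have i: "integrable lborel (\<lambda>s. ?i s * \<omega>' (\<xi> - s))"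
      using borel_integrable_atLeastAtMost'[OF c'] by (simp add: set_integrable_def)
    have "(LINT s|lborel. ?i s *\<^sub>R \<omega>' (\<xi> - s)) = - \<omega> (\<xi> - e) - (- \<omega> (\<xi> - 0))"
    proof (rule integral_FTC_atLeastAtMost[OF e])
      show "((\<lambda>s. - \<omega> (\<xi> - s)) has_vector_derivative \<omega>' (\<xi> - s)) (at s within {0..e})" for s
        unfolding has_real_derivative_iff_has_vector_derivative[symmetric]
        by (rule has_field_derivative_at_within)
           (rule DERIV_cong[OF DERIV_minus[OF DERIV_chain2[where g="\<lambda>y. \<xi> - y" and Db="-1", OF D]]], auto intro!: derivative_eq_intros)
    qed (rule c')
    then have s: "(LINT s|lborel. ?i s * \<omega>' (\<xi> - s)) = \<omega> \<xi> - \<omega> (\<xi> - e)" by simp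
    have "(LINT s|lborel. H s p) = (LINT s|lborel. Q0 p * \<omega>' \<xi> * ?i s - Q0 p * (?i s * \<omega>' (\<xi> - s)))"
      by (rule Bochner_Integration.integral_cong) (auto simp: H_def \<xi>_def algebra_simps)
    also have "\<dots> = Q0 p * \<omega>' \<xi> * e - Q0 p * (\<omega> \<xi> - \<omega> (\<xi> - e))"
      using i e s by simp
    finally show ?thesis by (simp add: \<xi>_def algebra_simps)
  qed
  have "integrable lborel (\<lambda>s. LINT p|plane. H s p)"
    using lborel_real_pair.integrable_fst'[OF Hi] by simp
  note Hsi = this
  have "\<bar>LINT s|lborel. LINT p|plane. H s p\<bar> \<le> (LINT s|lborel. \<bar>LINT p|plane. H s p\<bar>)"
    by (rule integral_abs_bound)
  also have "\<dots> \<le> (LINT s|lborel. ?i s * ((F1 + F2) * (B * e) * ?\<Omega>))"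
    by (rule integral_mono[OF integrable_abs[OF Hsi] _ Hs(3)]) (use e in auto)
  also have "\<dots> = (F1 + F2) * (B * e) * ?\<Omega> * e" using e by simp
  also have "(LINT s|lborel. LINT p|plane. H s p) = (LINT p|plane. LINT s|lborel. H s p)"
    using lborel_real_pair.Fubini_integral[of H] Hi by simp
  also have "\<dots> = (LINT p|plane. Q0 p * (\<omega> (fst p - snd p - e) - \<omega> (fst p - snd p)))
      + e * (LINT p|plane. Q0 p * \<omega>' (fst p - snd p))"
  proof -
    have "integrable plane (\<lambda>p. Q0 p * (\<omega> (fst p - snd p - e) - \<omega> (fst p - snd p)))"
      using q_pair_conv(1)[OF w vD(1) Bochner_Integration.integrable_diff[OF integrable_shift_diff(1)[OF \<omega>, of e] \<omega>]]
      by (simp add: Q0_def case_prod_beta')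
    moreover have "integrable plane (\<lambda>p. Q0 p * \<omega>' (fst p - snd p))"
      using q_pair_conv(1)[OF w vD(1) \<omega>'] by (simp add: Q0_def case_prod_beta')
    ultimately show ?thesis unfolding in1 by simp
  qed
  finally show ?thesis by (simp add: Q0_def case_prod_beta')
qed

text \<open>The derivative is traded for a difference quotient of step \<open>e\<close>, which is moved onto \<open>v\<close>, and \<open>e\<close> is chosen small compared with the width of the mollifier.\<close>

lemma mollified_flux_bound:
  assumes m: "mollifier r \<omega> \<omega>'" and w: "integrable lborel w" and v: "L1_lipschitz B v"
  shows "\<bar>LINT (x, y)|plane. q f (v y) (w x) * \<omega>' (x - y)\<bar> \<le> 2 * (F1 + F2) * B"
proof -
  note mD = mollifierD[OF m] and vD = L1_lipschitzD[OF v]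
  let ?\<Omega> = "LINT x|lborel. \<bar>\<omega>' x\<bar>"
  let ?N = "LINT (x, y)|plane. q f (v y) (w x) * \<omega>' (x - y)"
  \<comment> \<open>Makes the remainder of the difference quotient no larger than the bound of the
    quotient itself, hence the factor 2; the summand 1 keeps the denominator positive.\<close>
  define e where "e = 1 / (?\<Omega> + 1)"
  have \<Omega>: "0 \<le> ?\<Omega>" by simp
  then have "0 < ?\<Omega> + 1" by linarith
  then have e: "0 < e" "e * ?\<Omega> \<le> 1" unfolding e_def by (simp_all add: field_simps)
  let ?S = "LINT (x, y)|plane. q f (v y) (w x) * (\<omega> (x - y - e) - \<omega> (x - y))"
  have i: "integrable plane (\<lambda>(x, y). q f (v y) (w x) * \<omega> (x - y - e))"
    using q_pair_conv(1)[OF w vD(1) integrable_shift_diff(1)[OF mD(8), of e]] by simp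
  have S: "?S = (LINT (x, y)|plane. q f (v (y - e)) (w x) * \<omega> (x - y)) - (LINT (x, y)|plane. q f (v y) (w x) * \<omega> (x - y))"
    using i q_pair_conv(1)[OF w vD(1) mD(8)] q_pair_shift[of w v \<omega> e] w vD(2) mD(10)
    by (simp add: right_diff_distrib case_prod_beta')
  have "\<bar>?S\<bar> \<le> (F1 + F2) * (LINT y|lborel. \<bar>v (y - e) - v y\<bar>) * (L1norm \<omega>)"
    unfolding S by (rule q_pair_diff[OF w integrable_shift_diff(1)[OF vD(1)] vD(1) mD(8)])
  also have "(L1norm \<omega>) = 1" using mD(5,7) by simp
  also have "(LINT y|lborel. \<bar>v (y - e) - v y\<bar>) \<le> B * e"
    using L1_lipschitz_shift_diff[OF v, of e] e by (simp add: abs_minus_commute)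
  finally have S1: "\<bar>?S\<bar> \<le> (F1 + F2) * B * e" using F1_pos F2_pos by (simp add: mult.assoc)
  have "\<bar>?S + e * ?N\<bar> \<le> (F1 + F2) * (B * e) * ?\<Omega> * e"
    by (rule flux_difference_quotient[OF mD(2,3,8,9) w v]) (use e in simp)
  also have "\<dots> = (F1 + F2) * B * e * (e * ?\<Omega>)" by simp
  also have "\<dots> \<le> (F1 + F2) * B * e * 1"
    using e F1_pos F2_pos vD(5) by (intro mult_left_mono) auto
  finally have "e * \<bar>?N\<bar> \<le> e * (2 * (F1 + F2) * B)" using S1 e by (simp add: abs_mult[symmetric] algebra_simps)
  then show ?thesis using e by simp
qed

end

section \<open>One time step of the scheme against the solution\<close>

lemma floor_shift_cell: "0 < d \<Longrightarrow> \<lfloor>(y + d) / d\<rfloor> = \<lfloor>y / d\<rfloor> + 1" "0 < d \<Longrightarrow> \<lfloor>(y - d) / d\<rfloor> = \<lfloor>y / d\<rfloor> - 1"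
  by (simp_all add: add_divide_distrib diff_divide_distrib)

context monotone_flux
begin

lemma entropy_flux_pair_conv:
  fixes w v v1 K :: "real \<Rightarrow> real"
  assumes w: "integrable lborel w" and v: "integrable lborel v" and v1: "integrable lborel v1" and K: "integrable lborel K"
  shows "integrable plane (\<lambda>p. entropy_flux F (v (snd p)) (v1 (snd p)) (w (fst p)) (w (fst p)) * K (fst p - snd p))"
proof (rule conv_bound(1)[where P="\<lambda>x. (F1 + F2) * \<bar>w x\<bar>" and R="\<lambda>x. F1 * \<bar>v x\<bar> + F2 * \<bar>v1 x\<bar>" and K="\<lambda>x. \<bar>K x\<bar>"])
  have [measurable]: "w \<in> borel_measurable borel" "v \<in> borel_measurable borel" "v1 \<in> borel_measurable borel" "K \<in> borel_measurable borel"
    using w v v1 K by auto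
  show "(\<lambda>p. entropy_flux F (v (snd p)) (v1 (snd p)) (w (fst p)) (w (fst p)) * K (fst p - snd p)) \<in> borel_measurable plane" by measurable
  show "\<bar>entropy_flux F (v (snd (x, y))) (v1 (snd (x, y))) (w (fst (x, y))) (w (fst (x, y))) * K (fst (x, y) - snd (x, y))\<bar>
     \<le> ((F1 + F2) * \<bar>w x\<bar> + (F1 * \<bar>v y\<bar> + F2 * \<bar>v1 y\<bar>)) * \<bar>K (x - y)\<bar>" for x y
  proof -
    have "\<bar>entropy_flux F (v y) (v1 y) (w x) (w x)\<bar> \<le> F1 * \<bar>v y - w x\<bar> + F2 * \<bar>v1 y - w x\<bar>" by (rule entropy_flux_bound)
    also have "\<dots> \<le> F1 * (\<bar>v y\<bar> + \<bar>w x\<bar>) + F2 * (\<bar>v1 y\<bar> + \<bar>w x\<bar>)"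
      using F1_pos F2_pos by (intro add_mono mult_left_mono) auto
    finally have "\<bar>entropy_flux F (v y) (v1 y) (w x) (w x)\<bar> * \<bar>K (x - y)\<bar>
        \<le> (F1 * (\<bar>v y\<bar> + \<bar>w x\<bar>) + F2 * (\<bar>v1 y\<bar> + \<bar>w x\<bar>)) * \<bar>K (x - y)\<bar>"
      by (rule mult_right_mono) simp
    then show ?thesis by (simp add: abs_mult algebra_simps)
  qed
qed (use w v v1 K in auto)

text \<open>The differential-difference inequality at a fixed time, with w the slice of the
  solution. The discrete entropy inequality with k = w(x) is integrated against \<omega>(x - y).
  Three consistency errors remain: the flux at the old instead of the new level (\<open>D\<close>),
  the numerical instead of the exact flux (\<open>B * d\<close>), and the averaged instead of the
  pointwise nonlocal term (\<open>2 * Cg * d\<close>).\<close>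

lemma spatial_step:
  fixes V V' gd \<rho> :: "int \<Rightarrow> real" and w v v' \<omega> \<omega>' :: "real \<Rightarrow> real"
  assumes lam: "0 < lam" "lam < 1" and m: "mollifier r \<omega> \<omega>'" and d: "0 < d" and h: "0 < h"
    and w: "L1_lipschitz M w"
    and v: "v = (\<lambda>y. V \<lfloor>y / d\<rfloor>)" and v': "v' = (\<lambda>y. V' \<lfloor>y / d\<rfloor>)"
    and vB: "L1_lipschitz B v" and v'B: "L1_lipschitz B v'"
    and D: "(LINT y|lborel. \<bar>v' y - v y\<bar>) \<le> D"
    and \<rho>: "integrable lborel (\<lambda>y. \<rho> \<lfloor>y / d\<rfloor>)" "(LINT y|lborel. \<bar>\<rho> \<lfloor>y / d\<rfloor>\<bar>) \<le> R"
    and gd: "integrable lborel (\<lambda>y. gd \<lfloor>y / d\<rfloor>)" "(LINT y|lborel. \<bar>gd \<lfloor>y / d\<rfloor>\<bar>) \<le> Cg"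
    and avg: "\<And>i. d * gd i = (LINT y:cell d i|lborel. frac_lap lam v' y)"
    and Cg: "(LINT y|lborel. \<bar>frac_lap lam v' y\<bar>) \<le> Cg"
    and entropy: "\<And>k i. \<bar>V' i - k\<bar> \<le> \<bar>V i - k\<bar>
        - h / d * (entropy_flux F (V i) (V (i + 1)) k k - entropy_flux F (V (i - 1)) (V i) k k)
        + h * (sgn (V' i - k) * gd i) + h * \<bar>\<rho> i\<bar>"
  shows "(LINT (x, y)|plane. q f (v' y) (w x) * \<omega>' (x - y))
      + (LINT (x, y)|plane. sgn (w x - v' y) * frac_lap lam w x * \<omega> (x - y))
      + ((LINT (x, y)|plane. \<bar>w x - v' y\<bar> * \<omega> (x - y))
         - (LINT (x, y)|plane. \<bar>w x - v y\<bar> * \<omega> (x - y))) / h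
    \<le> (L1norm \<omega>') * ((F1 + F2) * D + (F1 + 4 * F2) * B * d + 2 * Cg * d) + R"
proof -
  note mD = mollifierD[OF m] and wD = L1_lipschitzD[OF w] and vD = L1_lipschitzD[OF vB] and v'D = L1_lipschitzD[OF v'B]
  define \<Omega> where "\<Omega> = (L1norm \<omega>')"
  have \<Omega>0: "0 \<le> \<Omega>" by (simp add: \<Omega>_def)
  have \<omega>L: "L1_lipschitz \<Omega> \<omega>" unfolding \<Omega>_def by (rule C1_L1_lipschitz[OF mD(2,3,8,9)])
  have [measurable]: "w \<in> borel_measurable borel" "v \<in> borel_measurable borel" "v' \<in> borel_measurable borel"
    "\<omega> \<in> borel_measurable borel" "\<omega>' \<in> borel_measurable borel"
    using wD vD v'D mD by auto
  define v1 where "v1 y = v (y + d)" for y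
  have v1i: "integrable lborel v1" unfolding v1_def[abs_def] by (rule integrable_shift[OF vD(1)])
  have [measurable]: "v1 \<in> borel_measurable borel" using v1i by simp
  define Q1 where "Q1 p = entropy_flux F (v (snd p)) (v1 (snd p)) (w (fst p)) (w (fst p))" for p
  define Q0 where "Q0 p = q f (v (snd p)) (w (fst p))" for p
  have Q1m[measurable]: "Q1 \<in> borel_measurable plane" unfolding Q1_def[abs_def] by measurable
  have Q0m[measurable]: "Q0 \<in> borel_measurable plane" unfolding Q0_def[abs_def] by measurable
  define \<Delta> where "\<Delta> x = \<omega> (x - d) - \<omega> x" for x
  have \<Delta>i: "integrable lborel \<Delta>" unfolding \<Delta>_def[abs_def] using mD(8) integrable_shift_diff(1)[OF mD(8)] by auto
  have \<Delta>b: "(L1norm \<Delta>) \<le> \<Omega> * d"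
    using L1_lipschitz_shift_diff[OF \<omega>L, of d] d by (simp add: \<Delta>_def abs_minus_commute)
  define \<theta> where "\<theta> p = sgn (w (fst p) - v' (snd p))" for p
  have \<theta>m[measurable]: "\<theta> \<in> borel_measurable plane" unfolding \<theta>_def[abs_def] by measurable
  have \<theta>1: "\<bar>\<theta> p\<bar> \<le> 1" for p by (auto simp: \<theta>_def sgn_if)
  let ?I = "\<lambda>h. (LINT p|plane. h p)"
  let ?W = "\<lambda>p. \<omega> (fst p - snd p)"
  have iQ1: "integrable plane (\<lambda>p. Q1 p * ?W p)" "integrable plane (\<lambda>p. Q1 p * \<omega> (fst p - snd p - d))"
    using entropy_flux_pair_conv[OF wD(1) vD(1) v1i mD(8)] entropy_flux_pair_conv[OF wD(1) vD(1) v1i integrable_shift_diff(1)[OF mD(8), of d]]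
    by (auto simp: Q1_def)
  define Q1s where "Q1s p = Q1 (fst p, snd p - d)" for p
  \<comment> \<open>Summation by parts: a shift of y by one cell moves the flux difference onto the
    mollifier.\<close>
  have sh: "?I (\<lambda>p. Q1s p * ?W p) = ?I (\<lambda>p. Q1 p * \<omega> (fst p - snd p - d))"
    using integral_shift_pair[OF borel_measurable_integrable[OF iQ1(2)], of 0 "- d"]
    by (simp add: Q1s_def case_prod_beta')
  have iQ1s: "integrable plane (\<lambda>p. Q1s p * ?W p)"
    using entropy_flux_pair_conv[OF wD(1) integrable_shift_diff(1)[OF vD(1), of d] vD(1) mD(8)]
    by (simp add: Q1s_def Q1_def v1_def)
  have ia: "integrable plane (\<lambda>p. \<bar>w (fst p) - v (snd p)\<bar> * ?W p)"
    "integrable plane (\<lambda>p. \<bar>w (fst p) - v' (snd p)\<bar> * ?W p)"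
    using abs_pair_conv wD(1) vD(1) v'D(1) mD(5,8) by auto
  have igd: "integrable plane (\<lambda>p. \<theta> p * gd \<lfloor>snd p / d\<rfloor> * ?W p)"
    using conv_weighted_integrable[OF gd(1) mD(8) \<theta>m \<theta>1, of snd] by simp
  have i\<rho>: "integrable plane (\<lambda>p. \<bar>\<rho> \<lfloor>snd p / d\<rfloor>\<bar> * ?W p)"
    "?I (\<lambda>p. \<bar>\<rho> \<lfloor>snd p / d\<rfloor>\<bar> * ?W p) \<le> R"
    using conv_snd[OF integrable_abs[OF \<rho>(1)] mD(8)] \<rho>(2) mD(7) by (simp_all add: case_prod_beta')
  have "?I (\<lambda>p. \<bar>w (fst p) - v' (snd p)\<bar> * ?W p)
      \<le> ?I (\<lambda>p. \<bar>w (fst p) - v (snd p)\<bar> * ?W p - h / d * (Q1 p * ?W p - Q1s p * ?W p)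
          - h * (\<theta> p * gd \<lfloor>snd p / d\<rfloor> * ?W p) + h * (\<bar>\<rho> \<lfloor>snd p / d\<rfloor>\<bar> * ?W p))"
  proof (rule integral_mono)
    fix p :: "real \<times> real"
    define i where "i = \<lfloor>snd p / d\<rfloor>"
    define k where "k = w (fst p)"
    have "\<bar>w (fst p) - v' (snd p)\<bar> = \<bar>V' i - k\<bar>" by (simp add: v' i_def k_def)
    moreover have "\<bar>w (fst p) - v (snd p)\<bar> = \<bar>V i - k\<bar>" by (simp add: v i_def k_def)
    moreover have "Q1 p = entropy_flux F (V i) (V (i + 1)) k k"
      by (simp add: Q1_def v1_def v i_def k_def floor_shift_cell[OF d])
    moreover have "Q1s p = entropy_flux F (V (i - 1)) (V i) k k"
      by (simp add: Q1s_def Q1_def v1_def v i_def k_def floor_shift_cell[OF d])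
    moreover have "\<theta> p = - sgn (V' i - k)" by (simp add: \<theta>_def v' i_def k_def sgn_if)
    ultimately have "\<bar>w (fst p) - v' (snd p)\<bar> \<le> \<bar>w (fst p) - v (snd p)\<bar> - h / d * (Q1 p - Q1s p) - h * (\<theta> p * gd i) + h * \<bar>\<rho> i\<bar>"
      using entropy[of i k] by simp
    from mult_right_mono[OF this mD(5)[of "fst p - snd p"]]
    show "\<bar>w (fst p) - v' (snd p)\<bar> * ?W p \<le> \<bar>w (fst p) - v (snd p)\<bar> * ?W p - h / d * (Q1 p * ?W p - Q1s p * ?W p)
          - h * (\<theta> p * gd \<lfloor>snd p / d\<rfloor> * ?W p) + h * (\<bar>\<rho> \<lfloor>snd p / d\<rfloor>\<bar> * ?W p)"
      by (simp add: i_def algebra_simps)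
  qed (use ia iQ1 iQ1s igd i\<rho> in auto)
  also have "\<dots> = ?I (\<lambda>p. \<bar>w (fst p) - v (snd p)\<bar> * ?W p) - h / d * (?I (\<lambda>p. Q1 p * ?W p) - ?I (\<lambda>p. Q1s p * ?W p))
      - h * ?I (\<lambda>p. \<theta> p * gd \<lfloor>snd p / d\<rfloor> * ?W p) + h * ?I (\<lambda>p. \<bar>\<rho> \<lfloor>snd p / d\<rfloor>\<bar> * ?W p)"
    using ia iQ1 iQ1s igd i\<rho> by simp
  finally have step1: "?I (\<lambda>p. \<bar>w (fst p) - v' (snd p)\<bar> * ?W p) - ?I (\<lambda>p. \<bar>w (fst p) - v (snd p)\<bar> * ?W p)
     \<le> h * ((?I (\<lambda>p. Q1s p * ?W p) - ?I (\<lambda>p. Q1 p * ?W p)) / d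
         - ?I (\<lambda>p. \<theta> p * gd \<lfloor>snd p / d\<rfloor> * ?W p) + ?I (\<lambda>p. \<bar>\<rho> \<lfloor>snd p / d\<rfloor>\<bar> * ?W p))"
    using d by (simp add: field_simps)
  have "(?I (\<lambda>p. \<bar>w (fst p) - v' (snd p)\<bar> * ?W p) - ?I (\<lambda>p. \<bar>w (fst p) - v (snd p)\<bar> * ?W p)) / h
     \<le> (?I (\<lambda>p. Q1s p * ?W p) - ?I (\<lambda>p. Q1 p * ?W p)) / d
         - ?I (\<lambda>p. \<theta> p * gd \<lfloor>snd p / d\<rfloor> * ?W p) + R"
  proof -
    have "(?I (\<lambda>p. \<bar>w (fst p) - v' (snd p)\<bar> * ?W p) - ?I (\<lambda>p. \<bar>w (fst p) - v (snd p)\<bar> * ?W p)) / h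
       \<le> (?I (\<lambda>p. Q1s p * ?W p) - ?I (\<lambda>p. Q1 p * ?W p)) / d
         - ?I (\<lambda>p. \<theta> p * gd \<lfloor>snd p / d\<rfloor> * ?W p) + ?I (\<lambda>p. \<bar>\<rho> \<lfloor>snd p / d\<rfloor>\<bar> * ?W p)"
      using step1 h by (simp add: divide_le_eq mult.commute)
    then show ?thesis using i\<rho>(2) by linarith
  qed
  \<comment> \<open>Replacing the second argument of the numerical flux by the first costs 3 F2, and
    passing from the difference quotient to \<omega>' costs F1 + F2.\<close>
  moreover have "(?I (\<lambda>p. Q1s p * ?W p) - ?I (\<lambda>p. Q1 p * ?W p)) / d
      \<le> - ?I (\<lambda>p. Q0 p * \<omega>' (fst p - snd p)) + \<Omega> * ((F1 + 4 * F2) * B * d)"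
  proof -
    have iQ0: "integrable plane (\<lambda>p. Q0 p * \<Delta> (fst p - snd p))"
      using q_pair_conv(1)[OF wD(1) vD(1) \<Delta>i] by (simp add: Q0_def case_prod_beta')
    have eq: "?I (\<lambda>p. Q1s p * ?W p) - ?I (\<lambda>p. Q1 p * ?W p) = ?I (\<lambda>p. Q1 p * \<Delta> (fst p - snd p))"
      unfolding sh \<Delta>_def using iQ1 by (simp add: right_diff_distrib)
    have iQ\<Delta>: "integrable plane (\<lambda>p. Q1 p * \<Delta> (fst p - snd p))"
      using entropy_flux_pair_conv[OF wD(1) vD(1) v1i \<Delta>i] by (simp add: Q1_def)
    have "\<bar>?I (\<lambda>p. (Q1 p - Q0 p) * \<Delta> (fst p - snd p))\<bar>
        \<le> ((LINT x::real|lborel. 0) + (LINT y|lborel. 3 * F2 * \<bar>v (y + d) - v y\<bar>)) * (L1norm \<Delta>)"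
    proof (rule conv_bound(2))
      show "(\<lambda>p. (Q1 p - Q0 p) * \<Delta> (fst p - snd p)) \<in> borel_measurable plane"
        using borel_measurable_integrable[OF \<Delta>i] by measurable
      show "\<bar>(Q1 (x, y) - Q0 (x, y)) * \<Delta> (fst (x, y) - snd (x, y))\<bar> \<le> (0 + 3 * F2 * \<bar>v (y + d) - v y\<bar>) * \<bar>\<Delta> (x - y)\<bar>" for x y
        using entropy_flux_lip2[of "v y" "v (y + d)" "w x"]
        by (simp add: Q1_def Q0_def v1_def entropy_flux_diag abs_mult mult_right_mono)
    qed (use vD(1) integrable_shift[OF vD(1), of d] \<Delta>i in auto)
    also have "\<dots> \<le> (3 * F2 * (B * d)) * (\<Omega> * d)"
      using vD(3)[of d] d F2_pos vD(5) \<Delta>b \<Omega>0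
      by (intro mult_mono) (auto simp: mult_left_mono intro!: mult_nonneg_nonneg)
    finally have e1: "?I (\<lambda>p. Q1 p * \<Delta> (fst p - snd p)) \<le> ?I (\<lambda>p. Q0 p * \<Delta> (fst p - snd p)) + (3 * F2 * (B * d)) * (\<Omega> * d)"
      using iQ0 iQ\<Delta> by (simp add: left_diff_distrib)
    have "\<bar>?I (\<lambda>p. Q0 p * \<Delta> (fst p - snd p)) + d * ?I (\<lambda>p. Q0 p * \<omega>' (fst p - snd p))\<bar> \<le> (F1 + F2) * (B * d) * \<Omega> * d"
      using flux_difference_quotient[OF mD(2,3,8,9) wD(1) vB, of d] d
      by (simp add: Q0_def \<Delta>_def \<Omega>_def case_prod_beta')
    then have "?I (\<lambda>p. Q1 p * \<Delta> (fst p - snd p)) \<le> d * (- ?I (\<lambda>p. Q0 p * \<omega>' (fst p - snd p)) + \<Omega> * ((F1 + 4 * F2) * B * d))"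
      using e1 by (simp add: algebra_simps)
    then show ?thesis unfolding eq using d by (simp add: divide_le_eq mult.commute)
  qed
  \<comment> \<open>The scheme evaluates its flux at \<open>v\<close>, the claim at
    \<open>v'\<close>.\<close>
  moreover have "?I (\<lambda>p. q f (v' (snd p)) (w (fst p)) * \<omega>' (fst p - snd p)) - ?I (\<lambda>p. Q0 p * \<omega>' (fst p - snd p)) \<le> \<Omega> * ((F1 + F2) * D)"
  proof -
    have "?I (\<lambda>p. q f (v' (snd p)) (w (fst p)) * \<omega>' (fst p - snd p)) - ?I (\<lambda>p. Q0 p * \<omega>' (fst p - snd p)) \<le> (F1 + F2) * (LINT y|lborel. \<bar>v' y - v y\<bar>) * \<Omega>"
      using q_pair_diff[OF wD(1) v'D(1) vD(1) mD(9)] by (simp add: Q0_def \<Omega>_def case_prod_beta')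
    also have "\<dots> \<le> (F1 + F2) * D * \<Omega>"
      using D F1_pos F2_pos \<Omega>0 by (intro mult_right_mono mult_left_mono) auto
    finally show ?thesis by (simp add: mult_ac)
  qed
  \<comment> \<open>Dissipativity exchanges the term of w for that of v'; what is left is the error
    of cell averaging.\<close>
  moreover have "?I (\<lambda>p. \<theta> p * frac_lap lam w (fst p) * ?W p) - ?I (\<lambda>p. \<theta> p * gd \<lfloor>snd p / d\<rfloor> * ?W p) \<le> \<Omega> * (2 * Cg * d)"
  proof -
    note fw = integrable_frac_lap[OF lam w] and fv = integrable_frac_lap[OF lam v'B]
    have ifw: "integrable plane (\<lambda>p. \<theta> p * frac_lap lam w (fst p) * ?W p)"
      using conv_weighted_integrable[OF fw mD(8) \<theta>m \<theta>1, of fst] by simp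
    have ifv: "integrable plane (\<lambda>p. \<theta> p * frac_lap lam v' (snd p) * ?W p)"
      using conv_weighted_integrable[OF fv mD(8) \<theta>m \<theta>1, of snd] by simp
    have "?I (\<lambda>p. \<theta> p * (frac_lap lam w (fst p) - frac_lap lam v' (snd p)) * ?W p) \<le> 0"
      using frac_lap_dissipative[OF lam w v'B mD(8,5)] by (simp add: \<theta>_def case_prod_beta')
    then have 1: "?I (\<lambda>p. \<theta> p * frac_lap lam w (fst p) * ?W p) \<le> ?I (\<lambda>p. \<theta> p * frac_lap lam v' (snd p) * ?W p)"
      using ifw ifv by (simp add: algebra_simps)
    have "\<bar>LINT (x, y)|plane. sgn (w x - V' \<lfloor>y / d\<rfloor>) * (frac_lap lam v' y - gd \<lfloor>y / d\<rfloor>) * \<omega> (x - y)\<bar>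
        \<le> (LINT y|lborel. \<bar>frac_lap lam v' y - gd \<lfloor>y / d\<rfloor>\<bar>) * (d * \<Omega>)"
    proof (rule cell_average_error[where \<theta>="\<lambda>x i. sgn (w x - V' i)", OF d fv gd(1) avg _ _ \<omega>L])
      show "(\<lambda>(x, y). sgn (w x - V' \<lfloor>y / d\<rfloor>)) \<in> borel_measurable plane" by measurable
    qed (auto simp: sgn_if)
    also have "(LINT y|lborel. \<bar>frac_lap lam v' y - gd \<lfloor>y / d\<rfloor>\<bar>) \<le> (LINT y|lborel. \<bar>frac_lap lam v' y\<bar> + \<bar>gd \<lfloor>y / d\<rfloor>\<bar>)"
      by (rule integral_mono) (use fv gd in auto)
    also have "\<dots> \<le> 2 * Cg" using fv gd Cg by simp
    finally have "?I (\<lambda>p. \<theta> p * (frac_lap lam v' (snd p) - gd \<lfloor>snd p / d\<rfloor>) * ?W p) \<le> 2 * Cg * (d * \<Omega>)"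
      using d \<Omega>0 by (simp add: \<theta>_def v' case_prod_beta' mult_right_mono)
    then have "?I (\<lambda>p. \<theta> p * frac_lap lam v' (snd p) * ?W p) - ?I (\<lambda>p. \<theta> p * gd \<lfloor>snd p / d\<rfloor> * ?W p) \<le> 2 * Cg * (d * \<Omega>)"
      using ifv igd by (simp add: algebra_simps)
    with 1 show ?thesis by (simp add: mult_ac)
  qed
  ultimately show ?thesis
    unfolding \<Omega>_def[symmetric] case_prod_beta' \<theta>_def by (simp add: distrib_left)
qed

end

section \<open>Step functions and the discrete fractional Laplacian\<close>

abbreviation abs_summable :: "(int \<Rightarrow> real) \<Rightarrow> bool" where
  "abs_summable U \<equiv> (\<lambda>i. \<bar>U i\<bar>) summable_on UNIV"

abbreviation l1norm :: "(int \<Rightarrow> real) \<Rightarrow> real" where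
  "l1norm U \<equiv> \<Sum>\<^sub>\<infinity>i. \<bar>U i\<bar>"

abbreviation jump_sum :: "(int \<Rightarrow> real) \<Rightarrow> real" where
  "jump_sum U \<equiv> \<Sum>\<^sub>\<infinity>i. \<bar>U (i + 1) - U i\<bar>"

definition step_fun :: "real \<Rightarrow> (int \<Rightarrow> real) \<Rightarrow> real \<Rightarrow> real" where
  "step_fun d U y = U \<lfloor>y / d\<rfloor>"

lemma step_fun_measurable [measurable]: "step_fun d U \<in> borel_measurable borel"
  unfolding step_fun_def[abs_def] by measurable

lemma step_fun_cell: "0 < d \<Longrightarrow> y \<in> cell d i \<Longrightarrow> step_fun d U y = U i"
  by (simp add: step_fun_def floor_in_cell)

lemma cell_set_integral_const:
  assumes d: "0 < d" and g: "\<And>y. y \<in> cell d i \<Longrightarrow> g y = c"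
  shows "(LINT y:cell d i|lborel. g y) = d * (c::real)"
proof -
  have "(LINT y:cell d i|lborel. g y) = (LINT y:cell d i|lborel. c)"
    by (rule set_lebesgue_integral_cong) (auto simp: g)
  also have "\<dots> = d * c" using d by (simp add: cell_def set_lebesgue_integral_def algebra_simps)
  finally show ?thesis .
qed

lemma
  assumes d: "0 < d" and U: "abs_summable U"
  shows integrable_step_fun: "integrable lborel (step_fun d U)"
    and step_fun_L1_norm: "(LINT y|lborel. \<bar>step_fun d U y\<bar>) = d * (l1norm U)"
proof -
  have sm: "(\<lambda>n. \<bar>U (int_decode n)\<bar>) summable_on UNIV"
    using U summable_on_reindex_bij_betw[OF bij_int_decode, of "\<lambda>i. \<bar>U i\<bar>"] by simp
  then have "summable (\<lambda>n. \<bar>U (int_decode n)\<bar>)" by (rule summable_on_imp_summable)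
  then have s2: "summable (\<lambda>n. \<bar>U (int_decode n)\<bar> * d)" by (rule summable_mult2)
  have ae: "AE y in lborel. y \<in> (\<Union>n. cell d (int_decode n))"
    using AE_in_cell[OF d] by eventually_elim (metis UN_iff UNIV_I int_encode_inverse)
  show i: "integrable lborel (step_fun d U)"
  proof (rule integrableI_bounded)
    have "(\<integral>\<^sup>+y. ennreal (norm (step_fun d U y)) \<partial>lborel) = (\<integral>\<^sup>+y\<in>(\<Union>n. cell d (int_decode n)). ennreal (norm (step_fun d U y)) \<partial>lborel)"
      by (rule nn_integral_cong_AE) (use ae in eventually_elim, simp)
    also have "\<dots> = (\<Sum>n. \<integral>\<^sup>+y\<in>cell d (int_decode n). ennreal (norm (step_fun d U y)) \<partial>lborel)"
    proof (rule nn_integral_disjoint_family)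
      show "disjoint_family (\<lambda>n. cell d (int_decode n))"
        unfolding disjoint_family_on_def using cell_disjoint[OF d] by (metis inj_int_decode inj_eq)
    qed auto
    also have "\<dots> = (\<Sum>n. ennreal (\<bar>U (int_decode n)\<bar> * d))"
    proof (rule suminf_cong)
      fix n
      have "(\<integral>\<^sup>+y\<in>cell d (int_decode n). ennreal (norm (step_fun d U y)) \<partial>lborel) = (\<integral>\<^sup>+y. ennreal \<bar>U (int_decode n)\<bar> * indicator (cell d (int_decode n)) y \<partial>lborel)"
        by (rule nn_integral_cong) (auto simp: step_fun_cell[OF d] indicator_def)
      also have "\<dots> = ennreal \<bar>U (int_decode n)\<bar> * ennreal d"
        using d by (subst nn_integral_cmult_indicator) (auto simp: cell_def algebra_simps)
      finally show "(\<integral>\<^sup>+y\<in>cell d (int_decode n). ennreal (norm (step_fun d U y)) \<partial>lborel) = ennreal (\<bar>U (int_decode n)\<bar> * d)"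
        using d by (simp add: ennreal_mult)
    qed
    also have "\<dots> < \<infinity>"
      using s2 d by (subst suminf_ennreal2) auto
    finally show "(\<integral>\<^sup>+y. ennreal (norm (step_fun d U y)) \<partial>lborel) < \<infinity>" .
  qed simp
  have "(LINT y:cell d j|lborel. \<bar>step_fun d U y\<bar>) = d * \<bar>U j\<bar>" for j
    by (rule cell_set_integral_const[OF d]) (simp add: step_fun_cell[OF d])
  then have "((\<lambda>j. d * \<bar>U j\<bar>) has_sum (LINT y|lborel. \<bar>step_fun d U y\<bar>)) UNIV"
    using cell_has_sum[OF d integrable_abs[OF i]] by simp
  moreover have "((\<lambda>j. d * \<bar>U j\<bar>) has_sum d * (l1norm U)) UNIV"
    by (intro has_sum_cmult_right has_sum_infsum U)
  ultimately show "(LINT y|lborel. \<bar>step_fun d U y\<bar>) = d * (l1norm U)"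
    by (rule has_sum_unique)
qed

text \<open>A translation by z is a chain of n translations by z/n \<le> d, each with the same
  bound.\<close>

lemma L1_lipschitzI_local:
  assumes w: "integrable lborel w" and d: "0 < d"
    and b: "\<And>z. 0 \<le> z \<Longrightarrow> z \<le> d \<Longrightarrow> (LINT x|lborel. \<bar>w (x + z) - w x\<bar>) \<le> M * z"
  shows "L1_lipschitz M w"
proof (rule L1_lipschitzI_nonneg[OF w])
  fix z :: real assume z: "0 \<le> z"
  have mult: "(LINT x|lborel. \<bar>w (x + real n * s) - w x\<bar>) \<le> M * (real n * s)" if s: "0 \<le> s" "s \<le> d" for n s
  proof (induction n)
    case (Suc n)
    have i: "integrable lborel (\<lambda>x. w (x + a))" for a by (rule integrable_shift[OF w])
    have "(LINT x|lborel. \<bar>w (x + real (Suc n) * s) - w x\<bar>)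
        \<le> (LINT x|lborel. \<bar>w ((x + real n * s) + s) - w (x + real n * s)\<bar> + \<bar>w (x + real n * s) - w x\<bar>)"
    proof (rule integral_mono)
      fix x
      have e: "x + real (Suc n) * s = (x + real n * s) + s" by (simp add: algebra_simps)
      show "\<bar>w (x + real (Suc n) * s) - w x\<bar> \<le> \<bar>w ((x + real n * s) + s) - w (x + real n * s)\<bar> + \<bar>w (x + real n * s) - w x\<bar>"
        unfolding e by linarith
    qed (use w i[of "real (Suc n) * s"] i[of "real n * s"] i[of "real n * s + s"] in \<open>auto simp: add.assoc\<close>)
    also have "\<dots> = (LINT x|lborel. \<bar>w ((x + real n * s) + s) - w (x + real n * s)\<bar>) + (LINT x|lborel. \<bar>w (x + real n * s) - w x\<bar>)"
      by (rule Bochner_Integration.integral_add) (use w i[of "real n * s"] i[of "real n * s + s"] in \<open>auto simp: add.assoc\<close>)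
    also have "(LINT x|lborel. \<bar>w ((x + real n * s) + s) - w (x + real n * s)\<bar>) = (LINT x|lborel. \<bar>w (x + s) - w x\<bar>)"
      by (rule integral_shift[of "\<lambda>x. \<bar>w (x + s) - w x\<bar>" "real n * s"])
    also have "\<dots> + (LINT x|lborel. \<bar>w (x + real n * s) - w x\<bar>) \<le> M * s + M * (real n * s)"
      by (intro add_mono b s Suc.IH)
    finally show ?case by (simp add: algebra_simps)
  qed simp
  obtain n :: nat where n: "z / d < real n" using reals_Archimedean2 by blast
  have n0: "0 < real n" using n z d by (smt (verit) divide_nonneg_pos)
  have "0 \<le> z / real n" "z / real n \<le> d" using z n n0 d by (auto simp: field_simps)
  from mult[OF this, of n] show "(LINT x|lborel. \<bar>w (x + z) - w x\<bar>) \<le> M * z" using n0 by simp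
qed

lemma summable_on_shift_int:
  fixes f :: "int \<Rightarrow> real"
  shows "(\<lambda>i. f (i + k)) summable_on UNIV \<longleftrightarrow> f summable_on UNIV" "(\<Sum>\<^sub>\<infinity>i. f (i + k)) = (\<Sum>\<^sub>\<infinity>i. f i)"
proof -
  have "bij_betw (\<lambda>i::int. i + k) UNIV UNIV"
    by (rule bij_betwI[where g="\<lambda>i. i - k"]) auto
  then show "(\<lambda>i. f (i + k)) summable_on UNIV \<longleftrightarrow> f summable_on UNIV" "(\<Sum>\<^sub>\<infinity>i. f (i + k)) = (\<Sum>\<^sub>\<infinity>i. f i)"
    using summable_on_reindex_bij_betw infsum_reindex_bij_betw by blast+
qed

lemma abs_summable_diff:
  fixes f g :: "'a \<Rightarrow> real"
  assumes "(\<lambda>i. \<bar>f i\<bar>) summable_on A" "(\<lambda>i. \<bar>g i\<bar>) summable_on A"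
  shows "(\<lambda>i. \<bar>f i - g i\<bar>) summable_on A"
  by (rule summable_on_comparison_test[OF summable_on_add[OF assms]]) auto

lemma abs_summable_shift_diff:
  assumes "(\<lambda>i. \<bar>U i\<bar>) summable_on (UNIV :: int set)"
  shows "(\<lambda>i. \<bar>U (i + 1) - U i :: real\<bar>) summable_on UNIV"
  using abs_summable_diff[of "\<lambda>i. U (i + 1)" UNIV U] assms summable_on_shift_int(1)[of "\<lambda>i. \<bar>U i\<bar>" 1] by simp

text \<open>For 0 \<le> z \<le> d only the last stretch of length z of a cell is carried across its
  right end, where it sees one jump.\<close>

lemma step_fun_L1_lipschitz:
  assumes d: "0 < d" and U: "abs_summable U"
  shows "L1_lipschitz (jump_sum U) (step_fun d U)"
proof (rule L1_lipschitzI_local[OF integrable_step_fun[OF d U] d])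
  fix z assume z: "0 \<le> z" "z \<le> d"
  let ?h = "\<lambda>y. \<bar>step_fun d U (y + z) - step_fun d U y\<bar>"
  have i: "integrable lborel ?h"
    using integrable_step_fun[OF d U] integrable_shift[OF integrable_step_fun[OF d U], of z] by auto
  have s: "((\<lambda>j. z * \<bar>U (j + 1) - U j\<bar>) has_sum z * (jump_sum U)) UNIV"
    by (intro has_sum_cmult_right has_sum_infsum abs_summable_shift_diff U)
  have "(LINT y|lborel. ?h y) \<le> z * (jump_sum U)"
  proof (rule has_sum_mono[OF cell_has_sum[OF d i] s])
    fix j
    let ?J = "{of_int (j + 1) * d - z .. of_int (j + 1) * d}"
    have "(LINT y:cell d j|lborel. ?h y) \<le> (LINT y|lborel. \<bar>U (j + 1) - U j\<bar> * indicator ?J y)"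
      unfolding set_lebesgue_integral_def
    proof (rule integral_mono)
      show "integrable lborel (\<lambda>y. indicat_real (cell d j) y *\<^sub>R ?h y)"
        using i by (intro integrable_mult_indicator) auto
      show "integrable lborel (\<lambda>y. \<bar>U (j + 1) - U j\<bar> * indicator ?J y)"
        by (intro integrable_mult_right integrable_real_indicator) (auto simp: emeasure_lborel_Icc_eq)
      fix y
      show "indicat_real (cell d j) y *\<^sub>R ?h y \<le> \<bar>U (j + 1) - U j\<bar> * indicator ?J y"
      proof (cases "y \<in> cell d j")
        case True
        then have y: "of_int j * d < y" "y < of_int (j + 1) * d" by (auto simp: cell_def)
        show ?thesis
        proof (cases "y + z < of_int (j + 1) * d")
          case lt: True
          then have "y + z \<in> cell d j" using y z by (auto simp: cell_def)
          then show ?thesis using True by (simp add: step_fun_cell[OF d])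
        next
          case False
          then have "real_of_int (j + 1) \<le> (y + z) / d" "(y + z) / d < real_of_int (j + 1) + 1"
            using y z d by (auto simp: field_simps)
          then have "\<lfloor>(y + z) / d\<rfloor> = j + 1" by (simp add: floor_eq_iff)
          then have "step_fun d U (y + z) = U (j + 1)" by (simp add: step_fun_def)
          moreover have "y \<in> ?J" using False y by auto
          ultimately show ?thesis using True by (simp add: step_fun_cell[OF d])
        qed
      qed auto
    qed
    also have "\<dots> = z * \<bar>U (j + 1) - U j\<bar>" using z by (simp add: mult.commute)
    finally show "(LINT y:cell d j|lborel. ?h y) \<le> z * \<bar>U (j + 1) - U j\<bar>" .
  qed
  then show "(LINT y|lborel. ?h y) \<le> (jump_sum U) * z" by (simp add: mult.commute)
qed

lemma indicator_cell_L1_lipschitz: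
  assumes d: "0 < d"
  shows "L1_lipschitz 2 (indicator (cell d j) :: real \<Rightarrow> real)"
proof (rule L1_lipschitzI_nonneg)
  show ii: "integrable lborel (indicator (cell d j) :: real \<Rightarrow> real)" using d by (simp add: cell_def)
  fix z :: real assume z: "0 \<le> z"
  define a where "a = of_int j * d"
  define b where "b = of_int (j + 1) * d"
  have "(LINT x|lborel. \<bar>indicat_real (cell d j) (x + z) - indicat_real (cell d j) x\<bar>)
      \<le> (LINT x|lborel. indicator {a - z..a} x + indicator {b - z..b} x)"
  proof (rule integral_mono)
    show "integrable lborel (\<lambda>x. \<bar>indicat_real (cell d j) (x + z) - indicat_real (cell d j) x\<bar>)"
      using ii integrable_shift[OF ii, of z] by auto
    show "integrable lborel (\<lambda>x. indicat_real {a - z..a} x + indicat_real {b - z..b} x)"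
      by (intro Bochner_Integration.integrable_add integrable_real_indicator emeasure_bounded_finite) auto
    show "\<bar>indicat_real (cell d j) (x + z) - indicat_real (cell d j) x\<bar> \<le> indicator {a - z..a} x + indicator {b - z..b} x" for x
    proof -
      have "cell d j = {a<..<b}" by (simp add: cell_def a_def b_def)
      then show ?thesis using z by (auto simp: indicator_def)
    qed
  qed
  also have "\<dots> = 2 * z" using z
    by (subst Bochner_Integration.integral_add) (auto intro!: integrable_real_indicator emeasure_bounded_finite)
  finally show "(LINT x|lborel. \<bar>indicat_real (cell d j) (x + z) - indicat_real (cell d j) x\<bar>) \<le> 2 * z" .
qed

section \<open>The matrix of the discrete operator\<close>

lemma set_integral_frac_lap:
  assumes lam: "0 < lam" "lam < 1" and w: "L1_lipschitz M w" and A[measurable]: "A \<in> sets borel"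
  shows "integrable lborel (\<lambda>z. (LINT x:A|lborel. w (x + z) - w x) / \<bar>z\<bar> powr (1 + lam))"
    and "(LINT x:A|lborel. frac_lap lam w x)
      = frac_const lam * (LINT z|lborel. (LINT x:A|lborel. w (x + z) - w x) / \<bar>z\<bar> powr (1 + lam))"
proof -
  note i = frac_increment_integrable[OF lam w]
  have [measurable]: "w \<in> borel_measurable borel" using L1_lipschitzD[OF w] by auto
  have iA: "integrable plane (\<lambda>(z, x). indicator A x * ((w (x + z) - w x) / \<bar>z\<bar> powr (1 + lam)))"
    by (rule Bochner_Integration.integrable_bound[OF i]) (auto simp: indicator_def)
  have eq: "(LINT x|lborel. indicator A x * ((w (x + z) - w x) / \<bar>z\<bar> powr (1 + lam)))
      = (LINT x:A|lborel. w (x + z) - w x) / \<bar>z\<bar> powr (1 + lam)" for z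
  proof -
    have "(LINT x|lborel. indicator A x * ((w (x + z) - w x) / \<bar>z\<bar> powr (1 + lam)))
      = (LINT x|lborel. (indicator A x * (w (x + z) - w x)) / \<bar>z\<bar> powr (1 + lam))"
      by (simp only: times_divide_eq_right)
    then show ?thesis unfolding integral_divide_zero set_lebesgue_integral_def by simp
  qed
  show "integrable lborel (\<lambda>z. (LINT x:A|lborel. w (x + z) - w x) / \<bar>z\<bar> powr (1 + lam))"
    unfolding eq[symmetric] using lborel_pair.integrable_fst'[OF iA] by simp
  have "(LINT x:A|lborel. frac_lap lam w x)
     = (LINT x|lborel. frac_const lam * (LINT z|lborel. indicator A x * ((w (x + z) - w x) / \<bar>z\<bar> powr (1 + lam))))"
    unfolding set_lebesgue_integral_def
    by (intro Bochner_Integration.integral_cong) (auto simp: indicator_def frac_lap_eq)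
  also have "\<dots> = frac_const lam * (LINT x|lborel. LINT z|lborel. indicator A x * ((w (x + z) - w x) / \<bar>z\<bar> powr (1 + lam)))"
    by (rule integral_mult_right_zero)
  also have "(LINT x|lborel. LINT z|lborel. indicator A x * ((w (x + z) - w x) / \<bar>z\<bar> powr (1 + lam)))
     = (LINT z|lborel. LINT x|lborel. indicator A x * ((w (x + z) - w x) / \<bar>z\<bar> powr (1 + lam)))"
    by (rule lborel_pair.Fubini_integral) (use iA in simp)
  finally show "(LINT x:A|lborel. frac_lap lam w x)
      = frac_const lam * (LINT z|lborel. (LINT x:A|lborel. w (x + z) - w x) / \<bar>z\<bar> powr (1 + lam))"
    by (simp only: eq)
qed

text \<open>An exceptional point is allowed because a step function includes the left end of a cell
  and the indicator of the open cell does not.\<close>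

lemma set_integral_frac_lap_combine:
  assumes lam: "0 < lam" "lam < 1" and w: "L1_lipschitz M w" and w1: "L1_lipschitz M1 w1" and w2: "L1_lipschitz M2 w2"
    and A[measurable]: "A \<in> sets borel" and eq: "\<And>x. x \<noteq> a \<Longrightarrow> w x = w1 x + c * w2 x"
  shows "(LINT x:A|lborel. frac_lap lam w x) = (LINT x:A|lborel. frac_lap lam w1 x) + c * (LINT x:A|lborel. frac_lap lam w2 x)"
proof -
  note i1 = L1_lipschitzD(1)[OF w1] and i2 = L1_lipschitzD(1)[OF w2] and i = L1_lipschitzD(1)[OF w]
  have [measurable]: "w \<in> borel_measurable borel" "w1 \<in> borel_measurable borel" "w2 \<in> borel_measurable borel"
    using i i1 i2 by auto
  have inner: "(LINT x:A|lborel. w (x + z) - w x) = (LINT x:A|lborel. w1 (x + z) - w1 x) + c * (LINT x:A|lborel. w2 (x + z) - w2 x)" for z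
  proof -
    have s1: "set_integrable lborel A (\<lambda>x. w1 (x + z) - w1 x)" "set_integrable lborel A (\<lambda>x. w2 (x + z) - w2 x)"
      unfolding set_integrable_def using i1 i2 integrable_shift[OF i1, of z] integrable_shift[OF i2, of z]
      by (intro integrable_mult_indicator; auto)+
    have "(LINT x:A|lborel. w (x + z) - w x) = (LINT x:A|lborel. (w1 (x + z) - w1 x) + c * (w2 (x + z) - w2 x))"
      unfolding set_lebesgue_integral_def
    proof (rule integral_cong_AE)
      have "AE x in lborel. x \<noteq> a" "AE x in lborel. x \<noteq> a - z" by (rule AE_lborel_singleton)+
      then show "AE x in lborel. indicat_real A x *\<^sub>R (w (x + z) - w x) = indicat_real A x *\<^sub>R ((w1 (x + z) - w1 x) + c * (w2 (x + z) - w2 x))"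
      proof eventually_elim
        case (elim x)
        then have "x + z \<noteq> a" by auto
        then show ?case using elim eq[of x] eq[of "x + z"] by (simp add: algebra_simps)
      qed
    qed auto
    also have "\<dots> = (LINT x:A|lborel. w1 (x + z) - w1 x) + (LINT x:A|lborel. c * (w2 (x + z) - w2 x))"
      using s1 by (intro set_integral_add) auto
    finally show ?thesis by simp
  qed
  define X where "X z = (LINT x:A|lborel. w1 (x + z) - w1 x) / \<bar>z\<bar> powr (1 + lam)" for z
  define Y where "Y z = (LINT x:A|lborel. w2 (x + z) - w2 x) / \<bar>z\<bar> powr (1 + lam)" for z
  have "(LINT x:A|lborel. w (x + z) - w x) / \<bar>z\<bar> powr (1 + lam) = X z + c * Y z" for z
    unfolding inner X_def Y_def by (simp add: add_divide_distrib)
  then have "(LINT x:A|lborel. frac_lap lam w x) = frac_const lam * (LINT z|lborel. X z + c * Y z)"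
    unfolding set_integral_frac_lap(2)[OF lam w A] by (simp only:)
  moreover have "integrable lborel X" "integrable lborel Y"
    "(LINT x:A|lborel. frac_lap lam w1 x) = frac_const lam * (LINT z|lborel. X z)"
    "(LINT x:A|lborel. frac_lap lam w2 x) = frac_const lam * (LINT z|lborel. Y z)"
    unfolding X_def[abs_def] Y_def[abs_def]
    using set_integral_frac_lap[OF lam w1 A] set_integral_frac_lap[OF lam w2 A] by blast+
  ultimately show ?thesis by (simp add: distrib_left)
qed

text \<open>Outside cell j the indicator is 0, so that all its increments are nonnegative.\<close>

lemma G_nonneg:
  assumes "0 < d" "i \<noteq> j"
  shows "0 \<le> G lam d i j"
  unfolding G_def set_lebesgue_integral_def
proof (rule integral_nonneg_AE, rule AE_I2)
  fix x
  show "0 \<le> indicat_real (cell d i) x *\<^sub>R frac_lap lam (indicat_real (cell d j)) x"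
  proof (cases "x \<in> cell d i")
    case True
    then have "x \<notin> cell d j" using cell_disjoint[OF assms] by auto
    then show ?thesis
      unfolding frac_lap_eq using frac_const_nonneg[of lam] by (auto intro!: mult_nonneg_nonneg integral_nonneg_AE)
  qed auto
qed

lemma G_translate: "G lam d i j = G lam d (i - j) 0"
proof -
  have ind: "indicat_real (cell d j) x = indicator (cell d 0) (x - of_int j * d)"
    "indicat_real (cell d i) (x + of_int j * d) = indicator (cell d (i - j)) x" for x
    by (auto simp: indicator_def cell_def algebra_simps)
  have fl: "frac_lap lam (indicat_real (cell d j)) x = frac_lap lam (indicat_real (cell d 0)) (x - of_int j * d)" for x
    unfolding frac_lap_eq ind(1) by (simp add: algebra_simps)
  have "G lam d i j = (LINT x|lborel. indicat_real (cell d i) x *\<^sub>R frac_lap lam (indicat_real (cell d 0)) (x - of_int j * d))"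
    by (simp add: G_def set_lebesgue_integral_def fl)
  also have "\<dots> = (LINT x|lborel. indicat_real (cell d i) (x + of_int j * d) *\<^sub>R frac_lap lam (indicat_real (cell d 0)) (x + of_int j * d - of_int j * d))"
    by (rule integral_shift[symmetric])
  also have "\<dots> = G lam d (i - j) 0" by (simp add: G_def set_lebesgue_integral_def ind(2))
  finally show ?thesis .
qed

text \<open>A cell overlaps its translate by z in length max(0, d - |z|), so the increment
  integrates to -min(|z|, d), and scaling does the rest. This is how \<open>d_const\<close> enters
  the CFL condition.\<close>

lemma G_diagonal:
  assumes lam: "0 < lam" "lam < 1" and d: "0 < d"
  shows "G lam d 0 0 = - (d_const lam * d powr (1 - lam))"
proof -
  have inner: "(LINT x:cell d 0|lborel. indicat_real (cell d 0) (x + z) - indicat_real (cell d 0) x) = - min \<bar>z\<bar> d" for z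
  proof -
    have e: "indicat_real (cell d 0) x *\<^sub>R (indicat_real (cell d 0) (x + z) - indicat_real (cell d 0) x)
        = indicator {max 0 (- z)<..<min d (d - z)} x - indicator {0<..<d} x" for x
      by (auto simp: cell_def indicator_def)
    have fin: "integrable lborel (indicat_real {a<..<b})" for a b :: real
      by (intro integrable_real_indicator emeasure_bounded_finite) auto
    have "(LINT x:cell d 0|lborel. indicat_real (cell d 0) (x + z) - indicat_real (cell d 0) x)
       = (LINT x|lborel. indicator {max 0 (- z)<..<min d (d - z)} x) - (LINT x|lborel. indicator {0<..<d} x :: real)"
      unfolding set_lebesgue_integral_def e by (rule Bochner_Integration.integral_diff[OF fin fin])
    also have "(LINT x|lborel. indicator {0<..<d} x :: real) = d" using d by simp
    also have "(LINT x|lborel. indicator {max 0 (- z)<..<min d (d - z)} x :: real) = max 0 (d - \<bar>z\<bar>)"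
    proof (cases "\<bar>z\<bar> \<le> d")
      case True
      have "max 0 (- z) \<le> min d (d - z)" using True by auto
      then have "measure lborel {max 0 (- z)<..<min d (d - z)} = min d (d - z) - max 0 (- z)"
        by (rule measure_lborel_Ioo)
      also have "\<dots> = max 0 (d - \<bar>z\<bar>)" using True by auto
      finally show ?thesis by simp
    next
      case False
      then have "{max 0 (- z)<..<min d (d - z)} = {}" by auto
      then show ?thesis using False by simp
    qed
    also have "max 0 (d - \<bar>z\<bar>) - d = - min \<bar>z\<bar> d" by auto
    finally show ?thesis .
  qed
  show ?thesis
    unfolding G_def set_integral_frac_lap(2)[OF lam indicator_cell_L1_lipschitz[OF d] cell_sets] inner
    by (simp add: min_kernel_scaling[OF d] d_const_eq[OF lam])
qed

lemma has_sum_diff_real: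
  fixes f g :: "'a \<Rightarrow> real"
  assumes "(f has_sum a) A" "(g has_sum b) A"
  shows "((\<lambda>x. f x - g x) has_sum a - b) A"
  using has_sum_add[OF assms(1) has_sum_cmult_right[OF assms(2), of "-1"]] by simp

lemma shift_diff_sum_le:
  assumes U: "(\<lambda>i. \<bar>U i\<bar>) summable_on (UNIV :: int set)"
  shows "(\<Sum>\<^sub>\<infinity>i. \<bar>U (i + 1) - U i :: real\<bar>) \<le> 2 * (l1norm U)"
proof -
  have U1: "(\<lambda>i. \<bar>U (i + 1)\<bar>) summable_on UNIV" using U summable_on_shift_int(1)[of "\<lambda>i. \<bar>U i\<bar>" 1] by simp
  have "(jump_sum U) \<le> (\<Sum>\<^sub>\<infinity>i. \<bar>U (i + 1)\<bar> + \<bar>U i\<bar>)"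
    by (rule infsum_mono[OF abs_summable_shift_diff[OF U] summable_on_add[OF U1 U]]) auto
  also have "\<dots> = 2 * (l1norm U)"
    using infsum_add[OF U1 U] summable_on_shift_int(2)[of "\<lambda>i. \<bar>U i\<bar>" 1] by simp
  finally show ?thesis .
qed

lemma frac_lap_step_bound:
  assumes lam: "0 < lam" "lam < 1" and d: "0 < d" and U: "abs_summable U"
  shows "(LINT x|lborel. \<bar>frac_lap lam (step_fun d U) x\<bar>)
    \<le> frac_const lam * (((jump_sum U) + 2 * (d * (l1norm U))) * kernel_mass lam)"
  using frac_lap_L1_bound[OF lam step_fun_L1_lipschitz[OF d U]] by (simp add: step_fun_L1_norm[OF d U])

lemma set_integral_abs_le:
  fixes g :: "real \<Rightarrow> real"
  assumes g: "integrable lborel g" and A: "A \<in> sets borel"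
  shows "\<bar>LINT x:A|lborel. g x\<bar> \<le> (LINT x:A|lborel. \<bar>g x\<bar>)"
    "(LINT x:A|lborel. \<bar>g x\<bar>) \<le> (L1norm g)"
proof -
  have "integrable lborel (\<lambda>x. indicat_real A x *\<^sub>R g x)" using g A by (intro integrable_mult_indicator) auto
  then show "\<bar>LINT x:A|lborel. g x\<bar> \<le> (LINT x:A|lborel. \<bar>g x\<bar>)"
    using integral_abs_bound[of lborel "\<lambda>x. indicat_real A x *\<^sub>R g x"] by (simp add: set_lebesgue_integral_def abs_mult)
  show "(LINT x:A|lborel. \<bar>g x\<bar>) \<le> (L1norm g)"
    unfolding set_lebesgue_integral_def
    by (rule integral_mono) (use g A in \<open>auto simp: indicator_def intro!: integrable_mult_indicator[of A lborel "\<lambda>x. \<bar>g x\<bar>", simplified]\<close>)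
qed

text \<open>No exchange of the infinite sum with the singular integral: the cell average
  \<open>\<Psi>\<close> is additive under changes of finitely many entries and bounded by a multiple
  of the l1 norm, so the remainder of a finite partial sum is controlled by the l1 tail of
  U.\<close>

lemma G_step_has_sum:
  assumes lam: "0 < lam" "lam < 1" and d: "0 < d" and U: "abs_summable U"
  shows "((\<lambda>j. G lam d i j * U j) has_sum (LINT x:cell d i|lborel. frac_lap lam (step_fun d U) x)) UNIV"
proof -
  define \<Psi> where "\<Psi> W = (LINT x:cell d i|lborel. frac_lap lam (step_fun d W) x)" for W
  define C where "C = frac_const lam * ((2 + 2 * d) * kernel_mass lam)"
  have C: "\<bar>\<Psi> W\<bar> \<le> C * (l1norm W)" if W: "abs_summable W" for W
  proof -
    note fi = integrable_frac_lap[OF lam step_fun_L1_lipschitz[OF d W]]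
    have "\<bar>\<Psi> W\<bar> \<le> (LINT x|lborel. \<bar>frac_lap lam (step_fun d W) x\<bar>)"
      unfolding \<Psi>_def using set_integral_abs_le[OF fi cell_sets, of d i] by linarith
    also have "\<dots> \<le> frac_const lam * (((jump_sum W) + 2 * (d * (l1norm W))) * kernel_mass lam)"
      by (rule frac_lap_step_bound[OF lam d W])
    also have "\<dots> \<le> frac_const lam * ((2 * (l1norm W) + 2 * (d * (l1norm W))) * kernel_mass lam)"
      by (intro mult_left_mono mult_right_mono add_right_mono shift_diff_sum_le W frac_const_nonneg kernel_mass_nonneg)
    finally show ?thesis by (simp add: C_def algebra_simps)
  qed
  have off: "(\<lambda>i. \<bar>if i \<in> J then 0 else U i\<bar>) summable_on UNIV" for J
    by (rule summable_on_comparison_test[OF U]) auto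
  have split: "\<Psi> W = \<Psi> (W(j := 0)) + W j * G lam d i j" if W: "abs_summable W" for W j
  proof -
    have W0: "(\<lambda>i. \<bar>(W(j := 0)) i\<bar>) summable_on UNIV"
      by (rule summable_on_comparison_test[OF W]) auto
    show ?thesis
      unfolding \<Psi>_def G_def
    proof (rule set_integral_frac_lap_combine[OF lam step_fun_L1_lipschitz[OF d W] step_fun_L1_lipschitz[OF d W0] indicator_cell_L1_lipschitz[OF d] cell_sets])
      fix x :: real assume x: "x \<noteq> of_int j * d"
      show "step_fun d W x = step_fun d (W(j := 0)) x + W j * indicat_real (cell d j) x"
      proof (cases "\<lfloor>x / d\<rfloor> = j")
        case True
        have "x \<in> cell d j"
          using floor_divide_lower[OF d, of x] floor_divide_upper[OF d, of x] x unfolding True by (auto simp: cell_def)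
        then show ?thesis using True by (simp add: step_fun_def)
      next
        case False
        then have "x \<notin> cell d j" using floor_in_cell[OF d] by auto
        then show ?thesis using False by (simp add: step_fun_def)
      qed
    qed
  qed
  have part: "\<Psi> U = \<Psi> (\<lambda>i. if i \<in> J then 0 else U i) + (\<Sum>j\<in>J. G lam d i j * U j)" if "finite J" for J
    using that
  proof (induction J)
    case (insert j J)
    have "(\<lambda>i. if i \<in> J then 0 else U i)(j := 0) = (\<lambda>i. if i \<in> insert j J then 0 else U i)" by auto
    then show ?case using insert split[OF off[of J], of j] by simp
  qed simp
  have rest: "(\<Sum>\<^sub>\<infinity>i. \<bar>if i \<in> J then 0 else U i\<bar>) = (l1norm U) - (\<Sum>j\<in>J. \<bar>U j\<bar>)" if "finite J" for J
  proof -
    have a: "(\<lambda>i. \<bar>if i \<in> J then U i else 0\<bar>) summable_on UNIV"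
      by (rule summable_on_comparison_test[OF U]) auto
    have "(\<Sum>\<^sub>\<infinity>i. \<bar>if i \<in> J then U i else 0\<bar>) = (\<Sum>\<^sub>\<infinity>i\<in>J. \<bar>U i\<bar>)"
      by (rule infsum_cong_neutral) auto
    moreover have "(l1norm U) = (\<Sum>\<^sub>\<infinity>i. \<bar>if i \<in> J then 0 else U i\<bar> + \<bar>if i \<in> J then U i else 0\<bar>)"
      by (rule infsum_cong) auto
    ultimately show ?thesis using infsum_add[OF off[of J] a] that by simp
  qed
  have "((\<lambda>J. (\<Sum>j\<in>J. G lam d i j * U j) - \<Psi> U) \<longlongrightarrow> 0) (finite_subsets_at_top UNIV)"
  proof (rule Lim_null_comparison)
    show "eventually (\<lambda>J. norm ((\<Sum>j\<in>J. G lam d i j * U j) - \<Psi> U) \<le> C * ((l1norm U) - (\<Sum>j\<in>J. \<bar>U j\<bar>))) (finite_subsets_at_top UNIV)"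
    proof (rule eventually_finite_subsets_at_top_weakI)
      fix J :: "int set" assume J: "finite J"
      show "norm ((\<Sum>j\<in>J. G lam d i j * U j) - \<Psi> U) \<le> C * ((l1norm U) - (\<Sum>j\<in>J. \<bar>U j\<bar>))"
        using C[OF off[of J]] unfolding rest[OF J] part[OF J] by simp
    qed
    have "((\<lambda>J. \<Sum>j\<in>J. \<bar>U j\<bar>) \<longlongrightarrow> (l1norm U)) (finite_subsets_at_top UNIV)"
      using has_sum_infsum[OF U] by (simp add: has_sum_def)
    from tendsto_mult_left[OF tendsto_diff[OF tendsto_const[of "\<Sum>\<^sub>\<infinity>i. \<bar>U i\<bar>"] this], of C]
    show "((\<lambda>J. C * ((l1norm U) - (\<Sum>j\<in>J. \<bar>U j\<bar>))) \<longlongrightarrow> 0) (finite_subsets_at_top UNIV)" by simp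
  qed
  then show ?thesis unfolding has_sum_def \<Psi>_def by (rule LIM_zero_cancel)
qed

lemma disc_frac_lap_shift: "disc_frac_lap lam d (\<lambda>i. U (i + 1)) i = disc_frac_lap lam d U (i + 1)"
proof -
  have "(\<Sum>\<^sub>\<infinity>j. G lam d i j * U (j + 1)) = (\<Sum>\<^sub>\<infinity>j. G lam d (i + 1) (j + 1) * U (j + 1))"
    by (subst (1 2) G_translate) simp
  also have "\<dots> = (\<Sum>\<^sub>\<infinity>j. G lam d (i + 1) j * U j)"
    by (rule summable_on_shift_int(2)[of "\<lambda>j. G lam d (i + 1) j * U j" 1])
  finally show ?thesis by (simp add: disc_frac_lap_def)
qed

lemma disc_frac_lap_zero: "disc_frac_lap lam d (\<lambda>i. 0) i = 0"
  by (simp add: disc_frac_lap_def)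

section \<open>The discrete operator on summable sequences\<close>

context
  fixes lam d :: real
  assumes lam: "0 < lam" "lam < 1" and d: "0 < d"
begin

lemma disc_frac_lap_average:
  assumes U: "abs_summable U"
  shows "d * disc_frac_lap lam d U i = (LINT x:cell d i|lborel. frac_lap lam (step_fun d U) x)"
  using infsumI[OF G_step_has_sum[OF lam d U, of i]] d by (simp add: disc_frac_lap_def)

lemma disc_frac_lap_has_sum:
  assumes U: "abs_summable U"
  shows "((\<lambda>j. G lam d i j * U j) has_sum d * disc_frac_lap lam d U i) UNIV"
  using G_step_has_sum[OF lam d U, of i] by (simp add: disc_frac_lap_average[OF U])

text \<open>The vanishing column sums of \<open>G\<close>, in the form tested against U.\<close>

lemma disc_frac_lap_sum_zero:
  assumes U: "abs_summable U"
  shows "((\<lambda>i. d * disc_frac_lap lam d U i) has_sum 0) UNIV"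
  using cell_has_sum[OF d integrable_frac_lap[OF lam step_fun_L1_lipschitz[OF d U]]]
    integral_frac_lap[OF lam step_fun_L1_lipschitz[OF d U]]
  by (simp add: disc_frac_lap_average[OF U])

lemma disc_frac_lap_abs_summable:
  assumes U: "abs_summable U"
  shows "(\<lambda>i. \<bar>disc_frac_lap lam d U i\<bar>) summable_on UNIV"
    and "d * (\<Sum>\<^sub>\<infinity>i. \<bar>disc_frac_lap lam d U i\<bar>) \<le> (LINT x|lborel. \<bar>frac_lap lam (step_fun d U) x\<bar>)"
proof -
  note fi = integrable_frac_lap[OF lam step_fun_L1_lipschitz[OF d U]]
  note hs = cell_has_sum[OF d integrable_abs[OF fi]]
  have le: "d * \<bar>disc_frac_lap lam d U i\<bar> \<le> (LINT x:cell d i|lborel. \<bar>frac_lap lam (step_fun d U) x\<bar>)" for i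
  proof -
    have "d * \<bar>disc_frac_lap lam d U i\<bar> = \<bar>LINT x:cell d i|lborel. frac_lap lam (step_fun d U) x\<bar>"
      using d by (simp add: disc_frac_lap_average[OF U, symmetric] abs_mult)
    then show ?thesis using set_integral_abs_le(1)[OF fi cell_sets, of d i] by simp
  qed
  have "(\<lambda>i. d * \<bar>disc_frac_lap lam d U i\<bar>) summable_on UNIV"
    by (rule summable_on_comparison_test[OF has_sum_imp_summable[OF hs]]) (use le d in auto)
  then show s: "(\<lambda>i. \<bar>disc_frac_lap lam d U i\<bar>) summable_on UNIV"
    using d summable_on_cmult_right[of "\<lambda>i. d * \<bar>disc_frac_lap lam d U i\<bar>" UNIV "1 / d"] by simp
  show "d * (\<Sum>\<^sub>\<infinity>i. \<bar>disc_frac_lap lam d U i\<bar>) \<le> (LINT x|lborel. \<bar>frac_lap lam (step_fun d U) x\<bar>)"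
    by (rule has_sum_mono[OF has_sum_cmult_right[OF has_sum_infsum[OF s]] hs]) (use le in auto)
qed

text \<open>Off the diagonal the kernel is nonnegative; this is the only property of it that the
  contraction proofs use, besides the vanishing of its column sums.\<close>

lemma disc_frac_lap_off_diagonal:
  assumes U: "abs_summable U"
  shows "\<bar>d * disc_frac_lap lam d U i - G lam d 0 0 * U i\<bar>
    \<le> d * disc_frac_lap lam d (\<lambda>i. \<bar>U i\<bar>) i - G lam d 0 0 * \<bar>U i\<bar>"
proof -
  have Ua: "(\<lambda>i. \<bar>\<bar>U i\<bar>\<bar>) summable_on UNIV" using U by simp
  have Gii: "G lam d i i = G lam d 0 0" using G_translate[of lam d i i] by simp
  have *: "0 \<le> (d * disc_frac_lap lam d (\<lambda>i. \<bar>U i\<bar>) i - G lam d 0 0 * \<bar>U i\<bar>) + s * (d * disc_frac_lap lam d U i - G lam d 0 0 * U i)"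
    if s: "s = 1 \<or> s = -1" for s
  proof (rule has_sum_nonneg)
    let ?f = "\<lambda>j. (G lam d i j * \<bar>U j\<bar> - (if j = i then G lam d 0 0 * \<bar>U i\<bar> else 0)) + s * (G lam d i j * U j - (if j = i then G lam d 0 0 * U i else 0))"
    have single: "((\<lambda>j. if j = i then c else 0) has_sum c) UNIV" for c :: real
      by (rule has_sum_finite_neutralI[where B="{i}"]) auto
    show "(?f has_sum (d * disc_frac_lap lam d (\<lambda>i. \<bar>U i\<bar>) i - G lam d 0 0 * \<bar>U i\<bar>) + s * (d * disc_frac_lap lam d U i - G lam d 0 0 * U i)) UNIV"
      by (intro has_sum_add has_sum_cmult_right has_sum_diff_real single disc_frac_lap_has_sum U Ua)
    show "0 \<le> ?f j" for j
    proof (cases "j = i")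
      case True
      then show ?thesis by (simp add: Gii)
    next
      case False
      have "?f j = G lam d i j * (\<bar>U j\<bar> + s * U j)" using False by (simp add: algebra_simps)
      moreover have "0 \<le> \<bar>U j\<bar> + s * U j" using s by auto
      ultimately show ?thesis using G_nonneg[OF d, of i j lam] False by simp
    qed
  qed
  show ?thesis using *[of 1] *[of "-1"] by (simp add: abs_le_iff)
qed

text \<open>Kato's inequality: the diagonal terms on both sides agree, and off the diagonal the sign
  can only lose.\<close>

lemma disc_frac_lap_kato:
  assumes U: "abs_summable U"
  shows "sgn (U i) * disc_frac_lap lam d U i \<le> disc_frac_lap lam d (\<lambda>i. \<bar>U i\<bar>) i"
proof -
  have "d * (sgn (U i) * disc_frac_lap lam d U i) - G lam d 0 0 * \<bar>U i\<bar> = sgn (U i) * (d * disc_frac_lap lam d U i - G lam d 0 0 * U i)"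
    by (auto simp: sgn_if algebra_simps)
  also have "\<dots> \<le> \<bar>d * disc_frac_lap lam d U i - G lam d 0 0 * U i\<bar>" by (auto simp: sgn_if abs_le_iff)
  also have "\<dots> \<le> d * disc_frac_lap lam d (\<lambda>i. \<bar>U i\<bar>) i - G lam d 0 0 * \<bar>U i\<bar>"
    by (rule disc_frac_lap_off_diagonal[OF U])
  finally have "d * (sgn (U i) * disc_frac_lap lam d U i) \<le> d * disc_frac_lap lam d (\<lambda>i. \<bar>U i\<bar>) i" by simp
  then show ?thesis using d by simp
qed

lemma disc_frac_lap_diff:
  assumes U: "abs_summable U" and V: "abs_summable V"
  shows "disc_frac_lap lam d (\<lambda>i. U i - V i) i = disc_frac_lap lam d U i - disc_frac_lap lam d V i"
proof -
  have "((\<lambda>j. G lam d i j * U j - G lam d i j * V j) has_sum d * disc_frac_lap lam d U i - d * disc_frac_lap lam d V i) UNIV"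
    by (intro has_sum_diff_real disc_frac_lap_has_sum U V)
  moreover have "((\<lambda>j. G lam d i j * U j - G lam d i j * V j) has_sum d * disc_frac_lap lam d (\<lambda>i. U i - V i) i) UNIV"
    using disc_frac_lap_has_sum[OF abs_summable_diff[OF U V], of i] by (simp add: right_diff_distrib)
  ultimately have "d * disc_frac_lap lam d U i - d * disc_frac_lap lam d V i = d * disc_frac_lap lam d (\<lambda>i. U i - V i) i"
    by (rule has_sum_unique)
  then show ?thesis using d by (simp add: right_diff_distrib[symmetric])
qed

text \<open>The operator norm on l1: the off-diagonal part is no larger than the diagonal. In
  contrast to \<open>frac_lap_step_bound\<close> no variation enters, at the price of the power
  d^(-lam); it will be applied to time increments, of which only the l1 norm is known to be
  small.\<close>

lemma disc_frac_lap_l1_bound: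
  assumes U: "abs_summable U"
  shows "d * (\<Sum>\<^sub>\<infinity>i. \<bar>disc_frac_lap lam d U i\<bar>) \<le> 2 * (d_const lam * d powr (1 - lam)) * (l1norm U)"
proof (rule has_sum_mono)
  have Ua: "(\<lambda>i. \<bar>\<bar>U i\<bar>\<bar>) summable_on UNIV" using U by simp
  let ?g = "d_const lam * d powr (1 - lam)"
  have g: "G lam d 0 0 = - ?g" by (rule G_diagonal[OF lam d])
  have g0: "0 \<le> ?g" using d_const_nonneg[OF lam] by simp
  show "((\<lambda>i. d * \<bar>disc_frac_lap lam d U i\<bar>) has_sum d * (\<Sum>\<^sub>\<infinity>i. \<bar>disc_frac_lap lam d U i\<bar>)) UNIV"
    by (intro has_sum_cmult_right has_sum_infsum disc_frac_lap_abs_summable U)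
  have "((\<lambda>i. d * disc_frac_lap lam d (\<lambda>i. \<bar>U i\<bar>) i + 2 * ?g * \<bar>U i\<bar>) has_sum 0 + 2 * ?g * (l1norm U)) UNIV"
    by (intro has_sum_add has_sum_cmult_right has_sum_infsum U disc_frac_lap_sum_zero Ua)
  then show "((\<lambda>i. d * disc_frac_lap lam d (\<lambda>i. \<bar>U i\<bar>) i + 2 * ?g * \<bar>U i\<bar>) has_sum 2 * ?g * (l1norm U)) UNIV"
    by simp
  fix i
  have "d * \<bar>disc_frac_lap lam d U i\<bar> = \<bar>d * disc_frac_lap lam d U i\<bar>" using d by (simp add: abs_mult)
  also have "\<dots> \<le> \<bar>d * disc_frac_lap lam d U i - G lam d 0 0 * U i\<bar> + \<bar>G lam d 0 0 * U i\<bar>" by linarith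
  also have "\<bar>G lam d 0 0 * U i\<bar> = ?g * \<bar>U i\<bar>" using g0 d_const_nonneg[OF lam] by (simp add: g abs_mult)
  also have "\<bar>d * disc_frac_lap lam d U i - G lam d 0 0 * U i\<bar> \<le> d * disc_frac_lap lam d (\<lambda>i. \<bar>U i\<bar>) i + ?g * \<bar>U i\<bar>"
    using disc_frac_lap_off_diagonal[OF U, of i] by (simp add: g)
  finally show "d * \<bar>disc_frac_lap lam d U i\<bar> \<le> d * disc_frac_lap lam d (\<lambda>i. \<bar>U i\<bar>) i + 2 * ?g * \<bar>U i\<bar>" by (simp add: algebra_simps)
qed

end

text \<open>For the last claim, d times the deviation from the cell average at y is at most the
  integral of |u0(y + s) - u0(y)| over |s| \<le> d, since a cell containing y lies in that range.
  Integrating in y first gives at most B d for each s, hence 2 B d^2.\<close>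

lemma initial_averages_error:
  assumes d: "0 < d" and u0: "L1_lipschitz B u0"
  shows "(\<lambda>i. \<bar>initial_averages d u0 i\<bar>) summable_on UNIV"
    and "d * (\<Sum>\<^sub>\<infinity>i. \<bar>initial_averages d u0 i\<bar>) \<le> (L1norm u0)"
    and "(\<Sum>\<^sub>\<infinity>i. \<bar>initial_averages d u0 (i + 1) - initial_averages d u0 i\<bar>) \<le> B"
    and "(LINT y|lborel. \<bar>u0 y - step_fun d (initial_averages d u0) y\<bar>) \<le> 2 * B * d"
proof -
  note uD = L1_lipschitzD[OF u0]
  have [measurable]: "u0 \<in> borel_measurable borel" using uD by auto
  let ?U = "initial_averages d u0"
  have dU: "d * ?U i = (LINT x:cell d i|lborel. u0 x)" for i using d by (simp add: initial_averages_def)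
  note hs = cell_has_sum[OF d integrable_abs[OF uD(1)]]
  have le: "d * \<bar>?U i\<bar> \<le> (LINT x:cell d i|lborel. \<bar>u0 x\<bar>)" for i
  proof -
    have "d * \<bar>?U i\<bar> = \<bar>LINT x:cell d i|lborel. u0 x\<bar>" using d by (simp add: dU[symmetric] abs_mult)
    then show ?thesis using set_integral_abs_le(1)[OF uD(1) cell_sets, of d i] by simp
  qed
  have "(\<lambda>i. d * \<bar>?U i\<bar>) summable_on UNIV"
    by (rule summable_on_comparison_test[OF has_sum_imp_summable[OF hs]]) (use le d in auto)
  then show s: "abs_summable ?U"
    using d summable_on_cmult_right[of "\<lambda>i. d * \<bar>?U i\<bar>" UNIV "1 / d"] by simp
  show "d * (l1norm ?U) \<le> (L1norm u0)"
    by (rule has_sum_mono[OF has_sum_cmult_right[OF has_sum_infsum[OF s]] hs]) (use le in auto)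
  define e where "e x = u0 (x + d) - u0 x" for x
  have e: "integrable lborel e" unfolding e_def[abs_def] using uD(1) integrable_shift[OF uD(1), of d] by auto
  have dU1: "d * (?U (i + 1) - ?U i) = (LINT x:cell d i|lborel. e x)" for i
  proof -
    have "(LINT x:cell d (i + 1)|lborel. u0 x) = (LINT x|lborel. indicat_real (cell d (i + 1)) (x + d) *\<^sub>R u0 (x + d))"
      unfolding set_lebesgue_integral_def by (rule integral_shift[symmetric])
    also have "\<dots> = (LINT x:cell d i|lborel. u0 (x + d))"
      unfolding set_lebesgue_integral_def
      by (rule Bochner_Integration.integral_cong) (auto simp: indicator_def cell_def algebra_simps)
    finally have 1: "d * ?U (i + 1) = (LINT x:cell d i|lborel. u0 (x + d))" by (simp add: dU)
    have "set_integrable lborel (cell d i) (\<lambda>x. u0 (x + d))" "set_integrable lborel (cell d i) u0"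
      unfolding set_integrable_def using uD(1) integrable_shift[OF uD(1), of d] by (intro integrable_mult_indicator; simp)+
    from set_integral_diff(2)[OF this] show ?thesis unfolding right_diff_distrib 1 dU[of i] e_def by simp
  qed
  have "d * (jump_sum ?U) \<le> (L1norm e)"
  proof (rule has_sum_mono[OF has_sum_cmult_right[OF has_sum_infsum[OF abs_summable_shift_diff[OF s]]] cell_has_sum[OF d integrable_abs[OF e]]])
    fix i
    have "d * \<bar>?U (i + 1) - ?U i\<bar> = \<bar>LINT x:cell d i|lborel. e x\<bar>" using d by (simp add: dU1[symmetric] abs_mult)
    then show "d * \<bar>?U (i + 1) - ?U i\<bar> \<le> (LINT x:cell d i|lborel. \<bar>e x\<bar>)"
      using set_integral_abs_le(1)[OF e cell_sets, of d i] by simp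
  qed
  also have "\<dots> \<le> B * d" using uD(3)[of d] d by (simp add: e_def)
  finally show "(jump_sum ?U) \<le> B" using d by (simp add: mult.commute)
  let ?J = "{-d..d}"
  let ?h = "\<lambda>(s, y). indicat_real ?J s * \<bar>u0 (y + s) - u0 y\<bar>"
  have hm: "?h \<in> borel_measurable plane" by measurable
  have hB: "AE s in lborel. integrable lborel (\<lambda>y. ?h (s, y)) \<and> (LINT y|lborel. \<bar>?h (s, y)\<bar>) \<le> B * d * indicat_real ?J s"
  proof (rule AE_I2)
    fix s
    have "(LINT y|lborel. \<bar>u0 (y + s) - u0 y\<bar>) \<le> B * d" if "s \<in> ?J"
    proof -
      have "(LINT y|lborel. \<bar>u0 (y + s) - u0 y\<bar>) \<le> B * \<bar>s\<bar>" by (rule uD(3))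
      also have "\<dots> \<le> B * d" using that uD(5) by (intro mult_left_mono) auto
      finally show ?thesis .
    qed
    then show "integrable lborel (\<lambda>y. ?h (s, y)) \<and> (LINT y|lborel. \<bar>?h (s, y)\<bar>) \<le> B * d * indicat_real ?J s"
      using uD(1) integrable_shift[OF uD(1), of s] by (cases "s \<in> ?J") auto
  qed
  have iJ: "integrable lborel (\<lambda>s. B * d * indicat_real ?J s)"
    by (intro integrable_mult_right integrable_real_indicator emeasure_bounded_finite) auto
  have hi: "integrable plane ?h" by (rule lborel_pair.integrable_pair_bound[OF hm hB iJ])
  have "(LINT y|lborel. LINT s|lborel. ?h (s, y)) = (LINT p|plane. ?h p)"
    using lborel_pair.Fubini_integral[of "\<lambda>s y. ?h (s, y)"] hi lborel_pair.integral_fst'[OF hi] by simp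
  also have "\<dots> \<le> (LINT s|lborel. B * d * indicat_real ?J s)"
    using lborel_pair.integral_pair_bound[OF hm hB iJ] by linarith
  also have "\<dots> = 2 * B * d * d" using d by simp
  finally have hh: "(LINT y|lborel. LINT s|lborel. ?h (s, y)) \<le> 2 * B * d * d" .
  have hy: "integrable lborel (\<lambda>y. LINT s|lborel. ?h (s, y))"
    using lborel_pair.integrable_fst'[OF lborel_pair.integrable_product_swap[OF hi]] by simp
  have "d * (LINT y|lborel. \<bar>u0 y - step_fun d ?U y\<bar>) = (LINT y|lborel. d * \<bar>u0 y - step_fun d ?U y\<bar>)" by simp
  also have "\<dots> \<le> (LINT y|lborel. LINT s|lborel. ?h (s, y))"
  proof (rule integral_mono_AE[OF _ hy])
    show "integrable lborel (\<lambda>y. d * \<bar>u0 y - step_fun d ?U y\<bar>)" using uD(1) integrable_step_fun[OF d s] by auto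
    show "AE y in lborel. d * \<bar>u0 y - step_fun d ?U y\<bar> \<le> (LINT s|lborel. ?h (s, y))"
      using AE_in_cell[OF d]
    proof eventually_elim
      case (elim y)
      define i where "i = \<lfloor>y / d\<rfloor>"
      have y: "y \<in> cell d i" using elim by (simp add: i_def)
      have c: "integrable lborel (\<lambda>x. indicat_real (cell d i) x * (u0 x - u0 y))"
      proof -
        have "integrable lborel (\<lambda>x. indicat_real (cell d i) x *\<^sub>R u0 x)" using uD(1) by (intro integrable_mult_indicator) auto
        moreover have "integrable lborel (\<lambda>x. indicat_real (cell d i) x * u0 y)"
          by (intro integrable_mult_left integrable_real_indicator emeasure_bounded_finite) (auto simp: cell_def)
        ultimately show ?thesis by (simp add: right_diff_distrib)
      qed
      have ci: "integrable lborel (\<lambda>s. indicat_real (cell d i) (s + y) * (u0 (s + y) - u0 y))"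
        by (rule integrable_shift[OF c])
      have hsi: "integrable lborel (\<lambda>s. ?h (s, y))"
      proof -
        have "integrable lborel (\<lambda>s. indicat_real ?J s *\<^sub>R u0 (s + y))"
          using integrable_shift[OF uD(1), of y] by (intro integrable_mult_indicator) auto
        moreover have "integrable lborel (\<lambda>s. indicat_real ?J s * u0 y)"
          by (intro integrable_mult_left integrable_real_indicator emeasure_bounded_finite) auto
        ultimately have "integrable lborel (\<lambda>s. indicat_real ?J s * (u0 (s + y) - u0 y))" by (simp add: right_diff_distrib)
        from integrable_abs[OF this] show ?thesis by (simp add: abs_mult add.commute)
      qed
      have "d * (?U i - u0 y) = (LINT x:cell d i|lborel. u0 x) - (LINT x:cell d i|lborel. u0 y)"
        using cell_set_integral_const[OF d, of i "\<lambda>x. u0 y" "u0 y"] by (simp add: dU right_diff_distrib)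
      also have "\<dots> = (LINT x|lborel. indicat_real (cell d i) x * (u0 x - u0 y))"
      proof -
        have "set_integrable lborel (cell d i) u0" "set_integrable lborel (cell d i) (\<lambda>x. u0 y)"
          unfolding set_integrable_def using integrable_mult_indicator[of "cell d i" lborel u0] uD(1)
          by (auto intro!: integrable_mult_left integrable_real_indicator emeasure_bounded_finite simp: cell_def)
        from set_integral_diff(2)[OF this] show ?thesis by (simp add: set_lebesgue_integral_def)
      qed
      also have "\<dots> = (LINT s|lborel. indicat_real (cell d i) (s + y) * (u0 (s + y) - u0 y))"
        by (rule integral_shift[symmetric])
      finally have "\<bar>d * (?U i - u0 y)\<bar> \<le> (LINT s|lborel. \<bar>indicat_real (cell d i) (s + y) * (u0 (s + y) - u0 y)\<bar>)"
        using integral_abs_bound by metis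
      also have "\<dots> \<le> (LINT s|lborel. ?h (s, y))"
      proof (rule integral_mono[OF integrable_abs[OF ci] hsi])
        fix s
        have "s \<in> ?J" if "s + y \<in> cell d i" using that y by (auto simp: cell_def algebra_simps)
        then show "\<bar>indicat_real (cell d i) (s + y) * (u0 (s + y) - u0 y)\<bar> \<le> ?h (s, y)"
          by (auto simp: indicator_def add.commute)
      qed
      finally show ?case using d by (simp add: step_fun_def i_def[symmetric] abs_mult abs_minus_commute)
    qed
  qed
  also note hh
  finally show "(LINT y|lborel. \<bar>u0 y - step_fun d ?U y\<bar>) \<le> 2 * B * d" using d by (simp add: mult.commute)
qed

section \<open>The two schemes\<close>

definition frac_bound :: "real \<Rightarrow> real \<Rightarrow> real \<Rightarrow> real" where
  "frac_bound lam A B = frac_const lam * ((B + 2 * A) * kernel_mass lam)"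

section \<open>Stability of both schemes\<close>

locale grid_scheme = monotone_flux +
  fixes lam d h :: real
  assumes lam: "0 < lam" "lam < 1" and d: "0 < d" and h: "0 < h" and cfl: "(F1 + F2) * (h / d) \<le> 1"
begin

text \<open>Summed over all cells, the flux differences telescope and the nonlocal term vanishes.
  \<open>W\<close> is the difference at the level where the nonlocal operator acts: the new one for
  the implicit-explicit scheme, the old one for the explicit scheme.\<close>

lemma contraction_sum:
  fixes U V W D' :: "int \<Rightarrow> real"
  assumes D: "(\<lambda>i. \<bar>U i - V i\<bar>) summable_on UNIV" and W: "abs_summable W"
    and le: "\<And>i. \<bar>D' i\<bar> \<le> \<bar>U i - V i\<bar>
      - h / d * (entropy_flux F (U i) (U (i + 1)) (V i) (V (i + 1)) - entropy_flux F (U (i - 1)) (U i) (V (i - 1)) (V i))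
      + h * disc_frac_lap lam d (\<lambda>i. \<bar>W i\<bar>) i"
  shows "abs_summable D'" "(l1norm D') \<le> (\<Sum>\<^sub>\<infinity>i. \<bar>U i - V i\<bar>)"
proof -
  define Q1 where "Q1 i = entropy_flux F (U i) (U (i + 1)) (V i) (V (i + 1))" for i
  have D1: "(\<lambda>i. \<bar>U (i + 1) - V (i + 1)\<bar>) summable_on UNIV"
    using D summable_on_shift_int(1)[of "\<lambda>i. \<bar>U i - V i\<bar>" 1] by simp
  have "abs_summable Q1"
  proof (rule summable_on_comparison_test)
    show "(\<lambda>i. F1 * \<bar>U i - V i\<bar> + F2 * \<bar>U (i + 1) - V (i + 1)\<bar>) summable_on UNIV"
      by (intro summable_on_add summable_on_cmult_right D D1)
    show "\<bar>Q1 i\<bar> \<le> F1 * \<bar>U i - V i\<bar> + F2 * \<bar>U (i + 1) - V (i + 1)\<bar>" for i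
      unfolding Q1_def by (rule entropy_flux_bound)
  qed auto
  then have Q: "Q1 summable_on UNIV" using abs_summable_summable[of Q1 UNIV] by simp
  have Qm: "(\<lambda>i. Q1 (i - 1)) summable_on UNIV" "(\<Sum>\<^sub>\<infinity>i. Q1 (i - 1)) = (\<Sum>\<^sub>\<infinity>i. Q1 i)"
    using Q summable_on_shift_int[of Q1 "-1"] by simp_all
  have q: "((\<lambda>i. Q1 i - Q1 (i - 1)) has_sum 0) UNIV"
    using has_sum_diff_real[OF has_sum_infsum[OF Q] has_sum_infsum[OF Qm(1)]] Qm(2) by simp
  have "(\<lambda>i. \<bar>\<bar>W i\<bar>\<bar>) summable_on UNIV" using W by simp
  from has_sum_cmult_right[OF disc_frac_lap_sum_zero[OF lam d this], of "h / d"]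
  have a: "((\<lambda>i. h * disc_frac_lap lam d (\<lambda>i. \<bar>W i\<bar>) i) has_sum 0) UNIV" using d by simp
  have r: "((\<lambda>i. \<bar>U i - V i\<bar> - h / d * (Q1 i - Q1 (i - 1)) + h * disc_frac_lap lam d (\<lambda>i. \<bar>W i\<bar>) i) has_sum (\<Sum>\<^sub>\<infinity>i. \<bar>U i - V i\<bar>)) UNIV"
    using has_sum_add[OF has_sum_diff_real[OF has_sum_infsum[OF D] has_sum_cmult_right[OF q, of "h / d"]] a] by simp
  have le': "\<bar>D' i\<bar> \<le> \<bar>U i - V i\<bar> - h / d * (Q1 i - Q1 (i - 1)) + h * disc_frac_lap lam d (\<lambda>i. \<bar>W i\<bar>) i" for i
    using le[of i] by (simp add: Q1_def)
  show s: "abs_summable D'"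
    by (rule summable_on_comparison_test[OF has_sum_imp_summable[OF r]]) (use le' in auto)
  show "(l1norm D') \<le> (\<Sum>\<^sub>\<infinity>i. \<bar>U i - V i\<bar>)"
    by (rule has_sum_mono[OF has_sum_infsum[OF s] r]) (rule le')
qed

lemma flux_step_abs:
  assumes "(F1 + F2) * (h / d) + \<delta> \<le> 1"
  shows "\<bar>(1 - \<delta>) * (U i - V i) - h * (D_minus_flux F d U i - D_minus_flux F d V i)\<bar>
    \<le> (1 - \<delta>) * \<bar>U i - V i\<bar>
      - h / d * (entropy_flux F (U i) (U (i + 1)) (V i) (V (i + 1)) - entropy_flux F (U (i - 1)) (U i) (V (i - 1)) (V i))"
proof -
  have "h * (D_minus_flux F d U i - D_minus_flux F d V i)
      = h / d * ((F (U i) (U (i + 1)) - F (V i) (V (i + 1))) - (F (U (i - 1)) (U i) - F (V (i - 1)) (V i)))"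
    using d by (simp add: D_minus_flux_def field_simps)
  then show ?thesis
    using monotone_step_abs[of "h / d" \<delta> "U i" "V i" "U (i + 1)" "V (i + 1)" "U (i - 1)" "V (i - 1)"] assms d h
    by (simp add: mult.commute)
qed

text \<open>The difference of the two equations is multiplied by the sign of the new difference. As
  the operator acts on the new level, Kato's inequality applies without any restriction on the step,
  and the CFL condition only concerns the flux.\<close>

lemma imex_contraction:
  assumes U: "abs_summable U'" and V: "abs_summable V'"
    and D: "(\<lambda>i. \<bar>U i - V i\<bar>) summable_on UNIV"
    and Us: "\<And>i. U' i = U i - h * D_minus_flux F d U i + h * disc_frac_lap lam d U' i"
    and Vs: "\<And>i. V' i = V i - h * D_minus_flux F d V i + h * disc_frac_lap lam d V' i"
  shows "(\<Sum>\<^sub>\<infinity>i. \<bar>U' i - V' i\<bar>) \<le> (\<Sum>\<^sub>\<infinity>i. \<bar>U i - V i\<bar>)"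
proof (rule contraction_sum(2)[OF D abs_summable_diff[OF U V]])
  fix i
  let ?X = "(1 - 0) * (U i - V i) - h * (D_minus_flux F d U i - D_minus_flux F d V i)"
  have "U' i - V' i = ?X + h * disc_frac_lap lam d (\<lambda>i. U' i - V' i) i"
    by (subst Us, subst Vs) (simp add: disc_frac_lap_diff[OF lam d U V] algebra_simps)
  from arg_cong[OF this, of "\<lambda>t. sgn (U' i - V' i) * t"]
  have "sgn (U' i - V' i) * (U' i - V' i) = sgn (U' i - V' i) * ?X + h * (sgn (U' i - V' i) * disc_frac_lap lam d (\<lambda>i. U' i - V' i) i)"
    by (simp only: distrib_left mult.left_commute[of "sgn (U' i - V' i)" h])
  also have "sgn (U' i - V' i) * ?X \<le> \<bar>?X\<bar>" by (auto simp: sgn_if abs_le_iff)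
  also have "h * (sgn (U' i - V' i) * disc_frac_lap lam d (\<lambda>i. U' i - V' i) i) \<le> h * disc_frac_lap lam d (\<lambda>i. \<bar>U' i - V' i\<bar>) i"
    using disc_frac_lap_kato[OF lam d abs_summable_diff[OF U V], of i] h by (intro mult_left_mono) auto
  also have "sgn (U' i - V' i) * (U' i - V' i) = \<bar>U' i - V' i\<bar>" by (simp add: abs_sgn mult.commute)
  finally have "\<bar>U' i - V' i\<bar> \<le> \<bar>?X\<bar> + h * disc_frac_lap lam d (\<lambda>i. \<bar>U' i - V' i\<bar>) i" by simp
  then show "\<bar>U' i - V' i\<bar> \<le> \<bar>U i - V i\<bar>
      - h / d * (entropy_flux F (U i) (U (i + 1)) (V i) (V (i + 1)) - entropy_flux F (U (i - 1)) (U i) (V (i - 1)) (V i))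
      + h * disc_frac_lap lam d (\<lambda>i. \<bar>U' i - V' i\<bar>) i"
    using flux_step_abs[of 0 U i V] cfl by simp
qed

text \<open>Here the operator acts on the old level, where the sign of the new difference is of no
  help. Its diagonal is moved to the local part, which the stronger CFL condition keeps monotone,
  and the remaining entries are nonnegative.\<close>

lemma explicit_contraction:
  assumes U: "abs_summable U" and V: "abs_summable V"
    and cfl_d: "(F1 + F2) * (h / d) + d_const lam * (h / d powr lam) \<le> 1"
    and Us: "\<And>i. U' i = U i - h * D_minus_flux F d U i + h * disc_frac_lap lam d U i"
    and Vs: "\<And>i. V' i = V i - h * D_minus_flux F d V i + h * disc_frac_lap lam d V i"
  shows "(\<lambda>i. \<bar>U' i - V' i\<bar>) summable_on UNIV" "(\<Sum>\<^sub>\<infinity>i. \<bar>U' i - V' i\<bar>) \<le> (\<Sum>\<^sub>\<infinity>i. \<bar>U i - V i\<bar>)"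
proof -
  note D = abs_summable_diff[OF U V]
  have le: "\<bar>U' i - V' i\<bar> \<le> \<bar>U i - V i\<bar>
      - h / d * (entropy_flux F (U i) (U (i + 1)) (V i) (V (i + 1)) - entropy_flux F (U (i - 1)) (U i) (V (i - 1)) (V i))
      + h * disc_frac_lap lam d (\<lambda>i. \<bar>U i - V i\<bar>) i" for i
  proof -
    \<comment> \<open>h/d times the modulus of the diagonal entry of \<open>G\<close>, that is, the
      second summand of the CFL condition.\<close>
    define \<delta> where "\<delta> = d_const lam * (h / d powr lam)"
    have \<delta>: "h / d * G lam d 0 0 = - \<delta>"
      unfolding G_diagonal[OF lam d] \<delta>_def using d by (simp add: powr_diff)
    let ?X = "(1 - \<delta>) * (U i - V i) - h * (D_minus_flux F d U i - D_minus_flux F d V i)"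
    let ?A = "disc_frac_lap lam d (\<lambda>i. U i - V i) i"
    let ?B = "disc_frac_lap lam d (\<lambda>i. \<bar>U i - V i\<bar>) i"
    have hd: "h / d * (d * ?A - G lam d 0 0 * (U i - V i)) = h * ?A + \<delta> * (U i - V i)"
      "h / d * (d * ?B - G lam d 0 0 * \<bar>U i - V i\<bar>) = h * ?B + \<delta> * \<bar>U i - V i\<bar>"
      using \<delta> d by (simp_all add: right_diff_distrib mult.assoc[symmetric])
    have "U' i - V' i = ?X + (h * ?A + \<delta> * (U i - V i))"
      by (subst Us, subst Vs) (simp add: disc_frac_lap_diff[OF lam d U V] algebra_simps)
    then have "\<bar>U' i - V' i\<bar> \<le> \<bar>?X\<bar> + \<bar>h / d * (d * ?A - G lam d 0 0 * (U i - V i))\<bar>" unfolding hd by linarith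
    also have "\<bar>h / d * (d * ?A - G lam d 0 0 * (U i - V i))\<bar> = h / d * \<bar>d * ?A - G lam d 0 0 * (U i - V i)\<bar>"
      using h d by (simp add: abs_mult)
    also have "\<dots> \<le> h / d * (d * ?B - G lam d 0 0 * \<bar>U i - V i\<bar>)"
      using disc_frac_lap_off_diagonal[OF lam d D, of i] h d by (intro mult_left_mono) auto
    also note hd(2)
    finally show ?thesis
      using flux_step_abs[of \<delta> U i V] cfl_d by (simp add: \<delta>_def algebra_simps)
  qed
  show "(\<lambda>i. \<bar>U' i - V' i\<bar>) summable_on UNIV" "(\<Sum>\<^sub>\<infinity>i. \<bar>U' i - V' i\<bar>) \<le> (\<Sum>\<^sub>\<infinity>i. \<bar>U i - V i\<bar>)"
    by (rule contraction_sum[OF D D le])+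
qed

lemma D_minus_flux_zero: "D_minus_flux F d (\<lambda>i. 0) i = 0"
  by (simp add: D_minus_flux_def)

lemma D_minus_flux_shift: "D_minus_flux F d (\<lambda>i. U (i + 1)) i = D_minus_flux F d U (i + 1)"
  by (simp add: D_minus_flux_def)

text \<open>Both bounds are contractions: towards the zero solution, and towards the solution
  shifted by one cell, which solves the same equations by translation invariance.\<close>

lemma imex_preserves:
  assumes U: "abs_summable U" and U': "abs_summable U'"
    and Us: "\<And>i. U' i = U i - h * D_minus_flux F d U i + h * disc_frac_lap lam d U' i"
  shows "(l1norm U') \<le> (l1norm U)" "(jump_sum U') \<le> (jump_sum U)"
proof -
  show "(l1norm U') \<le> (l1norm U)"
  proof -
    have "(\<Sum>\<^sub>\<infinity>i. \<bar>U' i - 0\<bar>) \<le> (\<Sum>\<^sub>\<infinity>i. \<bar>U i - 0\<bar>)"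
      by (rule imex_contraction[OF U' _ _ Us]) (simp_all add: U D_minus_flux_zero disc_frac_lap_zero)
    then show ?thesis by simp
  qed
  have "(\<lambda>i. \<bar>U' (i + 1)\<bar>) summable_on UNIV" using U' summable_on_shift_int(1)[of "\<lambda>i. \<bar>U' i\<bar>" 1] by simp
  moreover have "U' (i + 1) = U (i + 1) - h * D_minus_flux F d (\<lambda>i. U (i + 1)) i + h * disc_frac_lap lam d (\<lambda>i. U' (i + 1)) i" for i
    unfolding D_minus_flux_shift disc_frac_lap_shift by (rule Us)
  ultimately show "(jump_sum U') \<le> (jump_sum U)"
    by (intro imex_contraction U' abs_summable_shift_diff[OF U] Us)
qed

lemma explicit_preserves:
  assumes U: "abs_summable U"
    and cfl_d: "(F1 + F2) * (h / d) + d_const lam * (h / d powr lam) \<le> 1"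
    and Us: "\<And>i. U' i = U i - h * D_minus_flux F d U i + h * disc_frac_lap lam d U i"
  shows "abs_summable U'"
    "(l1norm U') \<le> (l1norm U)" "(jump_sum U') \<le> (jump_sum U)"
proof -
  show "abs_summable U'" "(l1norm U') \<le> (l1norm U)"
  proof -
    have z: "(\<lambda>i. \<bar>0 :: real\<bar>) summable_on (UNIV :: int set)"
      "0 = 0 - h * D_minus_flux F d (\<lambda>i. 0) i + h * disc_frac_lap lam d (\<lambda>i. 0) i" for i
      by (simp_all add: D_minus_flux_zero disc_frac_lap_zero)
    show "abs_summable U'" "(l1norm U') \<le> (l1norm U)"
      using explicit_contraction[OF U z(1) cfl_d Us z(2)] by simp_all
  qed
  have "(\<lambda>i. \<bar>U (i + 1)\<bar>) summable_on UNIV" using U summable_on_shift_int(1)[of "\<lambda>i. \<bar>U i\<bar>" 1] by simp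
  moreover have "U' (i + 1) = U (i + 1) - h * D_minus_flux F d (\<lambda>i. U (i + 1)) i + h * disc_frac_lap lam d (\<lambda>i. U (i + 1)) i" for i
    unfolding D_minus_flux_shift disc_frac_lap_shift by (rule Us)
  ultimately show "(jump_sum U') \<le> (jump_sum U)"
    by (intro explicit_contraction(2) U cfl_d Us)
qed

lemma time_increment_bound:
  assumes U: "abs_summable U" and W: "abs_summable W"
    and UB: "(jump_sum U) \<le> B"
    and WC: "d * (\<Sum>\<^sub>\<infinity>i. \<bar>disc_frac_lap lam d W i\<bar>) \<le> C"
    and Us: "\<And>i. U' i = U i - h * D_minus_flux F d U i + h * disc_frac_lap lam d W i"
  shows "(\<lambda>i. \<bar>U' i - U i\<bar>) summable_on UNIV" "d * (\<Sum>\<^sub>\<infinity>i. \<bar>U' i - U i\<bar>) \<le> h * ((F1 + F2) * B + C)"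
proof -
  note tv = abs_summable_shift_diff[OF U]
  have tm: "((\<lambda>i. \<bar>U i - U (i - 1)\<bar>) has_sum (jump_sum U)) UNIV"
  proof -
    have "(\<lambda>i. \<bar>U i - U (i - 1)\<bar>) summable_on UNIV" "(\<Sum>\<^sub>\<infinity>i. \<bar>U i - U (i - 1)\<bar>) = (jump_sum U)"
      using summable_on_shift_int[of "\<lambda>i. \<bar>U (i + 1) - U i\<bar>" "-1"] tv by simp_all
    then show ?thesis using has_sum_infsum by metis
  qed
  note A = disc_frac_lap_abs_summable(1)[OF lam d W]
  have r: "((\<lambda>i. h * (F1 * \<bar>U i - U (i - 1)\<bar> + F2 * \<bar>U (i + 1) - U i\<bar>) + h * (d * \<bar>disc_frac_lap lam d W i\<bar>)) has_sum
      h * (F1 * (jump_sum U) + F2 * (jump_sum U)) + h * (d * (\<Sum>\<^sub>\<infinity>i. \<bar>disc_frac_lap lam d W i\<bar>))) UNIV"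
    by (intro has_sum_add has_sum_cmult_right has_sum_infsum tm tv A)
  have le: "d * \<bar>U' i - U i\<bar> \<le> h * (F1 * \<bar>U i - U (i - 1)\<bar> + F2 * \<bar>U (i + 1) - U i\<bar>) + h * (d * \<bar>disc_frac_lap lam d W i\<bar>)" for i
  proof -
    have fl: "\<bar>F (U i) (U (i + 1)) - F (U (i - 1)) (U i)\<bar> \<le> F1 * \<bar>U i - U (i - 1)\<bar> + F2 * \<bar>U (i + 1) - U i\<bar>"
      using F_lip1[of "U i" "U i" "U (i - 1)"] F_lip2[of "U i" "U (i + 1)" "U i"] by linarith
    have "d * (U' i - U i) = - h * (F (U i) (U (i + 1)) - F (U (i - 1)) (U i)) + h * (d * disc_frac_lap lam d W i)"
      using d by (subst Us) (simp add: D_minus_flux_def field_simps)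
    then have "\<bar>d * (U' i - U i)\<bar> \<le> \<bar>h * (F (U i) (U (i + 1)) - F (U (i - 1)) (U i))\<bar> + \<bar>h * (d * disc_frac_lap lam d W i)\<bar>"
      by linarith
    then have "d * \<bar>U' i - U i\<bar> \<le> h * \<bar>F (U i) (U (i + 1)) - F (U (i - 1)) (U i)\<bar> + h * (d * \<bar>disc_frac_lap lam d W i\<bar>)"
      using d h by (simp add: abs_mult)
    also have "\<dots> \<le> h * (F1 * \<bar>U i - U (i - 1)\<bar> + F2 * \<bar>U (i + 1) - U i\<bar>) + h * (d * \<bar>disc_frac_lap lam d W i\<bar>)"
      using fl h by (intro add_right_mono mult_left_mono) auto
    finally show ?thesis .
  qed
  have "(\<lambda>i. d * \<bar>U' i - U i\<bar>) summable_on UNIV"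
    by (rule summable_on_comparison_test[OF has_sum_imp_summable[OF r]]) (use le d in auto)
  then show s: "(\<lambda>i. \<bar>U' i - U i\<bar>) summable_on UNIV"
    using d summable_on_cmult_right[of "\<lambda>i. d * \<bar>U' i - U i\<bar>" UNIV "1 / d"] by simp
  have "d * (\<Sum>\<^sub>\<infinity>i. \<bar>U' i - U i\<bar>) \<le> h * (F1 * (jump_sum U) + F2 * (jump_sum U)) + h * (d * (\<Sum>\<^sub>\<infinity>i. \<bar>disc_frac_lap lam d W i\<bar>))"
    by (rule has_sum_mono[OF has_sum_cmult_right[OF has_sum_infsum[OF s]] r]) (rule le)
  also have "\<dots> \<le> h * (F1 * B + F2 * B) + h * C"
    using UB WC h F1_pos F2_pos by (intro add_mono mult_left_mono) auto
  finally show "d * (\<Sum>\<^sub>\<infinity>i. \<bar>U' i - U i\<bar>) \<le> h * ((F1 + F2) * B + C)" by (simp add: algebra_simps)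
qed

text \<open>The explicit scheme is the implicit-explicit one perturbed by \<open>\<rho> = g\<langle>U\<rangle> - g\<langle>U'\<rangle>\<close>, whose size
  \<open>O(h d\<^bsup>-lam\<^esup>)\<close> is the origin of the term \<open>\<Delta>x\<^bsup>1-lam\<^esup>\<close>.\<close>

definition perturbed_step :: "real \<Rightarrow> (int \<Rightarrow> real) \<Rightarrow> (int \<Rightarrow> real) \<Rightarrow> bool" where
  "perturbed_step R U U' \<longleftrightarrow> (\<exists>\<rho>. abs_summable \<rho> \<and> d * (l1norm \<rho>) \<le> R \<and>
     (\<forall>i. U' i = U i - h * D_minus_flux F d U i + h * disc_frac_lap lam d U' i + h * \<rho> i))"

text \<open>A comparison with the constant state k, whose flux differences vanish. Constants are not
  summable, so the nonlocal term is kept with its sign and is only estimated after doubling the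
  variables.\<close>

lemma perturbed_step_entropy:
  assumes "U' i = U i - h * D_minus_flux F d U i + h * disc_frac_lap lam d U' i + h * \<rho>"
  shows "\<bar>U' i - k\<bar> \<le> \<bar>U i - k\<bar>
        - h / d * (entropy_flux F (U i) (U (i + 1)) k k - entropy_flux F (U (i - 1)) (U i) k k)
        + h * (sgn (U' i - k) * disc_frac_lap lam d U' i) + h * \<bar>\<rho>\<bar>"
proof -
  let ?X = "(1 - 0) * (U i - k) - h * (D_minus_flux F d U i - D_minus_flux F d (\<lambda>i. k) i)"
  have "U' i - k = ?X + h * disc_frac_lap lam d U' i + h * \<rho>"
    by (subst assms) (simp add: D_minus_flux_def)
  from arg_cong[OF this, of "\<lambda>t. sgn (U' i - k) * t"]
  have "sgn (U' i - k) * (U' i - k) = sgn (U' i - k) * ?X + h * (sgn (U' i - k) * disc_frac_lap lam d U' i) + h * (sgn (U' i - k) * \<rho>)"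
    by (simp only: distrib_left mult.left_commute[of "sgn (U' i - k)" h])
  also have "sgn (U' i - k) * ?X \<le> \<bar>?X\<bar>" by (auto simp: sgn_if abs_le_iff)
  also have "h * (sgn (U' i - k) * \<rho>) \<le> h * \<bar>\<rho>\<bar>" using h by (intro mult_left_mono) (auto simp: sgn_if abs_le_iff)
  also have "sgn (U' i - k) * (U' i - k) = \<bar>U' i - k\<bar>" by (simp add: abs_sgn mult.commute)
  finally show ?thesis using flux_step_abs[of 0 U i "\<lambda>i. k"] cfl by simp
qed

text \<open>The interface between the schemes and the error estimate: uniform norm and variation,
  one perturbed step, and a speed \<open>C\<close> in L^1. \<open>R\<close> is 0 for the
  implicit-explicit scheme.\<close>

definition admissible_states :: "nat \<Rightarrow> real \<Rightarrow> real \<Rightarrow> real \<Rightarrow> real \<Rightarrow> (nat \<Rightarrow> int \<Rightarrow> real) \<Rightarrow> bool" where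
  "admissible_states N A B C R U \<longleftrightarrow>
     (\<forall>n\<le>N. abs_summable (U n) \<and> d * (l1norm (U n)) \<le> A \<and> (jump_sum (U n)) \<le> B) \<and>
     (\<forall>n<N. perturbed_step R (U n) (U (Suc n)) \<and> d * (\<Sum>\<^sub>\<infinity>i. \<bar>U (Suc n) i - U n i\<bar>) \<le> h * C)"

lemma frac_lap_step_frac_bound:
  assumes U: "abs_summable U" "d * (l1norm U) \<le> A" "(jump_sum U) \<le> B"
  shows "(LINT x|lborel. \<bar>frac_lap lam (step_fun d U) x\<bar>) \<le> frac_bound lam A B"
    and "d * (\<Sum>\<^sub>\<infinity>i. \<bar>disc_frac_lap lam d U i\<bar>) \<le> frac_bound lam A B"
proof -
  have "(LINT x|lborel. \<bar>frac_lap lam (step_fun d U) x\<bar>)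
      \<le> frac_const lam * (((jump_sum U) + 2 * (d * (l1norm U))) * kernel_mass lam)"
    by (rule frac_lap_step_bound[OF lam d U(1)])
  also have "\<dots> \<le> frac_bound lam A B"
    unfolding frac_bound_def using U by (intro mult_left_mono mult_right_mono frac_const_nonneg kernel_mass_nonneg) auto
  finally show 1: "(LINT x|lborel. \<bar>frac_lap lam (step_fun d U) x\<bar>) \<le> frac_bound lam A B" .
  show "d * (\<Sum>\<^sub>\<infinity>i. \<bar>disc_frac_lap lam d U i\<bar>) \<le> frac_bound lam A B"
    using disc_frac_lap_abs_summable(2)[OF lam d U(1)] 1 by linarith
qed

lemma imex_admissible:
  assumes sol: "imex_solution lam F u0 d h N U" and u0: "L1_lipschitz B u0"
  shows "admissible_states N (L1norm u0) B ((F1 + F2) * B + frac_bound lam (L1norm u0) B) 0 U"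
proof -
  let ?A = "LINT x|lborel. \<bar>u0 x\<bar>"
  have U0: "U 0 = initial_averages d u0" and sum: "\<And>n. n < N \<Longrightarrow> abs_summable (U (Suc n))"
    and Us: "\<And>n i. n < N \<Longrightarrow> U (Suc n) i = U n i - h * D_minus_flux F d (U n) i + h * disc_frac_lap lam d (U (Suc n)) i"
    using sol unfolding imex_solution_def by blast+
  note ia = initial_averages_error[OF d u0]
  have b: "abs_summable (U n) \<and> d * (l1norm (U n)) \<le> ?A \<and> (jump_sum (U n)) \<le> B" if "n \<le> N" for n
    using that
  proof (induction n)
    case 0
    then show ?case using ia U0 by simp
  next
    case (Suc n)
    then have n: "n < N" and IH: "abs_summable (U n)" "d * (l1norm (U n)) \<le> ?A" "(jump_sum (U n)) \<le> B"
      by auto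
    note p = imex_preserves[OF IH(1) sum[OF n] Us[OF n]]
    have "d * (l1norm (U (Suc n))) \<le> d * (l1norm (U n))" using p(1) d by simp
    then show ?case using p(2) IH sum[OF n] by linarith
  qed
  have "perturbed_step 0 (U n) (U (Suc n)) \<and> d * (\<Sum>\<^sub>\<infinity>i. \<bar>U (Suc n) i - U n i\<bar>) \<le> h * ((F1 + F2) * B + frac_bound lam ?A B)"
    if n: "n < N" for n
  proof
    show "perturbed_step 0 (U n) (U (Suc n))"
      unfolding perturbed_step_def by (rule exI[of _ "\<lambda>i. 0"]) (use Us[OF n] in auto)
    have bn: "abs_summable (U n)" "(jump_sum (U n)) \<le> B" using b[of n] n by auto
    have bS: "abs_summable (U (Suc n))" "d * (l1norm (U (Suc n))) \<le> ?A" "(jump_sum (U (Suc n))) \<le> B"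
      using b[of "Suc n"] n by auto
    show "d * (\<Sum>\<^sub>\<infinity>i. \<bar>U (Suc n) i - U n i\<bar>) \<le> h * ((F1 + F2) * B + frac_bound lam ?A B)"
      by (rule time_increment_bound(2)[OF bn(1) bS(1) bn(2) frac_lap_step_frac_bound(2)[OF bS] Us[OF n]])
  qed
  with b show ?thesis unfolding admissible_states_def by blast
qed

text \<open>Origin of the perturbation size: the increments have l1 norm at most h C / d, the CFL
  condition turns this into C / (F1 + F2), and the operator norm contributes 2 d_const d^(1 - lam)
  after multiplication by d.\<close>

lemma explicit_admissible:
  assumes sol: "explicit_solution lam F u0 d h N U" and u0: "L1_lipschitz B u0"
    and cfl_d: "(F1 + F2) * (h / d) + d_const lam * (h / d powr lam) \<le> 1"
  shows "admissible_states N (L1norm u0) B ((F1 + F2) * B + frac_bound lam (L1norm u0) B)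
    (2 * d_const lam / (F1 + F2) * ((F1 + F2) * B + frac_bound lam (L1norm u0) B) * d powr (1 - lam)) U"
proof -
  let ?A = "LINT x|lborel. \<bar>u0 x\<bar>"
  define C where "C = (F1 + F2) * B + frac_bound lam ?A B"
  have U0: "U 0 = initial_averages d u0"
    and Us: "\<And>n i. n < N \<Longrightarrow> U (Suc n) i = U n i - h * D_minus_flux F d (U n) i + h * disc_frac_lap lam d (U n) i"
    using sol unfolding explicit_solution_def by blast+
  note ia = initial_averages_error[OF d u0]
  have b: "abs_summable (U n) \<and> d * (l1norm (U n)) \<le> ?A \<and> (jump_sum (U n)) \<le> B" if "n \<le> N" for n
    using that
  proof (induction n)
    case 0
    then show ?case using ia U0 by simp
  next
    case (Suc n)
    then have n: "n < N" and IH: "abs_summable (U n)" "d * (l1norm (U n)) \<le> ?A" "(jump_sum (U n)) \<le> B"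
      by auto
    note p = explicit_preserves[OF IH(1) cfl_d Us[OF n]]
    have "d * (l1norm (U (Suc n))) \<le> d * (l1norm (U n))" using p(2) d by simp
    then show ?case using p(1,3) IH by linarith
  qed
  have "perturbed_step (2 * d_const lam / (F1 + F2) * C * d powr (1 - lam)) (U n) (U (Suc n)) \<and> d * (\<Sum>\<^sub>\<infinity>i. \<bar>U (Suc n) i - U n i\<bar>) \<le> h * C"
    if n: "n < N" for n
  proof -
    have bn: "abs_summable (U n)" "d * (l1norm (U n)) \<le> ?A" "(jump_sum (U n)) \<le> B"
      using b[of n] n by auto
    have bS: "abs_summable (U (Suc n))" using b[of "Suc n"] n by auto
    have ti: "d * (\<Sum>\<^sub>\<infinity>i. \<bar>U (Suc n) i - U n i\<bar>) \<le> h * C"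
      unfolding C_def by (rule time_increment_bound(2)[OF bn(1) bn(1) bn(3) frac_lap_step_frac_bound(2)[OF bn] Us[OF n]])
    define \<rho> where "\<rho> i = disc_frac_lap lam d (\<lambda>i. U n i - U (Suc n) i) i" for i
    note Dn = abs_summable_diff[OF bn(1) bS]
    have "\<rho> i = disc_frac_lap lam d (U n) i - disc_frac_lap lam d (U (Suc n)) i" for i
      unfolding \<rho>_def by (rule disc_frac_lap_diff[OF lam d bn(1) bS])
    then have st: "U (Suc n) i = U n i - h * D_minus_flux F d (U n) i + h * disc_frac_lap lam d (U (Suc n)) i + h * \<rho> i" for i
      by (subst Us[OF n]) (simp add: right_diff_distrib)
    have "d * (l1norm \<rho>) \<le> 2 * (d_const lam * d powr (1 - lam)) * (\<Sum>\<^sub>\<infinity>i. \<bar>U n i - U (Suc n) i\<bar>)"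
      unfolding \<rho>_def by (rule disc_frac_lap_l1_bound[OF lam d Dn])
    also have "\<dots> \<le> 2 * (d_const lam * d powr (1 - lam)) * (C / (F1 + F2))"
    proof (intro mult_left_mono)
      have s0: "0 \<le> (\<Sum>\<^sub>\<infinity>i. \<bar>U n i - U (Suc n) i\<bar>)" by (rule infsum_nonneg) simp
      have "d * (\<Sum>\<^sub>\<infinity>i. \<bar>U n i - U (Suc n) i\<bar>) \<le> h * C" using ti by (simp add: abs_minus_commute)
      note le = this
      have C0: "0 \<le> C"
        using order_trans[OF mult_nonneg_nonneg[OF less_imp_le[OF d] s0] le] h by (simp add: zero_le_mult_iff)
      moreover have "h * C \<le> d / (F1 + F2) * C"
        using cfl d F1_pos F2_pos C0 by (intro mult_right_mono) (auto simp: field_simps)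
      ultimately have "d * (\<Sum>\<^sub>\<infinity>i. \<bar>U n i - U (Suc n) i\<bar>) \<le> d * (C / (F1 + F2))" using le by simp
      then show "(\<Sum>\<^sub>\<infinity>i. \<bar>U n i - U (Suc n) i\<bar>) \<le> C / (F1 + F2)" by (rule mult_left_le_imp_le[OF _ d])
    qed (use d_const_nonneg[OF lam] in auto)
    finally have "d * (l1norm \<rho>) \<le> 2 * d_const lam / (F1 + F2) * C * d powr (1 - lam)" by (simp add: mult_ac)
    moreover have "abs_summable \<rho>"
      unfolding \<rho>_def by (rule disc_frac_lap_abs_summable(1)[OF lam d Dn])
    ultimately show ?thesis using st ti unfolding perturbed_step_def by blast
  qed
  with b show ?thesis unfolding admissible_states_def C_def by blast
qed

end

section \<open>The entropy inequality tested against grid functions\<close>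

lemma total_variation_nonneg: "0 \<le> total_variation w"
proof -
  have "(\<lambda>x. 0) C1_differentiable_on UNIV" by simp
  then have "ereal (LINT x|lborel. w x * deriv (\<lambda>x. 0) x) \<le> total_variation w"
    unfolding total_variation_def by (intro SUP_upper) auto
  then show ?thesis by (simp add: zero_ereal_def)
qed

lemma BV_L1_lipschitz:
  assumes "w \<in> BV"
  shows "\<exists>M. L1_lipschitz M w"
proof -
  have w: "integrable lborel w" "total_variation w < \<infinity>" using assms by (auto simp: BV_def)
  then obtain M where "total_variation w = ereal M"
    using total_variation_nonneg[of w] by (cases "total_variation w") auto
  then show ?thesis using BV_imp_L1_lipschitz[OF w(1), of M] by auto
qed

lemma BV_norm_le_imp:
  assumes "w \<in> BV" "BV_norm w \<le> ereal M"
  shows "(L1norm w) \<le> M" "L1_lipschitz M w"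
proof -
  have w: "integrable lborel w" "total_variation w < \<infinity>" using assms by (auto simp: BV_def)
  then obtain V where V: "total_variation w = ereal V"
    using total_variation_nonneg[of w] by (cases "total_variation w") auto
  then have "0 \<le> V" "(L1norm w) + V \<le> M"
    using total_variation_nonneg[of w] assms(2) by (auto simp: BV_norm_def)
  moreover have "0 \<le> (L1norm w)" by simp
  ultimately have "V \<le> M" "(L1norm w) \<le> M" by linarith+
  then show "(L1norm w) \<le> M" "L1_lipschitz M w"
    using BV_imp_L1_lipschitz[OF w(1), of M] V by auto
qed

lemma entropy_solution_slices:
  assumes "BV_entropy_solution lam T f u0 u"
  shows "\<exists>M\<ge>0. AE t in lborel. t \<in> {0<..<T} \<longrightarrow> (LINT x|lborel. \<bar>u x t\<bar>) \<le> M \<and> L1_lipschitz M (\<lambda>x. u x t)"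
proof -
  obtain M where M: "AE t in lborel. t \<in> {0<..<T} \<longrightarrow> (\<lambda>x. u x t) \<in> BV \<and> BV_norm (\<lambda>x. u x t) \<le> ereal M"
    using assms by (auto simp: BV_entropy_solution_def L_infinity_BV_def)
  have "AE t in lborel. t \<in> {0<..<T} \<longrightarrow> (LINT x|lborel. \<bar>u x t\<bar>) \<le> max M 0 \<and> L1_lipschitz (max M 0) (\<lambda>x. u x t)"
    using M
  proof eventually_elim
    case (elim t)
    have "BV_norm (\<lambda>x. u x t) \<le> ereal (max M 0)" if "BV_norm (\<lambda>x. u x t) \<le> ereal M"
      using that by (rule order_trans) simp
    then show ?case using elim BV_norm_le_imp[of "\<lambda>x. u x t" "max M 0"] by blast
  qed
  then show ?thesis by (intro exI[of _ "max M 0"]) auto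
qed

section \<open>The doubled entropy inequality\<close>

context monotone_flux
begin

text \<open>For each y the entropy inequality is used with k = v(y) and the test function \<omega>(x
  - y) \<tau>(t); then it is integrated in y. The work lies in the exchange of the integrals, which
  needs a majorant in (x, t, y). Integrability in t is part of the claim because the inequalities
  are added over n later.\<close>

lemma entropy_weak_form:
  fixes v :: "real \<Rightarrow> real"
  assumes lam: "0 < lam" "lam < 1" and T: "0 < T" and sol: "BV_entropy_solution lam T f u0 u"
    and u0: "integrable lborel u0" and m: "mollifier r \<omega> \<omega>'" and v: "integrable lborel v"
    and Ck: "\<And>k. Ck k \<tau>" and D: "\<And>t. (\<tau> has_real_derivative \<tau>' t) (at t)" and nn: "\<And>t. t \<in> {0..T} \<Longrightarrow> 0 \<le> \<tau> t"
  shows "integrable lborel (\<lambda>t. indicator {0<..<T} t *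
      (\<tau>' t * (LINT (x, y)|plane. \<bar>u x t - v y\<bar> * \<omega> (x - y))
       + \<tau> t * ((LINT (x, y)|plane. q f (v y) (u x t) * \<omega>' (x - y))
           + (LINT (x, y)|plane. sgn (u x t - v y) * frac_lap lam (\<lambda>x. u x t) x * \<omega> (x - y)))))
    \<and> 0 \<le> (LINT t|lborel. indicator {0<..<T} t *
      (\<tau>' t * (LINT (x, y)|plane. \<bar>u x t - v y\<bar> * \<omega> (x - y))
       + \<tau> t * ((LINT (x, y)|plane. q f (v y) (u x t) * \<omega>' (x - y))
           + (LINT (x, y)|plane. sgn (u x t - v y) * frac_lap lam (\<lambda>x. u x t) x * \<omega> (x - y)))))
      + \<tau> 0 * (LINT (x, y)|plane. \<bar>u0 x - v y\<bar> * \<omega> (x - y))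
      - \<tau> T * (LINT (x, y)|plane. \<bar>u x T - v y\<bar> * \<omega> (x - y))"
proof -
  note mD = mollifierD[OF m]
  have vm[measurable]: "v \<in> borel_measurable borel" and [measurable]: "\<omega> \<in> borel_measurable borel" "\<omega>' \<in> borel_measurable borel"
    using v mD by auto
  obtain M where M: "AE t in lborel. t \<in> {0<..<T} \<longrightarrow> (LINT x|lborel. \<bar>u x t\<bar>) \<le> M \<and> L1_lipschitz M (\<lambda>x. u x t)"
    using entropy_solution_slices[OF sol] by auto
  obtain \<sigma> where \<sigma>: "\<And>x. (\<tau> has_real_derivative \<sigma> x) (at x)" "continuous_on UNIV \<sigma>" using Ck[of 1] by auto
  have "\<tau>' = \<sigma>" using D \<sigma>(1) DERIV_unique by blast
  then have c': "continuous_on UNIV \<tau>'" using \<sigma> by simp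
  have c: "continuous_on UNIV \<tau>" using Ck[of 0] by simp
  have [measurable]: "\<tau> \<in> borel_measurable borel" "\<tau>' \<in> borel_measurable borel"
    using c c' by (auto intro: borel_measurable_continuous_onI)
  obtain C where C: "0 \<le> C" "\<And>t. t \<in> {0<..<T} \<Longrightarrow> \<bar>\<tau> t\<bar> \<le> C \<and> \<bar>\<tau>' t\<bar> \<le> C"
  proof -
    have "bounded (\<tau> ` {0..T})" "bounded (\<tau>' ` {0..T})"
      by (intro compact_imp_bounded compact_continuous_image continuous_on_subset[OF c] continuous_on_subset[OF c'] compact_Icc; simp)+
    then obtain C1 C2 where "\<forall>x\<in>{0..T}. \<bar>\<tau> x\<bar> \<le> C1" "\<forall>x\<in>{0..T}. \<bar>\<tau>' x\<bar> \<le> C2"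
      by (auto simp: bounded_iff)
    then show ?thesis by (intro that[of "max 0 (max C1 C2)"]) (auto simp: le_max_iff_disj)
  qed
  define i where "i = (indicator {0<..<T} :: real \<Rightarrow> real)"
  have ii: "integrable lborel i" unfolding i_def using T by simp
  have [measurable]: "i \<in> borel_measurable borel" unfolding i_def by measurable
  \<comment> \<open>The solution is jointly measurable on the open strip only; cut off outside, it
    becomes measurable on the plane, and so does its fractional Laplacian as a parameter
    integral.\<close>
  define w where "w p = i (snd p) * u (fst p) (snd p)" for p
  have wm[measurable]: "w \<in> borel_measurable plane"
  proof -
    have "(\<lambda>p. indicator (Q T) p *\<^sub>R (case p of (x, t) \<Rightarrow> u x t)) \<in> borel_measurable plane"
      using sol by (auto simp: BV_entropy_solution_def L_infinity_def set_borel_measurable_def lborel_prod)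
    moreover have "(\<lambda>p. indicator (Q T) p *\<^sub>R (case p of (x, t) \<Rightarrow> u x t)) = w"
      by (auto simp: fun_eq_iff w_def i_def Q_def indicator_def)
    ultimately show ?thesis by simp
  qed
  have wt: "w (x, t) = u x t" if "t \<in> {0<..<T}" for x t using that by (simp add: w_def i_def)
  have w0: "w (x, t) = 0" if "t \<notin> {0<..<T}" for x t using that by (simp add: w_def i_def)
  define g where "g p = frac_lap lam (\<lambda>x. w (x, snd p)) (fst p)" for p
  have gm[measurable]: "g \<in> borel_measurable plane"
    unfolding g_def[abs_def] frac_lap_eq by measurable
  have gt: "g (x, t) = frac_lap lam (\<lambda>x. u x t) x" if "t \<in> {0<..<T}" for x t
    by (simp add: g_def wt[OF that])
  have g0: "g (x, t) = 0" if "t \<notin> {0<..<T}" for x t by (simp add: g_def w0[OF that] frac_lap_eq)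
  have slice: "AE t in lborel. integrable lborel (\<lambda>x. w (x, t)) \<and> (LINT x|lborel. \<bar>w (x, t)\<bar>) \<le> M * i t
      \<and> integrable lborel (\<lambda>x. g (x, t)) \<and> (LINT x|lborel. \<bar>g (x, t)\<bar>) \<le> frac_const lam * ((M + 2 * M) * kernel_mass lam) * i t"
    using M
  proof eventually_elim
    case (elim t)
    show ?case
    proof (cases "t \<in> {0<..<T}")
      case True
      then have L: "L1_lipschitz M (\<lambda>x. u x t)" and M1: "(LINT x|lborel. \<bar>u x t\<bar>) \<le> M" using elim by auto
      have "(LINT x|lborel. \<bar>frac_lap lam (\<lambda>x. u x t) x\<bar>) \<le> frac_const lam * ((M + 2 * (LINT x|lborel. \<bar>u x t\<bar>)) * kernel_mass lam)"
        by (rule frac_lap_L1_bound[OF lam L])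
      also have "\<dots> \<le> frac_const lam * ((M + 2 * M) * kernel_mass lam)"
        using M1 by (intro mult_left_mono mult_right_mono add_left_mono frac_const_nonneg kernel_mass_nonneg) auto
      finally show ?thesis
        using L1_lipschitzD(1)[OF L] M1 integrable_frac_lap[OF lam L] True by (simp add: wt gt i_def)
    next
      case False
      then show ?thesis by (simp add: w0 g0 i_def)
    qed
  qed
  have wi: "integrable plane w"
  proof -
    have "integrable plane (\<lambda>(t, x). w (x, t))"
    proof (rule lborel_pair.integrable_pair_bound[where B="\<lambda>t. M * i t"])
      show "AE t in lborel. integrable lborel (\<lambda>x. case (t, x) of (t, x) \<Rightarrow> w (x, t)) \<and> (LINT x|lborel. \<bar>case (t, x) of (t, x) \<Rightarrow> w (x, t)\<bar>) \<le> M * i t"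
        using slice by eventually_elim auto
    qed (use ii in auto)
    from lborel_pair.integrable_product_swap[OF this] show ?thesis by simp
  qed
  have gi: "integrable plane g"
  proof -
    have "integrable plane (\<lambda>(t, x). g (x, t))"
    proof (rule lborel_pair.integrable_pair_bound[where B="\<lambda>t. frac_const lam * ((M + 2 * M) * kernel_mass lam) * i t"])
      show "AE t in lborel. integrable lborel (\<lambda>x. case (t, x) of (t, x) \<Rightarrow> g (x, t)) \<and> (LINT x|lborel. \<bar>case (t, x) of (t, x) \<Rightarrow> g (x, t)\<bar>) \<le> frac_const lam * ((M + 2 * M) * kernel_mass lam) * i t"
        using slice by eventually_elim auto
    qed (use ii in auto)
    from lborel_pair.integrable_product_swap[OF this] show ?thesis by simp
  qed
  define \<Theta> where "\<Theta> p y = i (snd p) * (\<tau>' (snd p) * (\<bar>w p - v y\<bar> * \<omega> (fst p - y))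
      + \<tau> (snd p) * (q f (v y) (w p) * \<omega>' (fst p - y) + sgn (w p - v y) * g p * \<omega> (fst p - y)))" for p y
  have \<Theta>m[measurable]: "(\<lambda>(p, y). \<Theta> p y) \<in> borel_measurable (plane \<Otimes>\<^sub>M lborel)"
    unfolding \<Theta>_def by measurable
  define K where "K x = \<omega> x + \<bar>\<omega>' x\<bar>" for x
  have Ki: "integrable lborel K" unfolding K_def[abs_def] using mD(8,9) by auto
  have [measurable]: "K \<in> borel_measurable borel" using Ki by simp
  have K0: "0 \<le> K x" "\<omega> x \<le> K x" "\<bar>\<omega>' x\<bar> \<le> K x" for x using mD(5)[of x] by (auto simp: K_def)
  define Z where "Z = 1 + (F1 + F2)"
  have Z: "1 \<le> Z" "F1 + F2 \<le> Z" using F1_pos F2_pos by (auto simp: Z_def)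
  have \<Theta>i: "integrable (plane \<Otimes>\<^sub>M lborel) (\<lambda>(p, y). \<Theta> p y)"
  proof -
    have P: "integrable plane (\<lambda>p. 2 * C * Z * \<bar>w p\<bar> + C * \<bar>g p\<bar>)" using wi gi by auto
    have "integrable (plane \<Otimes>\<^sub>M lborel) (\<lambda>(p, y). (2 * C * Z * \<bar>w p\<bar> + C * \<bar>g p\<bar>) * K (fst p - y))"
    proof (rule lborel_pair_real.integrable_pair_bound[where B="\<lambda>p. (2 * C * Z * \<bar>w p\<bar> + C * \<bar>g p\<bar>) * (LINT x|lborel. K x)"])
      show "AE p in plane. integrable lborel (\<lambda>y. case (p, y) of (p, y) \<Rightarrow> (2 * C * Z * \<bar>w p\<bar> + C * \<bar>g p\<bar>) * K (fst p - y)) \<and>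
          (LINT y|lborel. \<bar>case (p, y) of (p, y) \<Rightarrow> (2 * C * Z * \<bar>w p\<bar> + C * \<bar>g p\<bar>) * K (fst p - y)\<bar>) \<le> (2 * C * Z * \<bar>w p\<bar> + C * \<bar>g p\<bar>) * (LINT x|lborel. K x)"
      proof (rule AE_I2)
        fix p :: "real \<times> real"
        have "0 \<le> 2 * C * Z * \<bar>w p\<bar> + C * \<bar>g p\<bar>" using C(1) Z by simp
        then show "integrable lborel (\<lambda>y. case (p, y) of (p, y) \<Rightarrow> (2 * C * Z * \<bar>w p\<bar> + C * \<bar>g p\<bar>) * K (fst p - y)) \<and>
          (LINT y|lborel. \<bar>case (p, y) of (p, y) \<Rightarrow> (2 * C * Z * \<bar>w p\<bar> + C * \<bar>g p\<bar>) * K (fst p - y)\<bar>) \<le> (2 * C * Z * \<bar>w p\<bar> + C * \<bar>g p\<bar>) * (LINT x|lborel. K x)"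
          using integrable_reflect[OF Ki, of "fst p"] integral_reflect[of K "fst p"] K0(1)
          by (simp add: abs_mult)
      qed
      show "(\<lambda>(p, y). (2 * C * Z * \<bar>w p\<bar> + C * \<bar>g p\<bar>) * K (fst p - y)) \<in> borel_measurable (plane \<Otimes>\<^sub>M lborel)"
        by measurable
    qed (use P in auto)
    moreover have "integrable (plane \<Otimes>\<^sub>M lborel) (\<lambda>(p, y). 2 * C * Z * (\<bar>v y\<bar> * (K (fst p - y) * i (snd p))))"
    proof -
      have "integrable (lborel \<Otimes>\<^sub>M plane) (\<lambda>(y, p). \<bar>v y\<bar> * (K (fst p - y) * i (snd p)))"
      proof (rule lborel_real_pair.integrable_pair_bound[where B="\<lambda>y. \<bar>v y\<bar> * ((LINT x|lborel. K x) * (LINT t|lborel. i t))"])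
        show "AE y in lborel. integrable plane (\<lambda>p. case (y, p) of (y, p) \<Rightarrow> \<bar>v y\<bar> * (K (fst p - y) * i (snd p))) \<and>
          (LINT p|plane. \<bar>case (y, p) of (y, p) \<Rightarrow> \<bar>v y\<bar> * (K (fst p - y) * i (snd p))\<bar>) \<le> \<bar>v y\<bar> * ((LINT x|lborel. K x) * (LINT t|lborel. i t))"
        proof (rule AE_I2)
          fix y
          note pr = integrable_product[OF integrable_shift_diff(1)[OF Ki, of y] ii, unfolded case_prod_beta']
          have "0 \<le> i t" for t by (simp add: i_def)
          then show "integrable plane (\<lambda>p. case (y, p) of (y, p) \<Rightarrow> \<bar>v y\<bar> * (K (fst p - y) * i (snd p))) \<and>
          (LINT p|plane. \<bar>case (y, p) of (y, p) \<Rightarrow> \<bar>v y\<bar> * (K (fst p - y) * i (snd p))\<bar>) \<le> \<bar>v y\<bar> * ((LINT x|lborel. K x) * (LINT t|lborel. i t))"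
            using pr integrable_shift_diff(2)[OF Ki, of y] K0(1) by (simp add: abs_mult)
        qed
        show "(\<lambda>(y, p). \<bar>v y\<bar> * (K (fst p - y) * i (snd p))) \<in> borel_measurable (lborel \<Otimes>\<^sub>M plane)"
          by measurable
      qed (use v in auto)
      from lborel_real_pair.integrable_product_swap[OF this] show ?thesis
        by (simp add: case_prod_beta')
    qed
    ultimately have "integrable (plane \<Otimes>\<^sub>M lborel) (\<lambda>(p, y). (2 * C * Z * \<bar>w p\<bar> + C * \<bar>g p\<bar>) * K (fst p - y) + 2 * C * Z * (\<bar>v y\<bar> * (K (fst p - y) * i (snd p))))"
      unfolding case_prod_beta' by (rule Bochner_Integration.integrable_add)
    then show ?thesis
    proof (rule Bochner_Integration.integrable_bound[OF _ \<Theta>m], intro AE_I2, clarsimp simp only: split_paired_all prod.case real_norm_def fst_conv snd_conv)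
      fix x t y
      show "\<bar>\<Theta> (x, t) y\<bar> \<le> \<bar>(2 * C * Z * \<bar>w (x, t)\<bar> + C * \<bar>g (x, t)\<bar>) * K (x - y) + 2 * C * Z * (\<bar>v y\<bar> * (K (x - y) * i t))\<bar>"
      proof (cases "t \<in> {0<..<T}")
        case False
        then show ?thesis by (simp add: \<Theta>_def i_def)
      next
        case True
        let ?W = "w (x, t)" and ?G = "g (x, t)"
        have t: "\<bar>\<tau> t\<bar> \<le> C" "\<bar>\<tau>' t\<bar> \<le> C" using C(2)[OF True] by auto
        have 1: "\<bar>\<tau>' t * (\<bar>?W - v y\<bar> * \<omega> (x - y))\<bar> \<le> C * (Z * (\<bar>?W\<bar> + \<bar>v y\<bar>) * K (x - y))"
        proof -
          have "\<bar>\<bar>?W - v y\<bar> * \<omega> (x - y)\<bar> \<le> (\<bar>?W\<bar> + \<bar>v y\<bar>) * K (x - y)"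
            using K0(2)[of "x - y"] mD(5)[of "x - y"] by (simp add: abs_mult mult_mono)
          also have "\<dots> \<le> Z * (\<bar>?W\<bar> + \<bar>v y\<bar>) * K (x - y)"
            using Z(1) K0(1)[of "x - y"] mult_right_mono[of 1 Z "(\<bar>?W\<bar> + \<bar>v y\<bar>) * K (x - y)"] by (simp add: mult.assoc)
          finally show ?thesis unfolding abs_mult[of "\<tau>' t"] using t C(1) by (intro mult_mono) auto
        qed
        have 2: "\<bar>\<tau> t * (q f (v y) ?W * \<omega>' (x - y))\<bar> \<le> C * (Z * (\<bar>?W\<bar> + \<bar>v y\<bar>) * K (x - y))"
        proof -
          have "\<bar>q f (v y) ?W\<bar> \<le> (F1 + F2) * \<bar>?W - v y\<bar>" by (rule q_bound)
          also have "\<dots> \<le> Z * (\<bar>?W\<bar> + \<bar>v y\<bar>)" using Z F1_pos F2_pos by (intro mult_mono) auto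
          finally have "\<bar>q f (v y) ?W * \<omega>' (x - y)\<bar> \<le> Z * (\<bar>?W\<bar> + \<bar>v y\<bar>) * K (x - y)"
            unfolding abs_mult using K0(3)[of "x - y"] by (intro mult_mono) (use Z in auto)
          then show ?thesis unfolding abs_mult[of "\<tau> t"] using t C(1) by (intro mult_mono) auto
        qed
        have 3: "\<bar>\<tau> t * (sgn (?W - v y) * ?G * \<omega> (x - y))\<bar> \<le> C * (\<bar>?G\<bar> * K (x - y))"
        proof -
          have "\<bar>sgn (?W - v y) * ?G\<bar> \<le> \<bar>?G\<bar>" by (auto simp: sgn_if abs_mult)
          then have "\<bar>sgn (?W - v y) * ?G * \<omega> (x - y)\<bar> \<le> \<bar>?G\<bar> * K (x - y)"
            unfolding abs_mult[of _ "\<omega> (x - y)"] using K0(2)[of "x - y"] mD(5)[of "x - y"] by (intro mult_mono) auto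
          then show ?thesis unfolding abs_mult[of "\<tau> t"] using t C(1) by (intro mult_mono) auto
        qed
        have "\<Theta> (x, t) y = \<tau>' t * (\<bar>?W - v y\<bar> * \<omega> (x - y)) + \<tau> t * (q f (v y) ?W * \<omega>' (x - y)) + \<tau> t * (sgn (?W - v y) * ?G * \<omega> (x - y))"
          using True by (simp add: \<Theta>_def i_def distrib_left)
        then have "\<bar>\<Theta> (x, t) y\<bar> \<le> C * (Z * (\<bar>?W\<bar> + \<bar>v y\<bar>) * K (x - y)) + C * (Z * (\<bar>?W\<bar> + \<bar>v y\<bar>) * K (x - y)) + C * (\<bar>?G\<bar> * K (x - y))"
          using 1 2 3 by linarith
        also have "\<dots> = (2 * C * Z * \<bar>?W\<bar> + C * \<bar>?G\<bar>) * K (x - y) + 2 * C * Z * (\<bar>v y\<bar> * (K (x - y) * i t))"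
          using True by (simp add: i_def algebra_simps)
        finally show ?thesis by linarith
      qed
    qed
  qed
  define R where "R t = indicator {0<..<T} t *
      (\<tau>' t * (LINT (x, y)|plane. \<bar>u x t - v y\<bar> * \<omega> (x - y))
       + \<tau> t * ((LINT (x, y)|plane. q f (v y) (u x t) * \<omega>' (x - y))
           + (LINT (x, y)|plane. sgn (u x t - v y) * frac_lap lam (\<lambda>x. u x t) x * \<omega> (x - y))))" for t
  define h where "h p = (LINT y|lborel. \<Theta> p y)" for p
  have hi: "integrable plane h"
    unfolding h_def[abs_def] using lborel_pair_real.integrable_fst'[OF \<Theta>i] by simp
  have h2i: "integrable plane (\<lambda>(t, x). h (x, t))"
    using lborel_pair.integrable_product_swap[OF hi] .
  have hR: "AE t in lborel. (LINT x|lborel. h (x, t)) = R t"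
    using M
  proof eventually_elim
    case (elim t)
    show ?case
    proof (cases "t \<in> {0<..<T}")
      case False
      then show ?thesis by (simp add: R_def h_def \<Theta>_def i_def)
    next
      case True
      then have L: "L1_lipschitz M (\<lambda>x. u x t)" using elim by auto
      note ui = L1_lipschitzD(1,2)[OF L]
      have um[measurable]: "(\<lambda>x. u x t) \<in> borel_measurable borel" by (rule ui(2))
      note i1 = abs_pair_conv[OF ui(1) v mD(8,5)]
      note i2 = q_pair_conv(1)[OF ui(1) v mD(9)]
      have sm: "(\<lambda>p. sgn (u (fst p) t - v (snd p))) \<in> borel_measurable plane" by measurable
      have "\<bar>sgn (u (fst p) t - v (snd p))\<bar> \<le> 1" for p by (auto simp: sgn_if)
      note i3 = conv_weighted_integrable[OF integrable_frac_lap[OF lam L] mD(8) sm this, of fst, simplified]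
      let ?E = "\<lambda>p. \<tau>' t * (\<bar>u (fst p) t - v (snd p)\<bar> * \<omega> (fst p - snd p))
        + \<tau> t * (q f (v (snd p)) (u (fst p) t) * \<omega>' (fst p - snd p) + sgn (u (fst p) t - v (snd p)) * frac_lap lam (\<lambda>x. u x t) (fst p) * \<omega> (fst p - snd p))"
      have E: "integrable plane ?E"
        using i1 i2 i3 by (simp add: case_prod_beta')
      have "(LINT x|lborel. h (x, t)) = (LINT x|lborel. LINT y|lborel. ?E (x, y))"
        using True by (simp add: h_def \<Theta>_def i_def wt gt)
      also have "\<dots> = (LINT p|plane. ?E p)"
        by (rule lborel_pair.integral_fst'[OF E])
      also have "\<dots> = R t"
        using i1 i2 i3 True by (simp add: R_def case_prod_beta')
      finally show ?thesis .
    qed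
  qed
  have hm: "(\<lambda>t. LINT x|lborel. h (x, t)) \<in> borel_measurable lborel" "integrable lborel (\<lambda>t. LINT x|lborel. h (x, t))"
    using lborel_pair.integrable_fst'[OF h2i] by auto
  \<comment> \<open>Agreement almost everywhere with a measurable function does not make
    \<open>R\<close> Borel measurable, so \<open>R\<close> is rewritten in terms of \<open>w\<close>
    and \<open>g\<close>.\<close>
  have Rm: "R \<in> borel_measurable lborel"
  proof -
    have "(\<lambda>t. i t * (\<tau>' t * (LINT p|plane. \<bar>w (fst p, t) - v (snd p)\<bar> * \<omega> (fst p - snd p))
       + \<tau> t * ((LINT p|plane. q f (v (snd p)) (w (fst p, t)) * \<omega>' (fst p - snd p))
           + (LINT p|plane. sgn (w (fst p, t) - v (snd p)) * g (fst p, t) * \<omega> (fst p - snd p))))) \<in> borel_measurable lborel"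
      by measurable
    moreover have "(\<lambda>t. i t * (\<tau>' t * (LINT p|plane. \<bar>w (fst p, t) - v (snd p)\<bar> * \<omega> (fst p - snd p))
       + \<tau> t * ((LINT p|plane. q f (v (snd p)) (w (fst p, t)) * \<omega>' (fst p - snd p))
           + (LINT p|plane. sgn (w (fst p, t) - v (snd p)) * g (fst p, t) * \<omega> (fst p - snd p))))) = R"
    proof
      fix t
      show "i t * (\<tau>' t * (LINT p|plane. \<bar>w (fst p, t) - v (snd p)\<bar> * \<omega> (fst p - snd p))
       + \<tau> t * ((LINT p|plane. q f (v (snd p)) (w (fst p, t)) * \<omega>' (fst p - snd p))
           + (LINT p|plane. sgn (w (fst p, t) - v (snd p)) * g (fst p, t) * \<omega> (fst p - snd p)))) = R t"
        by (cases "t \<in> {0<..<T}") (simp_all add: R_def i_def wt gt case_prod_beta')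
    qed
    ultimately show ?thesis by simp
  qed
  have Ri: "integrable lborel R"
    using integrable_cong_AE[OF hm(1) Rm hR] hm(2) by simp
  define J where "J y = (LINT p|plane. \<Theta> p y)" for y
  have Ji: "integrable lborel J"
    unfolding J_def[abs_def] using lborel_real_pair.integrable_fst'[OF lborel_pair_real.integrable_product_swap[OF \<Theta>i]] by simp
  have JR: "(LINT y|lborel. J y) = (LINT t|lborel. R t)"
  proof -
    have "(LINT y|lborel. J y) = (LINT p|plane. h p)"
      unfolding J_def h_def using lborel_pair_real.Fubini_integral[of \<Theta>] \<Theta>i by simp
    also have "\<dots> = (LINT (t, x)|plane. h (x, t))"
      using lborel_pair.integral_product_swap[OF borel_measurable_integrable[OF hi]] by simp
    also have "\<dots> = (LINT t|lborel. LINT x|lborel. h (x, t))"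
      using lborel_pair.integral_fst'[OF h2i] by simp
    also have "\<dots> = (LINT t|lborel. R t)"
      by (rule integral_cong_AE[OF hm(1) Rm hR])
    finally show ?thesis .
  qed
  have bd: "integrable lborel (\<lambda>y. LINT x|lborel. \<bar>z x - v y\<bar> * \<omega> (x - y))"
    "(LINT y|lborel. LINT x|lborel. \<bar>z x - v y\<bar> * \<omega> (x - y)) = (LINT (x, y)|plane. \<bar>z x - v y\<bar> * \<omega> (x - y))"
    if z: "integrable lborel z" for z :: "real \<Rightarrow> real"
  proof -
    note ip = abs_pair_conv[OF z v mD(8,5)]
    have isw: "integrable plane (\<lambda>(y, x). \<bar>z x - v y\<bar> * \<omega> (x - y))"
      using lborel_pair.integrable_product_swap[OF ip] by simp
    show "integrable lborel (\<lambda>y. LINT x|lborel. \<bar>z x - v y\<bar> * \<omega> (x - y))"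
      using lborel_pair.integrable_fst'[OF isw] by simp
    show "(LINT y|lborel. LINT x|lborel. \<bar>z x - v y\<bar> * \<omega> (x - y)) = (LINT (x, y)|plane. \<bar>z x - v y\<bar> * \<omega> (x - y))"
      using lborel_pair.integral_fst'[OF isw] lborel_pair.integral_product_swap[OF borel_measurable_integrable[OF ip]]
      by (simp add: case_prod_beta')
  qed
  have uT: "integrable lborel (\<lambda>x. u x T)"
    using sol T by (auto simp: BV_entropy_solution_def continuous_in_L1_def)
  have pos: "0 \<le> J y + \<tau> 0 * (LINT x|lborel. \<bar>u0 x - v y\<bar> * \<omega> (x - y)) - \<tau> T * (LINT x|lborel. \<bar>u x T - v y\<bar> * \<omega> (x - y))" for y
  proof -
    define \<phi> where "\<phi> = (\<lambda>(x, t). \<omega> (x - y) * \<tau> t)"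
    have "\<phi> \<in> test_functions T" unfolding \<phi>_def by (rule mollifier_test_function[OF T m Ck])
    moreover have "\<forall>p\<in>UNIV \<times> {0..T}. 0 \<le> \<phi> p" unfolding \<phi>_def using mD(5) nn by auto
    ultimately have e: "0 \<le> (LINT (x, t):Q T|lborel.
             eta (v y) (u x t) * deriv (\<lambda>s. \<phi> (x, s)) t
           + q f (v y) (u x t) * deriv (\<lambda>y. \<phi> (y, t)) x
           + eta' (v y) (u x t) * frac_lap lam (\<lambda>y. u y t) x * \<phi> (x, t))
        + (LINT x|lborel. eta (v y) (u0 x) * \<phi> (x, 0))
        - (LINT x|lborel. eta (v y) (u x T) * \<phi> (x, T))"
      using sol unfolding BV_entropy_solution_def by blast
    have d1: "deriv (\<lambda>s. \<phi> (x, s)) t = \<omega> (x - y) * \<tau>' t" for x t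
      unfolding \<phi>_def prod.case by (rule DERIV_imp_deriv) (rule DERIV_cmult[OF D])
    have d2: "deriv (\<lambda>x. \<phi> (x, t)) x = \<omega>' (x - y) * \<tau> t" for x t
      unfolding \<phi>_def prod.case
      by (rule DERIV_imp_deriv, rule DERIV_cmult_right, rule DERIV_cong[OF DERIV_chain2[where g="\<lambda>x. x - y" and Db=1, OF mD(2)]])
         (auto intro!: derivative_eq_intros)
    have "(LINT (x, t):Q T|lborel.
             eta (v y) (u x t) * deriv (\<lambda>s. \<phi> (x, s)) t
           + q f (v y) (u x t) * deriv (\<lambda>y. \<phi> (y, t)) x
           + eta' (v y) (u x t) * frac_lap lam (\<lambda>y. u y t) x * \<phi> (x, t)) = J y"
      unfolding J_def set_lebesgue_integral_def lborel_prod
    proof (rule Bochner_Integration.integral_cong[OF refl])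
      fix p :: "real \<times> real"
      obtain x t where p: "p = (x, t)" by (cases p)
      show "indicat_real (Q T) p *\<^sub>R (case p of (x, t) \<Rightarrow> eta (v y) (u x t) * deriv (\<lambda>s. \<phi> (x, s)) t
           + q f (v y) (u x t) * deriv (\<lambda>y. \<phi> (y, t)) x
           + eta' (v y) (u x t) * frac_lap lam (\<lambda>y. u y t) x * \<phi> (x, t)) = \<Theta> p y"
      proof (cases "t \<in> {0<..<T}")
        case True
        then show ?thesis unfolding p prod.case d1 d2
          by (simp add: \<Theta>_def i_def Q_def wt gt eta_def eta'_def \<phi>_def algebra_simps)
      next
        case False
        then show ?thesis unfolding p by (simp add: \<Theta>_def i_def Q_def)
      qed
    qed
    moreover have "(LINT x|lborel. eta (v y) (z x) * \<phi> (x, t)) = \<tau> t * (LINT x|lborel. \<bar>z x - v y\<bar> * \<omega> (x - y))" for z t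
    proof -
      have "(LINT x|lborel. eta (v y) (z x) * \<phi> (x, t)) = (LINT x|lborel. \<tau> t * (\<bar>z x - v y\<bar> * \<omega> (x - y)))"
        by (rule Bochner_Integration.integral_cong) (auto simp: eta_def \<phi>_def)
      then show ?thesis by simp
    qed
    ultimately show ?thesis using e by simp
  qed
  have "0 \<le> (LINT y|lborel. J y + \<tau> 0 * (LINT x|lborel. \<bar>u0 x - v y\<bar> * \<omega> (x - y)) - \<tau> T * (LINT x|lborel. \<bar>u x T - v y\<bar> * \<omega> (x - y)))"
    by (rule integral_nonneg_AE) (use pos in auto)
  also have "\<dots> = (LINT t|lborel. R t) + \<tau> 0 * (LINT (x, y)|plane. \<bar>u0 x - v y\<bar> * \<omega> (x - y))
      - \<tau> T * (LINT (x, y)|plane. \<bar>u x T - v y\<bar> * \<omega> (x - y))"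
    using Ji bd[OF u0] bd[OF uT] by (simp add: JR)
  finally show ?thesis using Ri unfolding R_def by blast
qed

end

section \<open>The error estimate\<close>

text \<open>After the substitution s = x - y the mollifier restricts s to |s| \<le> r, where
  translating w costs at most B r.\<close>

lemma mollified_self_distance:
  assumes m: "mollifier r \<omega> \<omega>'" and w: "L1_lipschitz B w"
  shows "(LINT p|plane. \<bar>w (fst p) - w (snd p)\<bar> * \<omega> (fst p - snd p)) \<le> B * r"
proof -
  note mD = mollifierD[OF m] and wD = L1_lipschitzD[OF w]
  have [measurable]: "w \<in> borel_measurable borel" "\<omega> \<in> borel_measurable borel" using wD mD by auto
  have hm: "(\<lambda>(s, y). \<bar>w (y + s) - w y\<bar> * \<omega> s) \<in> borel_measurable plane" by measurable
  have hb: "AE s in lborel. integrable lborel (\<lambda>y. case (s, y) of (s, y) \<Rightarrow> \<bar>w (y + s) - w y\<bar> * \<omega> s) \<and>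
      (LINT y|lborel. \<bar>case (s, y) of (s, y) \<Rightarrow> \<bar>w (y + s) - w y\<bar> * \<omega> s\<bar>) \<le> B * r * \<omega> s"
  proof (rule AE_I2)
    fix s
    have "(LINT y|lborel. \<bar>w (y + s) - w y\<bar>) * \<omega> s \<le> B * r * \<omega> s"
    proof (cases "r < \<bar>s\<bar>")
      case True
      then show ?thesis using mD(6) by simp
    next
      case False
      have "(LINT y|lborel. \<bar>w (y + s) - w y\<bar>) \<le> B * \<bar>s\<bar>" by (rule wD(3))
      also have "\<dots> \<le> B * r" using False wD(5) by (intro mult_left_mono) auto
      finally show ?thesis using mD(5)[of s] by (rule mult_right_mono)
    qed
    then show "integrable lborel (\<lambda>y. case (s, y) of (s, y) \<Rightarrow> \<bar>w (y + s) - w y\<bar> * \<omega> s) \<and>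
      (LINT y|lborel. \<bar>case (s, y) of (s, y) \<Rightarrow> \<bar>w (y + s) - w y\<bar> * \<omega> s\<bar>) \<le> B * r * \<omega> s"
      using wD(1) integrable_shift[OF wD(1), of s] mD(5)[of s] by (simp add: abs_mult)
  qed
  have bi: "integrable lborel (\<lambda>s. B * r * \<omega> s)" using mD(8) by simp
  have hi: "integrable plane (\<lambda>(s, y). \<bar>w (y + s) - w y\<bar> * \<omega> s)"
    by (rule lborel_pair.integrable_pair_bound[OF hm hb bi])
  have isw: "integrable plane (\<lambda>(y, x). \<bar>w x - w y\<bar> * \<omega> (x - y))"
    using lborel_pair.integrable_product_swap[OF abs_pair_conv[OF wD(1) wD(1) mD(8,5)]] by simp
  have "(LINT p|plane. \<bar>w (fst p) - w (snd p)\<bar> * \<omega> (fst p - snd p))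
      = (LINT (y, x)|plane. \<bar>w x - w y\<bar> * \<omega> (x - y))"
    using lborel_pair.integral_product_swap[OF borel_measurable_integrable[OF abs_pair_conv[OF wD(1) wD(1) mD(8,5)]]] by simp
  also have "\<dots> = (LINT y|lborel. LINT x|lborel. \<bar>w x - w y\<bar> * \<omega> (x - y))"
    using lborel_pair.integral_fst'[OF isw] by simp
  also have "\<dots> = (LINT y|lborel. LINT s|lborel. \<bar>w (y + s) - w y\<bar> * \<omega> s)"
  proof (rule Bochner_Integration.integral_cong[OF refl])
    fix y
    show "(LINT x|lborel. \<bar>w x - w y\<bar> * \<omega> (x - y)) = (LINT s|lborel. \<bar>w (y + s) - w y\<bar> * \<omega> s)"
      using integral_shift[of "\<lambda>x. \<bar>w x - w y\<bar> * \<omega> (x - y)" y] by (simp add: add.commute)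
  qed
  also have "\<dots> = (LINT s|lborel. LINT y|lborel. \<bar>w (y + s) - w y\<bar> * \<omega> s)"
    by (rule lborel_pair.Fubini_integral) (use hi in simp)
  also have "\<dots> = (LINT (s, y)|plane. \<bar>w (y + s) - w y\<bar> * \<omega> s)"
    using lborel_pair.integral_fst'[OF hi] by simp
  also have "\<dots> \<le> (LINT s|lborel. B * r * \<omega> s)"
    using lborel_pair.integral_pair_bound[OF hm hb bi] by linarith
  also have "\<dots> = B * r" using mD(7) by simp
  finally show ?thesis .
qed

lemma conv_snd_norm:
  assumes m: "mollifier r \<omega> \<omega>'" and P: "integrable lborel P"
  shows "integrable plane (\<lambda>p. \<bar>P (snd p)\<bar> * \<omega> (fst p - snd p))"
    "(LINT p|plane. \<bar>P (snd p)\<bar> * \<omega> (fst p - snd p)) = (L1norm P)"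
  using conv_snd[OF integrable_abs[OF P] mollifierD(8)[OF m]] mollifierD(7)[OF m] by (simp_all add: case_prod_beta')

lemma conv_fst_norm:
  assumes m: "mollifier r \<omega> \<omega>'" and P: "integrable lborel P"
  shows "integrable plane (\<lambda>p. \<bar>P (fst p)\<bar> * \<omega> (fst p - snd p))"
    "(LINT p|plane. \<bar>P (fst p)\<bar> * \<omega> (fst p - snd p)) = (L1norm P)"
  using conv_fst[OF integrable_abs[OF P] mollifierD(8)[OF m]] mollifierD(7)[OF m] by (simp_all add: case_prod_beta')

lemma mollified_distance_upper:
  assumes m: "mollifier r \<omega> \<omega>'" and w: "L1_lipschitz B w" and v: "integrable lborel v"
  shows "(LINT (x, y)|plane. \<bar>w x - v y\<bar> * \<omega> (x - y)) \<le> B * r + (LINT y|lborel. \<bar>w y - v y\<bar>)"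
proof -
  note mD = mollifierD[OF m] and wi = L1_lipschitzD(1)[OF w]
  have e: "integrable lborel (\<lambda>y. w y - v y)" using wi v by auto
  note i1 = abs_pair_conv[OF wi v mD(8,5)] and i2 = abs_pair_conv[OF wi wi mD(8,5)] and i3 = conv_snd_norm[OF m e]
  have "(LINT p|plane. \<bar>w (fst p) - v (snd p)\<bar> * \<omega> (fst p - snd p))
     \<le> (LINT p|plane. \<bar>w (fst p) - w (snd p)\<bar> * \<omega> (fst p - snd p) + \<bar>w (snd p) - v (snd p)\<bar> * \<omega> (fst p - snd p))"
  proof (rule integral_mono)
    show "\<bar>w (fst p) - v (snd p)\<bar> * \<omega> (fst p - snd p)
      \<le> \<bar>w (fst p) - w (snd p)\<bar> * \<omega> (fst p - snd p) + \<bar>w (snd p) - v (snd p)\<bar> * \<omega> (fst p - snd p)" for p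
      unfolding distrib_right[symmetric] by (rule mult_right_mono[OF _ mD(5)]) auto
  qed (use i1 i2 i3 in auto)
  also have "\<dots> \<le> B * r + (LINT y|lborel. \<bar>w y - v y\<bar>)"
    using i2 i3 mollified_self_distance[OF m w] by simp
  finally show ?thesis by (simp add: case_prod_beta')
qed

text \<open>Inserting v(x) charges the mollification to the grid function v: at t = T the solution
  is known to be integrable, while its variation is controlled for almost every t only.\<close>

lemma mollified_distance_lower:
  assumes m: "mollifier r \<omega> \<omega>'" and w: "integrable lborel w" and v: "L1_lipschitz B v"
  shows "(LINT x|lborel. \<bar>w x - v x\<bar>) \<le> (LINT (x, y)|plane. \<bar>w x - v y\<bar> * \<omega> (x - y)) + B * r"
proof -
  note mD = mollifierD[OF m] and vi = L1_lipschitzD(1)[OF v]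
  have e: "integrable lborel (\<lambda>x. w x - v x)" using w vi by auto
  note i1 = abs_pair_conv[OF w vi mD(8,5)] and i2 = abs_pair_conv[OF vi vi mD(8,5)] and i3 = conv_fst_norm[OF m e]
  have "(LINT p|plane. \<bar>w (fst p) - v (fst p)\<bar> * \<omega> (fst p - snd p))
     \<le> (LINT p|plane. \<bar>w (fst p) - v (snd p)\<bar> * \<omega> (fst p - snd p) + \<bar>v (fst p) - v (snd p)\<bar> * \<omega> (fst p - snd p))"
  proof (rule integral_mono)
    show "\<bar>w (fst p) - v (fst p)\<bar> * \<omega> (fst p - snd p)
      \<le> \<bar>w (fst p) - v (snd p)\<bar> * \<omega> (fst p - snd p) + \<bar>v (fst p) - v (snd p)\<bar> * \<omega> (fst p - snd p)" for p
      unfolding distrib_right[symmetric] by (rule mult_right_mono[OF _ mD(5)]) auto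
  qed (use i1 i2 i3 in auto)
  also have "\<dots> \<le> (LINT p|plane. \<bar>w (fst p) - v (snd p)\<bar> * \<omega> (fst p - snd p)) + B * r"
    using i1 i2 mollified_self_distance[OF m v] by simp
  finally show ?thesis using i3 by (simp add: case_prod_beta')
qed

lemma L1_lipschitz_mono: "L1_lipschitz M w \<Longrightarrow> M \<le> M' \<Longrightarrow> L1_lipschitz M' w"
  unfolding L1_lipschitz_def by (meson abs_ge_zero mult_right_mono order_trans)

text \<open>Here \<open>A\<close> and \<open>B\<close> bound the norm and the variation of the data, \<open>C\<close> the speed of the scheme in \<open>L\<^sup>1\<close>,
  \<open>H\<close> and \<open>H'\<close> the fractional Laplacians of the scheme and of the solution, and \<open>\<Omega>\<close> is the
  \<open>L\<^sup>1\<close> norm of the derivative of the mollifier of width \<open>1\<close>.\<close>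

definition rate_const :: "real \<Rightarrow> real \<Rightarrow> real \<Rightarrow> real \<Rightarrow> real \<Rightarrow> real \<Rightarrow> real \<Rightarrow> real \<Rightarrow> real \<Rightarrow> real" where
  "rate_const F1 F2 A B C H H' \<Omega> T =
     4 * B + 2 * A + T * (\<Omega> * (C + (F1 + 4 * F2) * B + 2 * H))
       + 2 * (C + 2 * (F1 + F2) * B + H') * sqrt (T / (F1 + F2))"

context grid_scheme
begin

text \<open>Mollifying costs B r at time 0, charged to u0, and B r at time T, charged to the scheme.
  The last two terms are the source and the Poisson deviation from
  \<open>time_stepping_duality\<close>.\<close>

lemma error_estimate:
  assumes T: "T = real N * h" "0 < T" and sol: "BV_entropy_solution lam T f u0 u"
    and M: "AE t in lborel. t \<in> {0<..<T} \<longrightarrow> (LINT x|lborel. \<bar>u x t\<bar>) \<le> M \<and> L1_lipschitz M (\<lambda>x. u x t)" and M0: "0 \<le> M"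
    and u0: "L1_lipschitz B u0"
    and adm: "admissible_states N (L1norm u0) B C R U" and C: "0 \<le> C" and R: "0 \<le> R"
    and m: "mollifier r \<omega> \<omega>'" and r: "0 < r"
  shows "(LINT x|lborel. \<bar>u x T - step_fun d (U N) x\<bar>)
    \<le> 2 * B * r + (LINT y|lborel. \<bar>u0 y - step_fun d (U 0) y\<bar>)
      + ((L1norm \<omega>') * ((F1 + F2) * (h * C) + (F1 + 4 * F2) * B * d + 2 * frac_bound lam (L1norm u0) B * d) + R) * T
      + 2 * (C + 2 * (F1 + F2) * B + frac_bound lam M M) * (h * sqrt (real N))"
proof -
  let ?A = "LINT x|lborel. \<bar>u0 x\<bar>"
  let ?v = "\<lambda>n. step_fun d (U n)"
  note mD = mollifierD[OF m]
  have N: "0 < N" using T h by (cases N) auto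
  have Un: "abs_summable (U n)" "d * (l1norm (U n)) \<le> ?A" "(jump_sum (U n)) \<le> B" if "n \<le> N" for n
    using adm that unfolding admissible_states_def by auto
  have st: "perturbed_step R (U n) (U (Suc n))" "d * (\<Sum>\<^sub>\<infinity>i. \<bar>U (Suc n) i - U n i\<bar>) \<le> h * C" if "n < N" for n
    using adm that unfolding admissible_states_def by auto
  have vi: "integrable lborel (?v n)" if "n \<le> N" for n by (rule integrable_step_fun[OF d Un(1)[OF that]])
  have vL: "L1_lipschitz B (?v n)" if "n \<le> N" for n
    by (rule L1_lipschitz_mono[OF step_fun_L1_lipschitz[OF d Un(1)[OF that]] Un(3)[OF that]])
  have B0: "0 \<le> B" using L1_lipschitzD(5)[OF u0] .
  have dv: "(LINT y|lborel. \<bar>?v (Suc n) y - ?v n y\<bar>) \<le> h * C" if n: "n < N" for n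
  proof -
    have "(\<lambda>i. \<bar>U (Suc n) i - U n i\<bar>) summable_on UNIV"
      by (rule abs_summable_diff) (use Un(1)[of n] Un(1)[of "Suc n"] n in auto)
    from step_fun_L1_norm[OF d this] st(2)[OF n] show ?thesis by (simp add: step_fun_def)
  qed
  have dv0: "(LINT y|lborel. \<bar>u0 y - ?v n y\<bar>) \<le> (LINT y|lborel. \<bar>u0 y - ?v 0 y\<bar>) + real n * h * C" if "n \<le> N" for n
    using that
  proof (induction n)
    case (Suc n)
    note ui = L1_lipschitzD(1)[OF u0]
    have "(LINT y|lborel. \<bar>u0 y - ?v (Suc n) y\<bar>) \<le> (LINT y|lborel. \<bar>u0 y - ?v n y\<bar> + \<bar>?v (Suc n) y - ?v n y\<bar>)"
      by (rule integral_mono) (use ui vi[of n] vi[of "Suc n"] Suc.prems in auto)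
    also have "\<dots> = (LINT y|lborel. \<bar>u0 y - ?v n y\<bar>) + (LINT y|lborel. \<bar>?v (Suc n) y - ?v n y\<bar>)"
      by (rule Bochner_Integration.integral_add) (use ui vi[of n] vi[of "Suc n"] Suc.prems in auto)
    also have "\<dots> \<le> (LINT y|lborel. \<bar>u0 y - ?v 0 y\<bar>) + real n * h * C + h * C"
      using Suc dv[of n] by auto
    finally show ?case by (simp add: algebra_simps)
  qed simp
  define a where "a n t = (LINT (x, y)|plane. \<bar>u x t - ?v n y\<bar> * \<omega> (x - y))" for n t
  define b where "b n t = (LINT (x, y)|plane. q f (?v n y) (u x t) * \<omega>' (x - y))
     + (LINT (x, y)|plane. sgn (u x t - ?v n y) * frac_lap lam (\<lambda>x. u x t) x * \<omega> (x - y))" for n t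
  define a0 where "a0 n = (LINT (x, y)|plane. \<bar>u0 x - ?v n y\<bar> * \<omega> (x - y))" for n
  define \<Omega> where "\<Omega> = (L1norm \<omega>')"
  define E where "E = \<Omega> * ((F1 + F2) * (h * C) + (F1 + 4 * F2) * B * d + 2 * frac_bound lam ?A B * d) + R"
  \<comment> \<open>One constant for two tasks: the speed of the scheme, by which a_n(0) drifts away
    from a_0(0), and the bound of \<open>b 0\<close>, where no discrete inequality is
    available.\<close>
  define C' where "C' = C + 2 * (F1 + F2) * B + frac_bound lam M M"
  have fb: "0 \<le> frac_bound lam ?A B" "0 \<le> frac_bound lam M M"
    unfolding frac_bound_def using frac_const_nonneg kernel_mass_nonneg B0 M0 by (auto intro!: mult_nonneg_nonneg add_nonneg_nonneg)
  have E0: "0 \<le> E" unfolding E_def \<Omega>_def using R C B0 fb F1_pos F2_pos d h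
    by (auto intro!: mult_nonneg_nonneg add_nonneg_nonneg)
  have C'0: "0 \<le> C'" "C \<le> C'" unfolding C'_def using C B0 fb F1_pos F2_pos by auto
  have "(LINT (x, y)|plane. \<bar>u x T - ?v N y\<bar> * \<omega> (x - y))
      \<le> (B * r + (LINT y|lborel. \<bar>u0 y - ?v 0 y\<bar>)) + E * T + 2 * C' * (h * sqrt (real N))"
  proof (rule time_stepping_duality[OF h N T(1), where a=a and b=b and ?a0.0=a0])
    fix n \<tau> \<tau>'
    assume n: "n \<le> N" and \<tau>: "\<And>k. Ck k \<tau>" "\<And>t. (\<tau> has_real_derivative \<tau>' t) (at t)" "\<And>t. t \<in> {0..T} \<Longrightarrow> 0 \<le> \<tau> t"
    show "integrable lborel (\<lambda>t. indicator {0<..<T} t * (\<tau>' t * a n t + \<tau> t * b n t)) \<and>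
        0 \<le> (LINT t|lborel. indicator {0<..<T} t * (\<tau>' t * a n t + \<tau> t * b n t)) + \<tau> 0 * a0 n
          - \<tau> T * (LINT (x, y)|plane. \<bar>u x T - ?v n y\<bar> * \<omega> (x - y))"
      unfolding a_def b_def a0_def
      by (rule entropy_weak_form[OF lam T(2) sol L1_lipschitzD(1)[OF u0] m vi[OF n] \<tau>])
  next
    show "AE t in lborel. t \<in> {0<..<T} \<longrightarrow> (\<forall>n<N. b (Suc n) t + (a (Suc n) t - a n t) / h \<le> E)"
      using M
    proof eventually_elim
      case (elim t)
      show ?case
      proof (intro impI allI)
        fix n assume t: "t \<in> {0<..<T}" and n: "n < N"
        then have L: "L1_lipschitz M (\<lambda>x. u x t)" using elim by auto
        obtain \<rho> where \<rho>: "abs_summable \<rho>" "d * (l1norm \<rho>) \<le> R"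
          "\<And>i. U (Suc n) i = U n i - h * D_minus_flux F d (U n) i + h * disc_frac_lap lam d (U (Suc n)) i + h * \<rho> i"
          using st(1)[OF n] unfolding perturbed_step_def by blast
        have nn: "n \<le> N" "Suc n \<le> N" using n by auto
        note gs = disc_frac_lap_abs_summable(1)[OF lam d Un(1)[OF nn(2)]]
        note fb' = frac_lap_step_frac_bound[OF Un[OF nn(2)]]
        show "b (Suc n) t + (a (Suc n) t - a n t) / h \<le> E"
          unfolding a_def b_def E_def \<Omega>_def
        proof (rule spatial_step[OF lam m d h L _ _ vL[OF nn(1)] vL[OF nn(2)] dv[OF n],
              where V="U n" and V'="U (Suc n)" and gd="disc_frac_lap lam d (U (Suc n))" and \<rho>=\<rho>])
          show "?v n = (\<lambda>y. U n \<lfloor>y / d\<rfloor>)" "?v (Suc n) = (\<lambda>y. U (Suc n) \<lfloor>y / d\<rfloor>)"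
            by (auto simp: step_fun_def)
          show "integrable lborel (\<lambda>y. \<rho> \<lfloor>y / d\<rfloor>)" "(LINT y|lborel. \<bar>\<rho> \<lfloor>y / d\<rfloor>\<bar>) \<le> R"
            using integrable_step_fun[OF d \<rho>(1)] step_fun_L1_norm[OF d \<rho>(1)] \<rho>(2) by (simp_all add: step_fun_def[abs_def])
          show "integrable lborel (\<lambda>y. disc_frac_lap lam d (U (Suc n)) \<lfloor>y / d\<rfloor>)"
            "(LINT y|lborel. \<bar>disc_frac_lap lam d (U (Suc n)) \<lfloor>y / d\<rfloor>\<bar>) \<le> frac_bound lam ?A B"
            using integrable_step_fun[OF d gs] step_fun_L1_norm[OF d gs] fb'(2) by (simp_all add: step_fun_def[abs_def])
          show "d * disc_frac_lap lam d (U (Suc n)) i = (LINT y:cell d i|lborel. frac_lap lam (?v (Suc n)) y)" for i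
            by (rule disc_frac_lap_average[OF lam d Un(1)[OF nn(2)]])
          show "(LINT y|lborel. \<bar>frac_lap lam (?v (Suc n)) y\<bar>) \<le> frac_bound lam ?A B" by (rule fb'(1))
          show "\<bar>U (Suc n) i - k\<bar> \<le> \<bar>U n i - k\<bar>
            - h / d * (entropy_flux F (U n i) (U n (i + 1)) k k - entropy_flux F (U n (i - 1)) (U n i) k k)
            + h * (sgn (U (Suc n) i - k) * disc_frac_lap lam d (U (Suc n)) i) + h * \<bar>\<rho> i\<bar>" for k i
            by (rule perturbed_step_entropy[OF \<rho>(3)])
        qed
      qed
    qed
  next
    show "AE t in lborel. t \<in> {0<..<T} \<longrightarrow> b 0 t \<le> C'"
      using M
    proof eventually_elim
      case (elim t)
      show ?case
      proof
        assume t: "t \<in> {0<..<T}"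
        then have L: "L1_lipschitz M (\<lambda>x. u x t)" and M1: "(LINT x|lborel. \<bar>u x t\<bar>) \<le> M" using elim by auto
        note fi = integrable_frac_lap[OF lam L]
        have "(LINT (x, y)|plane. q f (?v 0 y) (u x t) * \<omega>' (x - y)) \<le> 2 * (F1 + F2) * B"
          using mollified_flux_bound[OF m L1_lipschitzD(1)[OF L] vL[of 0]] by simp
        moreover have "(LINT (x, y)|plane. sgn (u x t - ?v 0 y) * frac_lap lam (\<lambda>x. u x t) x * \<omega> (x - y)) \<le> frac_bound lam M M"
        proof -
          have sm: "(\<lambda>p. sgn (u (fst p) t - ?v 0 (snd p))) \<in> borel_measurable plane"
            using L1_lipschitzD(2)[OF L] by measurable
          have s1: "\<bar>sgn (u (fst p) t - ?v 0 (snd p))\<bar> \<le> 1" for p by (auto simp: sgn_if)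
          note i = conv_weighted_integrable[OF fi mD(8) sm s1, of fst, simplified]
          note cn = conv_fst_norm[OF m fi]
          have "(LINT p|plane. sgn (u (fst p) t - ?v 0 (snd p)) * frac_lap lam (\<lambda>x. u x t) (fst p) * \<omega> (fst p - snd p))
              \<le> (LINT p|plane. \<bar>frac_lap lam (\<lambda>x. u x t) (fst p)\<bar> * \<omega> (fst p - snd p))"
          proof (rule integral_mono[OF i cn(1)])
            show "sgn (u (fst p) t - ?v 0 (snd p)) * frac_lap lam (\<lambda>x. u x t) (fst p) * \<omega> (fst p - snd p)
              \<le> \<bar>frac_lap lam (\<lambda>x. u x t) (fst p)\<bar> * \<omega> (fst p - snd p)" for p
              by (rule mult_right_mono[OF _ mD(5)]) (auto simp: sgn_if abs_le_iff)
          qed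
          also have "\<dots> \<le> frac_const lam * ((M + 2 * (LINT x|lborel. \<bar>u x t\<bar>)) * kernel_mass lam)"
            unfolding cn(2) by (rule frac_lap_L1_bound[OF lam L])
          also have "\<dots> \<le> frac_bound lam M M"
            unfolding frac_bound_def using M1
            by (intro mult_left_mono mult_right_mono add_left_mono frac_const_nonneg kernel_mass_nonneg) auto
          finally show ?thesis by (simp add: case_prod_beta')
        qed
        ultimately show "b 0 t \<le> C'" unfolding b_def C'_def using C by linarith
      qed
    qed
  next
    fix n assume n: "n \<le> N"
    have "a0 n \<le> B * r + (LINT y|lborel. \<bar>u0 y - ?v n y\<bar>)"
      unfolding a0_def by (rule mollified_distance_upper[OF m u0 vi[OF n]])
    also have "\<dots> \<le> (B * r + (LINT y|lborel. \<bar>u0 y - ?v 0 y\<bar>)) + real n * h * C" using dv0[OF n] by simp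
    also have "real n * h * C \<le> C' * (real n * h)"
      using C'0 h mult_right_mono[of C C' "real n * h"] by (simp add: mult_ac)
    finally show "a0 n \<le> (B * r + (LINT y|lborel. \<bar>u0 y - ?v 0 y\<bar>)) + C' * (real n * h)" by simp
  qed (fact E0, fact C'0(1))
  moreover have "integrable lborel (\<lambda>x. u x T)"
    using sol T by (auto simp: BV_entropy_solution_def continuous_in_L1_def)
  ultimately show ?thesis
    using mollified_distance_lower[OF m _ vL[of N], of "\<lambda>x. u x T"]
    unfolding E_def C'_def \<Omega>_def by simp
qed

lemma convergence_rate:
  assumes T: "T = real N * h" "0 < T" and sol: "BV_entropy_solution lam T f u0 u"
    and M: "AE t in lborel. t \<in> {0<..<T} \<longrightarrow> (LINT x|lborel. \<bar>u x t\<bar>) \<le> M \<and> L1_lipschitz M (\<lambda>x. u x t)" and M0: "0 \<le> M"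
    and u0: "L1_lipschitz B u0" and U0: "U 0 = initial_averages d u0"
    and adm: "admissible_states N (L1norm u0) B C R U" and C: "0 \<le> C" and R: "0 \<le> R"
    and m: "mollifier 1 \<omega> \<omega>'"
  shows "L1_dist (\<lambda>x. u x T) (\<lambda>x. interpolation d h U x T)
    \<le> ennreal (rate_const F1 F2 (L1norm u0) B C (frac_bound lam (L1norm u0) B) (frac_bound lam M M) (L1norm \<omega>') T * sqrt d + R * T)"
proof -
  let ?A = "LINT x|lborel. \<bar>u0 x\<bar>"
  let ?\<Omega> = "LINT x|lborel. \<bar>\<omega>' x\<bar>"
  let ?v = "\<lambda>n. step_fun d (U n)"
  \<comment> \<open>Balances the mollification error of order r and the consistency error of order d
    / r.\<close>
  define r where "r = sqrt d"
  have r: "0 < r" "r * r = d" using d by (auto simp: r_def)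
  define L where "L = F1 + F2"
  have L: "0 < L" using F1_pos F2_pos by (simp add: L_def)
  have B0: "0 \<le> B" using L1_lipschitzD(5)[OF u0] .
  have fb: "0 \<le> frac_bound lam ?A B" "0 \<le> frac_bound lam M M"
    unfolding frac_bound_def using frac_const_nonneg kernel_mass_nonneg B0 M0 by (auto intro!: mult_nonneg_nonneg add_nonneg_nonneg)
  have hd: "L * h \<le> d" using cfl d by (simp add: L_def field_simps)
  note ms = mollifier_scale[OF m r(1)]
  \<comment> \<open>The constant has to serve coarse grids too: for d > 1 the bound 2 B d exceeds
    the order sqrt d, and the L^1 norms of both functions are used instead.\<close>
  have v0: "(LINT y|lborel. \<bar>u0 y - ?v 0 y\<bar>) \<le> (2 * ?A + 2 * B) * r"
  proof (cases "d \<le> 1")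
    case True
    then have "r \<le> 1" by (simp add: r_def)
    then have "d \<le> r" using r mult_left_mono[of r 1 r] by simp
    then have "2 * B * d \<le> 2 * B * r" using B0 by (intro mult_left_mono) auto
    moreover have "0 \<le> 2 * ?A * r" using r by simp
    moreover have "(LINT y|lborel. \<bar>u0 y - ?v 0 y\<bar>) \<le> 2 * B * d"
      unfolding U0 by (rule initial_averages_error(4)[OF d u0])
    ultimately show ?thesis unfolding distrib_right by linarith
  next
    case False
    then have r1: "1 \<le> r" by (simp add: r_def)
    have s: "abs_summable (U 0)" "d * (l1norm (U 0)) \<le> ?A"
      using initial_averages_error(1,2)[OF d u0] by (simp_all add: U0)
    have "(LINT y|lborel. \<bar>u0 y - ?v 0 y\<bar>) \<le> (LINT y|lborel. \<bar>u0 y\<bar> + \<bar>?v 0 y\<bar>)"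
      by (rule integral_mono) (use L1_lipschitzD(1)[OF u0] integrable_step_fun[OF d s(1)] in auto)
    also have "\<dots> \<le> 2 * ?A"
      using L1_lipschitzD(1)[OF u0] integrable_step_fun[OF d s(1)] step_fun_L1_norm[OF d s(1)] s(2) by simp
    also have "\<dots> \<le> 2 * ?A * r" using r1 mult_left_mono[of 1 r "2 * ?A"] by simp
    also have "\<dots> \<le> (2 * ?A + 2 * B) * r" using B0 r by (intro mult_right_mono) auto
    finally show ?thesis .
  qed
  \<comment> \<open>T = N h makes the left side sqrt(h T), and the CFL condition bounds h by d /
    L.\<close>
  have hN: "h * sqrt (real N) \<le> sqrt (T / L) * r"
  proof -
    have "h * sqrt (real N) = sqrt (h * T)"
      using h by (simp add: T(1) real_sqrt_mult mult.left_commute[of "sqrt h"])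
    also have "\<dots> \<le> sqrt (T / L * d)"
      using hd L T(2) by (intro real_sqrt_le_mono) (simp add: field_simps mult_left_mono)
    also have "\<dots> = sqrt (T / L) * r" by (simp only: r_def real_sqrt_mult)
    finally show ?thesis .
  qed
  have main: "(?\<Omega> / r) * ((F1 + F2) * (h * C) + (F1 + 4 * F2) * B * d + 2 * frac_bound lam ?A B * d)
      \<le> ?\<Omega> * (C + (F1 + 4 * F2) * B + 2 * frac_bound lam ?A B) * r"
  proof -
    have "(F1 + F2) * (h * C) \<le> d * C" using hd C mult_right_mono[of "L * h" d C] by (simp add: L_def mult.assoc)
    then have "(?\<Omega> / r) * ((F1 + F2) * (h * C) + (F1 + 4 * F2) * B * d + 2 * frac_bound lam ?A B * d)
      \<le> (?\<Omega> / r) * ((C + (F1 + 4 * F2) * B + 2 * frac_bound lam ?A B) * (r * r))"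
      using r by (intro mult_left_mono) (auto simp: algebra_simps)
    then show ?thesis using r(1) by simp
  qed
  have "(LINT x|lborel. \<bar>u x T - ?v N x\<bar>)
    \<le> 2 * B * r + (LINT y|lborel. \<bar>u0 y - ?v 0 y\<bar>)
      + ((?\<Omega> / r) * ((F1 + F2) * (h * C) + (F1 + 4 * F2) * B * d + 2 * frac_bound lam ?A B * d) + R) * T
      + 2 * (C + 2 * (F1 + F2) * B + frac_bound lam M M) * (h * sqrt (real N))"
    using error_estimate[where U=U and u=u, OF T sol M M0 u0 adm C R ms(1) r(1)] unfolding ms(2) .
  also have "\<dots> \<le> 2 * B * r + (2 * ?A + 2 * B) * r
      + (?\<Omega> * (C + (F1 + 4 * F2) * B + 2 * frac_bound lam ?A B) * r + R) * T
      + 2 * (C + 2 * (F1 + F2) * B + frac_bound lam M M) * (sqrt (T / L) * r)"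
    using v0 main hN T(2) C B0 fb F1_pos F2_pos
    by (intro add_mono mult_left_mono mult_right_mono order_refl) (auto intro!: add_nonneg_nonneg mult_nonneg_nonneg)
  also have "\<dots> = rate_const F1 F2 ?A B C (frac_bound lam ?A B) (frac_bound lam M M) ?\<Omega> T * sqrt d + R * T"
    unfolding rate_const_def L_def[symmetric] r_def[symmetric] by (simp add: algebra_simps)
  finally have le: "(LINT x|lborel. \<bar>u x T - ?v N x\<bar>) \<le> rate_const F1 F2 ?A B C (frac_bound lam ?A B) (frac_bound lam M M) ?\<Omega> T * sqrt d + R * T" .
  have "T / h = real N" using T h by simp
  then have interp: "interpolation d h U x T = ?v N x" for x
    by (simp add: interpolation_def step_fun_def)
  have "integrable lborel (\<lambda>x. u x T)"
    using sol T by (auto simp: BV_entropy_solution_def continuous_in_L1_def)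
  moreover have "abs_summable (U N)" using adm unfolding admissible_states_def by auto
  ultimately have "integrable lborel (\<lambda>x. \<bar>u x T - ?v N x\<bar>)"
    using integrable_step_fun[OF d] by auto
  then have "L1_dist (\<lambda>x. u x T) (\<lambda>x. interpolation d h U x T) = ennreal (LINT x|lborel. \<bar>u x T - ?v N x\<bar>)"
    unfolding L1_dist_def interp by (rule nn_integral_eq_integral) simp
  then show ?thesis using le by (simp add: ennreal_leI)
qed

end

theorem theorem4p4:
  fixes lam T F1 F2 :: real
    and f u0 :: "real \<Rightarrow> real"
    and F :: "real \<Rightarrow> real \<Rightarrow> real"
    and u :: "real \<Rightarrow> real \<Rightarrow> real"
  assumes "0 < lam" and "lam < 1" and "T > 0"
    and "\<exists>L. L-lipschitz_on UNIV f"
    and "numerical_flux f F"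
    and "F1 > 0" and "\<And>b. F1-lipschitz_on UNIV (\<lambda>a. F a b)"
    and "F2 > 0" and "\<And>a. F2-lipschitz_on UNIV (\<lambda>b. F a b)"
    and "u0 \<in> BV"
    and "BV_entropy_solution lam T f u0 u"
  shows "(\<exists>c>0. \<forall>\<Delta>x>0. \<forall>\<Delta>t>0. \<forall>N::nat. \<forall>U.
            T = real N * \<Delta>t \<longrightarrow>
            (F1 + F2) * (\<Delta>t / \<Delta>x) \<le> 1 \<longrightarrow>
            imex_solution lam F u0 \<Delta>x \<Delta>t N U \<longrightarrow>
            L1_dist (\<lambda>x. u x T) (\<lambda>x. interpolation \<Delta>x \<Delta>t U x T)
              \<le> ennreal (c * sqrt \<Delta>x))
       \<and> (\<exists>c>0. \<forall>\<Delta>x>0. \<forall>\<Delta>t>0. \<forall>N::nat. \<forall>U.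
            T = real N * \<Delta>t \<longrightarrow>
            (F1 + F2) * (\<Delta>t / \<Delta>x) + d_const lam * (\<Delta>t / \<Delta>x powr lam) \<le> 1 \<longrightarrow>
            explicit_solution lam F u0 \<Delta>x \<Delta>t N U \<longrightarrow>
            L1_dist (\<lambda>x. u x T) (\<lambda>x. interpolation \<Delta>x \<Delta>t U x T)
              \<le> ennreal (c * (sqrt \<Delta>x + \<Delta>x powr (1 - lam))))"
proof -
  note lam = assms(1,2) and T = assms(3) and sol = assms(11)
  interpret monotone_flux f F F1 F2
    by standard (use assms in auto)
  obtain M where M: "0 \<le> M"
    "AE t in lborel. t \<in> {0<..<T} \<longrightarrow> (LINT x|lborel. \<bar>u x t\<bar>) \<le> M \<and> L1_lipschitz M (\<lambda>x. u x t)"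
    using entropy_solution_slices[OF sol] by auto
  obtain B where u0: "L1_lipschitz B u0" using BV_L1_lipschitz[OF assms(10)] by auto
  obtain \<omega> \<omega>' where m: "mollifier 1 \<omega> \<omega>'" using mollifier_exists by auto
  define A where "A = (L1norm u0)"
  define C where "C = (F1 + F2) * B + frac_bound lam A B"
  define K where "K = rate_const F1 F2 A B C (frac_bound lam A B) (frac_bound lam M M) (L1norm \<omega>') T"
  define R where "R = 2 * d_const lam / (F1 + F2) * C"
  have C0: "0 \<le> C"
    unfolding C_def A_def frac_bound_def
    using frac_const_nonneg kernel_mass_nonneg L1_lipschitzD(5)[OF u0] F1_pos F2_pos
    by (auto intro!: mult_nonneg_nonneg add_nonneg_nonneg)
  have R0: "0 \<le> R" unfolding R_def using C0 d_const_nonneg[OF lam] F1_pos F2_pos by simp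
  show ?thesis
  proof
    show "\<exists>c>0. \<forall>\<Delta>x>0. \<forall>\<Delta>t>0. \<forall>N::nat. \<forall>U. T = real N * \<Delta>t \<longrightarrow> (F1 + F2) * (\<Delta>t / \<Delta>x) \<le> 1 \<longrightarrow>
        imex_solution lam F u0 \<Delta>x \<Delta>t N U \<longrightarrow>
        L1_dist (\<lambda>x. u x T) (\<lambda>x. interpolation \<Delta>x \<Delta>t U x T) \<le> ennreal (c * sqrt \<Delta>x)"
    \<comment> \<open>\<open>K\<close> may vanish, for zero data and solution say; the maximum with
      1 makes the constant positive. It is fixed before the grid.\<close>
    proof (rule exI[of _ "max K 1"], intro conjI allI impI)
      fix d h :: real and N :: nat and U
      assume d: "0 < d" and h: "0 < h" and N: "T = real N * h" and cfl: "(F1 + F2) * (h / d) \<le> 1"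
        and U: "imex_solution lam F u0 d h N U"
      interpret grid_scheme f F F1 F2 lam d h by standard (use lam d h cfl in auto)
      have U0: "U 0 = initial_averages d u0" using U by (simp add: imex_solution_def)
      have "L1_dist (\<lambda>x. u x T) (\<lambda>x. interpolation d h U x T) \<le> ennreal (K * sqrt d + 0 * T)"
        unfolding K_def A_def
        by (rule convergence_rate[where U=U and u=u, OF N T sol M(2,1) u0 U0 _ C0 _ m])
           (use imex_admissible[OF U u0] in \<open>simp_all add: C_def A_def\<close>)
      also have "\<dots> \<le> ennreal (max K 1 * sqrt d)"
        using d by (intro ennreal_leI) (simp add: mult_right_mono)
      finally show "L1_dist (\<lambda>x. u x T) (\<lambda>x. interpolation d h U x T) \<le> ennreal (max K 1 * sqrt d)" .
    qed simp
    show "\<exists>c>0. \<forall>\<Delta>x>0. \<forall>\<Delta>t>0. \<forall>N::nat. \<forall>U. T = real N * \<Delta>t \<longrightarrow>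
        (F1 + F2) * (\<Delta>t / \<Delta>x) + d_const lam * (\<Delta>t / \<Delta>x powr lam) \<le> 1 \<longrightarrow>
        explicit_solution lam F u0 \<Delta>x \<Delta>t N U \<longrightarrow>
        L1_dist (\<lambda>x. u x T) (\<lambda>x. interpolation \<Delta>x \<Delta>t U x T) \<le> ennreal (c * (sqrt \<Delta>x + \<Delta>x powr (1 - lam)))"
    proof (rule exI[of _ "max (max K 1) (R * T)"], intro conjI allI impI)
      fix d h :: real and N :: nat and U
      assume d: "0 < d" and h: "0 < h" and N: "T = real N * h"
        and cfl_d: "(F1 + F2) * (h / d) + d_const lam * (h / d powr lam) \<le> 1"
        and U: "explicit_solution lam F u0 d h N U"
      have "0 \<le> d_const lam * (h / d powr lam)" using d_const_nonneg[OF lam] h by simp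
      then have cfl: "(F1 + F2) * (h / d) \<le> 1" using cfl_d by linarith
      interpret grid_scheme f F F1 F2 lam d h by standard (use lam d h cfl in auto)
      have U0: "U 0 = initial_averages d u0" using U by (simp add: explicit_solution_def)
      have Rd: "0 \<le> R * d powr (1 - lam)" using R0 by simp
      have "L1_dist (\<lambda>x. u x T) (\<lambda>x. interpolation d h U x T) \<le> ennreal (K * sqrt d + R * d powr (1 - lam) * T)"
        unfolding K_def A_def
        by (rule convergence_rate[where U=U and u=u, OF N T sol M(2,1) u0 U0 _ C0 Rd m])
           (use explicit_admissible[OF U u0 cfl_d] in \<open>simp add: C_def A_def R_def\<close>)
      also have "\<dots> \<le> ennreal (max (max K 1) (R * T) * (sqrt d + d powr (1 - lam)))"
      proof (rule ennreal_leI)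
        have "K * sqrt d \<le> max (max K 1) (R * T) * sqrt d" using d by (intro mult_right_mono) auto
        moreover have "R * T * d powr (1 - lam) \<le> max (max K 1) (R * T) * d powr (1 - lam)" by (intro mult_right_mono) auto
        ultimately show "K * sqrt d + R * d powr (1 - lam) * T \<le> max (max K 1) (R * T) * (sqrt d + d powr (1 - lam))"
          by (simp add: distrib_left mult_ac)
      qed
      finally show "L1_dist (\<lambda>x. u x T) (\<lambda>x. interpolation d h U x T) \<le> ennreal (max (max K 1) (R * T) * (sqrt d + d powr (1 - lam)))" .
    qed simp
  qed
qed

end
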